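(* Let $(\Sigma,\sigma)$ be a topologically mixing countable Markov shift and let the potential $\mathcal{F}=\{f_n\}_{n=1}^{\infty}$ on $\Sigma$ be almost-additive and summable with bounded variation. For $t>1$ let $\mu_{t\mathcal{F}}$ be the (unique) equilibrium state for $t\mathcal{F}$, and let $\mu_\infty\in\mathcal{M}$ be an accumulation point of the family $(\mu_{t\mathcal{F}})_{t>1}$ as $t\to\infty$. Then $$\lim_{t\to\infty}h(\mu_{t\mathcal{F}})=h(\mu_\infty)=\sup\{h(\mu):\mu\in\mathcal{M}_{\max}(\mathcal{F})\},$$ where $\mathcal{M}_{\max}(\mathcal{F})$ denotes the set of maximising measures for $\mathcal{F}$.
   Context: Countable Markov shift: the alphabet is $\mathcal{A}=\mathbb{N}=\{1,2,\dots\}$, $\mathbf{M}=(M_{ij})_{\mathcal{A}\times\mathcal{A}}$ is a matrix of zeros and ones with no zero row and no zero column, $\Sigma=\{x=x_1x_2\cdots\in\mathcal{A}^{\mathbb{N}}: M_{x_ix_{i+1}}=1\ \forall i\in\mathbb{N}\}$, and $\sigma:\Sigma\to\Sigma$ is the shift $(\sigma(x))_i=x_{i+1}$. $\Sigma$ has the topology generated by the cylinders $[w]=\{x\in\Sigma: x_1\cdots x_n=w\}$, $w$ an admissible word of length $n$ (i.e. $M_{w_iw_{i+1}}=1$ for $1\le i<n$). $(\Sigma,\sigma)$ is topologically mixing if for all $a,b\in\mathcal{A}$ there is $N_{ab}\in\mathbb{N}$ such that for every $n\ge N_{ab}$ there is an admissible word $w_1\cdots w_n$ with $w_1=a$, $w_n=b$.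 Potentials: $\mathcal{F}=\{f_n\}_{n=1}^\infty$ is a sequence of continuous functions $f_n:\Sigma\to\mathbb{R}$; $t\mathcal{F}=\{tf_n\}_{n=1}^\infty$. It is almost-additive if there is $C\ge 0$ with $f_n(x)+f_m(\sigma^n x)-C\le f_{n+m}(x)\le f_n(x)+f_m(\sigma^n x)+C$ for all $n,m\in\mathbb{N}$, $x\in\Sigma$. It has bounded variation if there is $C\ge0$ with $\sup_n\sup\{|f_n(x)-f_n(y)|: x,y\in\Sigma,\ x_i=y_i,\ 1\le i\le n\}\le C$. It is summable if $\sum_{i\in\mathbb{N}}\exp(\sup (f_1|_{[i]}))<\infty$. $\mathcal{M}$ is the set of $\sigma$-invariant Borel probability measures on $\Sigma$, with the weak (weak-star) topology, i.e. convergence against bounded continuous functions. $h(\mu)$ is the Kolmogorov–Sinai entropy of $\mu\in\mathcal{M}$, and $\mathcal{F}_*(\mu)=\lim_{n\to\infty}\frac1n\int f_n\,d\mu\in[-\infty,\infty)$. A measure $\mu\in\mathcal{M}$ is maximising for $\mathcal{F}$ if $\mathcal{F}_*(\mu)=\sup\{\mathcal{F}_*(\nu):\nu\in\mathcal{M}\}$. Gurevich pressure: $P_G(\mathcal{F})=\lim_{n\to\infty}\frac1n\log\big(\sum_{\sigma^nx=x}\exp(f_n(x))\chi_{[a]}(x)\big)$, which is independent of $a\in\mathcal{A}$. An equilibrium state for $t\mathcal{F}$ is a measure $\mu\in\mathcal{M}$ with $P_G(t\mathcal{F})=h(\mu)+t\mathcal{F}_*(\mu)$ (in particular $\mathcal{F}_*(\mu)>-\infty$).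 Under the stated hypotheses there is exactly one equilibrium state $\mu_{t\mathcal{F}}$ for each $t>1$, and the family $(\mu_{t\mathcal{F}})_{t>1}$ has an accumulation point as $t\to\infty$, i.e. a measure $\mu_\infty\in\mathcal{M}$ such that $\mu_{t_k\mathcal{F}}\to\mu_\infty$ weakly for some sequence $t_k\to\infty$. *)

theory Defs
  imports "HOL-Probability.Probability"
begin

section \<open>Countable Markov shifts\<close>

text \<open>
  The countably infinite alphabet is the type \<^typ>\<open>nat\<close>, and sequences and words are indexed from 0:
  the symbol $x_{i+1}$ is \<open>x i\<close>, and the letter $i + 1$ is \<open>i\<close>.
\<close>

definition transition_matrix :: "(nat \<Rightarrow> nat \<Rightarrow> nat) \<Rightarrow> bool" where
  "transition_matrix M \<longleftrightarrow>
     (\<forall>i j. M i j \<in> {0, 1}) \<and> (\<forall>i. \<exists>j. M i j \<noteq> 0) \<and> (\<forall>j. \<exists>i. M i j \<noteq> 0)"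

definition shift_space :: "(nat \<Rightarrow> nat \<Rightarrow> nat) \<Rightarrow> (nat \<Rightarrow> nat) set" where
  "shift_space M = {x. \<forall>i. M (x i) (x (Suc i)) = 1}"

definition shift_map :: "(nat \<Rightarrow> 'a) \<Rightarrow> (nat \<Rightarrow> 'a)" where
  "shift_map x = (\<lambda>i. x (Suc i))"

definition admissible :: "(nat \<Rightarrow> nat \<Rightarrow> nat) \<Rightarrow> nat list \<Rightarrow> bool" where
  "admissible M w \<longleftrightarrow> w \<noteq> [] \<and> (\<forall>i. Suc i < length w \<longrightarrow> M (w ! i) (w ! Suc i) = 1)"

definition cylinder :: "(nat \<Rightarrow> nat \<Rightarrow> nat) \<Rightarrow> nat list \<Rightarrow> (nat \<Rightarrow> nat) set" where
  "cylinder M w = {x \<in> shift_space M. \<forall>i<length w. x i = w ! i}"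

definition topologically_mixing :: "(nat \<Rightarrow> nat \<Rightarrow> nat) \<Rightarrow> bool" where
  "topologically_mixing M \<longleftrightarrow>
     (\<forall>a b. \<exists>N. \<forall>n\<ge>N. \<exists>w. admissible M w \<and> length w = n \<and> hd w = a \<and> last w = b)"

text \<open>
  The shift space is used as a subspace of \<^typ>\<open>nat \<Rightarrow> nat\<close> with the library's product topology.
  This is the topology generated by the cylinders.
\<close>

lemma topology_generated_by_cylinders:
  "topology_generated_by {cylinder M w | w. admissible M w} = top_of_set (shift_space M)"
proof (rule topology_eq[THEN iffD2], intro allI iffI)
  fix U
  assume "openin (topology_generated_by {cylinder M w | w. admissible M w}) U"
  then have "generate_topology_on {cylinder M w | w. admissible M w} U"
    by (simp add: openin_topology_generated_by_iff)
  then show "openin (top_of_set (shift_space M)) U"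
  proof induction
    case (Basis s)
    then obtain w where s: "s = cylinder M w" by blast
    have "open {x :: nat \<Rightarrow> nat. x i = w ! i}" for i
    proof -
      have "continuous_on UNIV (\<lambda>x :: nat \<Rightarrow> nat. x i)"
        by (rule continuous_on_product_coordinates)
      then have "open ((\<lambda>x :: nat \<Rightarrow> nat. x i) -` {w ! i})"
        by (rule open_vimage[rotated]) (rule Topological_Spaces.open_discrete)
      then show ?thesis by (simp add: vimage_def)
    qed
    then have "open (\<Inter>i\<in>{..<length w}. {x :: nat \<Rightarrow> nat. x i = w ! i})"
      by (intro open_INT) auto
    moreover have "s = shift_space M \<inter> (\<Inter>i\<in>{..<length w}. {x. x i = w ! i})"
      by (auto simp: s cylinder_def)
    ultimately show ?case
      by (auto simp: openin_open)
  qed auto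
next
  fix U
  assume U: "openin (top_of_set (shift_space M)) U"
  then obtain V where V: "open V" "U = shift_space M \<inter> V"
    by (auto simp: openin_open)
  have "\<exists>C. openin (topology_generated_by {cylinder M w | w. admissible M w}) C \<and> x \<in> C \<and> C \<subseteq> U"
    if x: "x \<in> U" for x
  proof -
    have "openin (product_topology (\<lambda>i :: nat. euclidean :: nat topology) UNIV) V" "x \<in> V"
      using V x by (auto simp: open_fun_def)
    then obtain X where X: "x \<in> (\<Pi>\<^sub>E i\<in>UNIV. X i)" "finite {i. X i \<noteq> UNIV}" "(\<Pi>\<^sub>E i\<in>UNIV. X i) \<subseteq> V"
      using product_topology_open_contains_basis[of "\<lambda>i :: nat. euclidean :: nat topology" UNIV V x]
      by auto
    obtain N where N: "\<And>i. X i \<noteq> UNIV \<Longrightarrow> i < N"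
      using finite_nat_set_iff_bounded[of "{i. X i \<noteq> UNIV}"] X(2) by auto
    define w where "w = map x [0..<Suc N]"
    have w: "length w = Suc N" "\<And>i. i < Suc N \<Longrightarrow> w ! i = x i"
      unfolding w_def by (simp, simp del: upt_Suc)
    have xS: "x \<in> shift_space M" using x V by auto
    have adm: "admissible M w"
      unfolding admissible_def using xS w by (auto simp: shift_space_def)
    have "cylinder M w \<subseteq> U"
    proof
      fix y assume y: "y \<in> cylinder M w"
      have "y i \<in> X i" for i
      proof (cases "X i = UNIV")
        case False
        then have "i < Suc N" using N by (simp add: less_SucI)
        then have "y i = x i" using y w by (auto simp: cylinder_def)
        then show ?thesis using X(1) by auto
      qed auto
      then have "y \<in> V" using X(3) by auto
      then show "y \<in> U" using y V by (auto simp: cylinder_def)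
    qed
    moreover have "x \<in> cylinder M w"
      using xS w by (auto simp: cylinder_def)
    moreover have "openin (topology_generated_by {cylinder M w | w. admissible M w}) (cylinder M w)"
      using adm by (intro topology_generated_by_Basis) auto
    ultimately show ?thesis by blast
  qed
  then show "openin (topology_generated_by {cylinder M w | w. admissible M w}) U"
    by (subst openin_subopen) blast
qed

section \<open>Potentials\<close>

text \<open>
  A potential is a sequence \<open>f\<close> of functions; only the terms \<open>f n\<close> with \<open>n \<ge> 1\<close> are relevant.
\<close>

definition continuous_potential :: "(nat \<Rightarrow> nat \<Rightarrow> nat) \<Rightarrow> (nat \<Rightarrow> (nat \<Rightarrow> nat) \<Rightarrow> real) \<Rightarrow> bool" where
  "continuous_potential M f \<longleftrightarrow> (\<forall>n\<ge>1. continuous_on (shift_space M) (f n))"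

definition almost_additive :: "(nat \<Rightarrow> nat \<Rightarrow> nat) \<Rightarrow> (nat \<Rightarrow> (nat \<Rightarrow> nat) \<Rightarrow> real) \<Rightarrow> bool" where
  "almost_additive M f \<longleftrightarrow> (\<exists>C\<ge>0. \<forall>n\<ge>1. \<forall>m\<ge>1. \<forall>x\<in>shift_space M.
     f n x + f m ((shift_map ^^ n) x) - C \<le> f (n + m) x \<and>
     f (n + m) x \<le> f n x + f m ((shift_map ^^ n) x) + C)"

definition bounded_variation :: "(nat \<Rightarrow> nat \<Rightarrow> nat) \<Rightarrow> (nat \<Rightarrow> (nat \<Rightarrow> nat) \<Rightarrow> real) \<Rightarrow> bool" where
  "bounded_variation M f \<longleftrightarrow> (\<exists>C\<ge>0. \<forall>n\<ge>1. \<forall>x\<in>shift_space M. \<forall>y\<in>shift_space M.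
     (\<forall>i<n. x i = y i) \<longrightarrow> \<bar>f n x - f n y\<bar> \<le> C)"

text \<open>
  The real supremum \<open>SUP\<close> is meaningful only for sets bounded above, so finiteness of the
  suprema has to be required separately.
\<close>

definition summable_potential :: "(nat \<Rightarrow> nat \<Rightarrow> nat) \<Rightarrow> (nat \<Rightarrow> (nat \<Rightarrow> nat) \<Rightarrow> real) \<Rightarrow> bool" where
  "summable_potential M f \<longleftrightarrow>
     (\<forall>i. bdd_above (f 1 ` cylinder M [i])) \<and>
     summable (\<lambda>i. exp (SUP x\<in>cylinder M [i]. f 1 x))"

section \<open>Kolmogorov--Sinai entropy\<close>

definition finite_measurable_partition :: "'a measure \<Rightarrow> 'a set set \<Rightarrow> bool" where
  "finite_measurable_partition \<mu> P \<longleftrightarrow> partition_on (space \<mu>) P \<and> finite P \<and> P \<subseteq> sets \<mu>"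

text \<open>
  The common refinement of $P, T^{-1}P, \ldots, T^{-(n-1)}P$. It may contain the empty set, which
  does not contribute to the entropy, since \<open>0 * ln 0 = 0\<close>.
\<close>

definition refined_partition :: "'a measure \<Rightarrow> ('a \<Rightarrow> 'a) \<Rightarrow> 'a set set \<Rightarrow> nat \<Rightarrow> 'a set set" where
  "refined_partition \<mu> T P n =
     (\<lambda>A. {x \<in> space \<mu>. \<forall>i<n. (T ^^ i) x \<in> A i}) ` ({..<n} \<rightarrow>\<^sub>E P)"

definition partition_entropy :: "'a measure \<Rightarrow> 'a set set \<Rightarrow> real" where
  "partition_entropy \<mu> P = - (\<Sum>A\<in>P. measure \<mu> A * ln (measure \<mu> A))"

definition entropy_wrt_partition :: "'a measure \<Rightarrow> ('a \<Rightarrow> 'a) \<Rightarrow> 'a set set \<Rightarrow> ereal" where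
  "entropy_wrt_partition \<mu> T P =
     lim (\<lambda>n. ereal (partition_entropy \<mu> (refined_partition \<mu> T P n) / real n))"

definition ks_entropy :: "'a measure \<Rightarrow> ('a \<Rightarrow> 'a) \<Rightarrow> ereal" where
  "ks_entropy \<mu> T = (SUP P\<in>{P. finite_measurable_partition \<mu> P}. entropy_wrt_partition \<mu> T P)"

section \<open>Invariant measures\<close>

definition invariant_measures :: "(nat \<Rightarrow> nat \<Rightarrow> nat) \<Rightarrow> (nat \<Rightarrow> nat) measure set" where
  "invariant_measures M =
     {\<mu>. prob_space \<mu> \<and> sets \<mu> = sets (restrict_space borel (shift_space M)) \<and>
         distr \<mu> \<mu> shift_map = \<mu>}"

definition weakly_converges ::
  "(nat \<Rightarrow> nat \<Rightarrow> nat) \<Rightarrow> (nat \<Rightarrow> (nat \<Rightarrow> nat) measure) \<Rightarrow> (nat \<Rightarrow> nat) measure \<Rightarrow> bool" where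
  "weakly_converges M \<nu> \<mu> \<longleftrightarrow>
     (\<forall>g :: (nat \<Rightarrow> nat) \<Rightarrow> real. continuous_on (shift_space M) g \<and> bounded (g ` shift_space M) \<longrightarrow>
        (\<lambda>k. \<integral>x. g x \<partial>\<nu> k) \<longlonglongrightarrow> (\<integral>x. g x \<partial>\<mu>))"

text \<open>
  The functions \<open>f n\<close> need not be integrable, and the Bochner integral of a non-integrable
  function is \<open>0\<close>; hence the extended integral. For the potentials considered here every \<open>f n\<close> is
  bounded above, so the first term is finite.
\<close>

definition extended_integral :: "'a measure \<Rightarrow> ('a \<Rightarrow> real) \<Rightarrow> ereal" where
  "extended_integral \<mu> g =
     enn2ereal (\<integral>\<^sup>+x. ennreal (g x) \<partial>\<mu>) - enn2ereal (\<integral>\<^sup>+x. ennreal (- g x) \<partial>\<mu>)"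

text \<open>The quantity $\mathcal{F}_*(\mu)$.\<close>

definition mean_value :: "(nat \<Rightarrow> 'a \<Rightarrow> real) \<Rightarrow> 'a measure \<Rightarrow> ereal" where
  "mean_value f \<mu> = lim (\<lambda>n. extended_integral \<mu> (f n) / ereal (real n))"

definition maximising_measures ::
  "(nat \<Rightarrow> nat \<Rightarrow> nat) \<Rightarrow> (nat \<Rightarrow> (nat \<Rightarrow> nat) \<Rightarrow> real) \<Rightarrow> (nat \<Rightarrow> nat) measure set" where
  "maximising_measures M f =
     {\<mu> \<in> invariant_measures M. mean_value f \<mu> = (SUP \<nu>\<in>invariant_measures M. mean_value f \<nu>)}"

section \<open>Gurevich pressure and equilibrium states\<close>

definition extended_ln :: "ennreal \<Rightarrow> ereal" where
  "extended_ln s = (if s = 0 then -\<infinity> else if s = \<infinity> then \<infinity> else ereal (ln (enn2real s)))"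

text \<open>
  The sum over periodic points is infinite in general, so it is taken in \<^typ>\<open>ennreal\<close>. It is \<open>0\<close>
  if no point of period \<open>n\<close> starts with the letter \<open>a\<close>, which can happen for small \<open>n\<close>.
\<close>

definition periodic_sum ::
  "(nat \<Rightarrow> nat \<Rightarrow> nat) \<Rightarrow> nat \<Rightarrow> (nat \<Rightarrow> (nat \<Rightarrow> nat) \<Rightarrow> real) \<Rightarrow> nat \<Rightarrow> ennreal" where
  "periodic_sum M a f n =
     (\<Sum>\<^sub>\<infinity>x\<in>{x \<in> shift_space M. (shift_map ^^ n) x = x}. ennreal (exp (f n x)) * indicator (cylinder M [a]) x)"

definition gurevich_pressure ::
  "(nat \<Rightarrow> nat \<Rightarrow> nat) \<Rightarrow> nat \<Rightarrow> (nat \<Rightarrow> (nat \<Rightarrow> nat) \<Rightarrow> real) \<Rightarrow> ereal" where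
  "gurevich_pressure M a f = lim (\<lambda>n. extended_ln (periodic_sum M a f n) / ereal (real n))"

text \<open>
  Equilibrium states for $t\mathcal{F}$, where \<open>a\<close> is the letter used in the definition of the
  pressure. The condition on the mean value is stated explicitly because
  \<open>\<infinity> + -\<infinity> = \<infinity>\<close> in \<^typ>\<open>ereal\<close>.
\<close>

definition equilibrium_state ::
  "(nat \<Rightarrow> nat \<Rightarrow> nat) \<Rightarrow> nat \<Rightarrow> (nat \<Rightarrow> (nat \<Rightarrow> nat) \<Rightarrow> real) \<Rightarrow> real \<Rightarrow> (nat \<Rightarrow> nat) measure \<Rightarrow> bool" where
  "equilibrium_state M a f t \<mu> \<longleftrightarrow>
     \<mu> \<in> invariant_measures M \<and> mean_value f \<mu> > -\<infinity> \<and>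
     gurevich_pressure M a (\<lambda>n x. t * f n x) = ks_entropy \<mu> shift_map + ereal t * mean_value f \<mu>"

definition accumulation_point_at_infinity ::
  "(nat \<Rightarrow> nat \<Rightarrow> nat) \<Rightarrow> (real \<Rightarrow> (nat \<Rightarrow> nat) measure) \<Rightarrow> (nat \<Rightarrow> nat) measure \<Rightarrow> bool" where
  "accumulation_point_at_infinity M \<mu> \<mu>_inf \<longleftrightarrow>
     \<mu>_inf \<in> invariant_measures M \<and>
     (\<exists>t :: nat \<Rightarrow> real. (\<forall>k. t k > 1) \<and> filterlim t at_top sequentially \<and>
        weakly_converges M (\<lambda>k. \<mu> (t k)) \<mu>_inf)"

end

theory Submission
  imports Defs "HOL-Real_Asymp.Real_Asymp"
begin

text \<open>
  Write $F(\mu)$ for the mean value of a measure, $P(t)$ for the pressure of $t\mathcal{F}$ and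
  $\mu_t$ for the equilibrium states. Every invariant measure $\nu$ of finite energy satisfies
  $h(\nu) + t F(\nu) \le P(t) = h(\mu_t) + t F(\mu_t)$. Comparing two parameters shows that
  $h(\mu_t)$ decreases in $t$, and comparing with a fixed $\nu$ that $F(\mu_t)$ tends to the supremum
  of $F$. As $F$ is upper semicontinuous, $\mu_\infty$ is maximising, and then
  $h(\nu) \le h(\mu_t)$ for every maximising $\nu$. It remains to bound $h(\mu_t)$ by
  $h(\mu_\infty) + \epsilon$ for some $t$.

  Entropy is not upper semicontinuous on a countable shift. Lumping the letters $\ge N$ together
  gives a finite clopen partition whose entropy rate is upper semicontinuous, and the entropy lost
  is at most $\int_{x_0 \ge N} (-s_{x_0}) \, d\mu + \sum_{i \ge N} e^{s_i}$ with
  $s_i = \sup f_1|_{[i]}$. The integral is controlled along $\mu_{t_k}$ because the loss of mass of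
  $f_n$ at infinity is at most $2C$ for every $n$, while it is $n$ times the loss of the integral.

  The same lumping gives the variational inequality without any hypothesis on the matrix beyond
  mixing: for large $N$, initial and final runs of letters $\ge N$ in a block are so costly that
  they do not contribute to the exponential growth, and what is left between them begins and ends
  with one of finitely many letters and can be closed up to a periodic orbit.
\<close>

text \<open>The limits behind entropy, mean value and pressure must be shown to exist, since
  \<open>lim\<close> says nothing about a divergent sequence. All three come from one Fekete lemma
  that tolerates an additive error and a bad initial segment.

  The terms \<open>f n\<close> are bounded above but not below. Hence their integrals pass to weak
  limits only in one direction, and an invariant measure either makes \<open>f 1\<close> integrable
  or has mean value -\<infinity>. This dichotomy reduces the comparison of measures to real
  arithmetic.

  Of the variational principle only the inequality has to be proved: for the equilibrium states,
  equality with the pressure is part of the definition.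

  The bound for the lost entropy is \<open>- p ln p \<le> p b + exp (- b)\<close>, applied to the
  probability of each letter \<open>i \<ge> N\<close> with \<open>b = - s i\<close>; the first terms
  add up to the integral and the second to the sum.

  Weak convergence is known along one sequence of parameters only. Monotonicity of the entropy in
  the parameter turns this into a limit over all of them.\<close>

text \<open>The sequence \<open>a n + C\<close> is subadditive, so the limit is the infimum of
  \<open>(a n + C) / n\<close>; the lower bound keeps that infimum finite. Subadditivity is asked
  only from \<open>N\<close> on because partition functions may vanish for short periods, and their
  logarithms mean nothing there.\<close>

lemma fekete_limit:
  fixes a :: "nat \<Rightarrow> real"
  assumes sub: "\<And>m n. m \<ge> N \<Longrightarrow> n \<ge> N \<Longrightarrow> a (m + n) \<le> a m + a n + C"
    and N: "N \<ge> 1"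
    and lower: "\<And>n. n \<ge> N \<Longrightarrow> a n \<ge> - B * real n"
  obtains L where "(\<lambda>n. a n / real n) \<longlonglongrightarrow> L" "\<And>n. n \<ge> N \<Longrightarrow> L * real n \<le> a n + C"
proof -
  define c where "c n = (a n + C) / real n" for n
  define L where "L = (INF n\<in>{N..}. c n)"
  have "- B - \<bar>C\<bar> \<le> c n" if "n \<ge> N" for n
  proof -
    have n: "real n \<ge> 1" using that N by simp
    then have "\<bar>C\<bar> \<le> \<bar>C\<bar> * real n" by (simp add: mult_le_cancel_left1)
    moreover have "(- B - \<bar>C\<bar>) * real n = - B * real n - \<bar>C\<bar> * real n" by (simp add: algebra_simps)
    ultimately have "(- B - \<bar>C\<bar>) * real n \<le> a n + C"
      using lower[OF that] by linarith
    then show ?thesis using n by (simp add: c_def pos_le_divide_eq)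
  qed
  then have bdd: "bdd_below (c ` {N..})" by (auto intro!: bdd_belowI2)
  have L_le: "L \<le> c n" if "n \<ge> N" for n
    unfolding L_def using that by (intro cINF_lower bdd) auto
  have lim: "(\<lambda>n. a n / real n) \<longlonglongrightarrow> L"
  proof (rule order_tendstoI)
    fix y assume "y < L"
    have "((\<lambda>n. L - C / real n) \<longlongrightarrow> L - 0) sequentially"
      by (intro tendsto_diff tendsto_const tendsto_divide_0[OF tendsto_const]
          filterlim_at_top_imp_at_infinity filterlim_real_sequentially)
    then have "eventually (\<lambda>n. y < L - C / real n) sequentially"
      using \<open>y < L\<close> by (simp add: order_tendstoD)
    then show "eventually (\<lambda>n. y < a n / real n) sequentially"
      using eventually_ge_at_top[of N]
      by eventually_elim (use L_le in \<open>fastforce simp: c_def add_divide_distrib\<close>)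
  next
    fix y assume "L < y"
    then obtain m where m: "m \<ge> N" "c m < y"
      unfolding L_def using cINF_less_iff[OF _ bdd] by auto
    have m0: "m > 0" using m N by linarith
    have iter: "a (q * m + r) \<le> real q * (a m + C) + a r" if "r \<ge> N" for q r
    proof (induction q)
      case (Suc q)
      have "a (Suc q * m + r) = a (m + (q * m + r))" by (simp add: algebra_simps)
      also have "\<dots> \<le> a m + a (q * m + r) + C"
        using m that by (intro sub) auto
      finally show ?case using Suc by (simp add: algebra_simps)
    qed simp
    define D where "D = Max (a ` {N..N + m})"
    define K where "K = real (N + m) * \<bar>c m\<bar> + \<bar>D\<bar>"
    have bound: "a n \<le> real n * c m + K" if n: "n \<ge> N" for n
    proof -
      \<comment> \<open>Dividing \<open>n - N\<close> instead of \<open>n\<close> leaves a remainder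
        \<open>r\<close> in the window from \<open>N\<close> to \<open>N + m\<close>: subadditivity
        applies to it, and \<open>a r\<close> is bounded by \<open>D\<close>.\<close>
      define q where "q = (n - N) div m"
      define r where "r = N + (n - N) mod m"
      have nqr: "n = q * m + r" using n by (simp add: q_def r_def)
      have r: "r \<ge> N" "r \<le> N + m" using m0 by (auto simp: r_def intro: less_imp_le)
      have "a n \<le> real q * (a m + C) + a r" unfolding nqr using r by (intro iter)
      also have "a r \<le> D" unfolding D_def using r by (intro Max_ge) auto
      also have "real q * (a m + C) = (real n - real r) * c m"
        using m0 nqr by (simp add: c_def)
      also have "\<dots> \<le> real n * c m + real r * \<bar>c m\<bar>"
        using mult_left_mono[of "- c m" "\<bar>c m\<bar>" "real r"] by (simp add: left_diff_distrib)
      also have "real r * \<bar>c m\<bar> \<le> real (N + m) * \<bar>c m\<bar>"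
        using r by (intro mult_right_mono) auto
      finally show ?thesis by (simp add: K_def)
    qed
    have "((\<lambda>n. c m + K / real n) \<longlongrightarrow> c m + 0) sequentially"
      by (intro tendsto_add tendsto_const tendsto_divide_0[OF tendsto_const]
          filterlim_at_top_imp_at_infinity filterlim_real_sequentially)
    then have "eventually (\<lambda>n. c m + K / real n < y) sequentially"
      using m by (simp add: order_tendstoD)
    then show "eventually (\<lambda>n. a n / real n < y) sequentially"
      using eventually_ge_at_top[of N]
    proof eventually_elim
      case (elim n)
      have "real n > 0" using elim N by simp
      then have "a n / real n \<le> (real n * c m + K) / real n"
        using bound elim by (intro divide_right_mono) auto
      also have "\<dots> = c m + K / real n" using \<open>real n > 0\<close> by (simp add: add_divide_distrib)
      finally show ?case using elim by simp
    qed
  qed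
  show ?thesis
  proof (rule that[OF lim])
    fix n assume "n \<ge> N"
    moreover from this have "real n > 0" using N by simp
    ultimately show "L * real n \<le> a n + C" using L_le[of n] by (simp add: c_def pos_le_divide_eq)
  qed
qed

section \<open>Entropy of simple functions\<close>

definition level_prob :: "'a measure \<Rightarrow> ('a \<Rightarrow> 'b) \<Rightarrow> 'b \<Rightarrow> real" where
  "level_prob \<mu> X v = measure \<mu> (X -` {v} \<inter> space \<mu>)"

text \<open>A partition is represented by a labelling function: joint partitions are pairs,
  coarsening is composition, and labels from different spaces can be compared. The sum has its
  intended meaning for a finite range, hence the \<open>simple_function\<close> hypotheses
  below.\<close>

definition shannon_entropy :: "'a measure \<Rightarrow> ('a \<Rightarrow> 'b) \<Rightarrow> real" where
  "shannon_entropy \<mu> X = - (\<Sum>v\<in>X ` space \<mu>. level_prob \<mu> X v * ln (level_prob \<mu> X v))"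

definition cond_entropy :: "'a measure \<Rightarrow> ('a \<Rightarrow> 'b) \<Rightarrow> ('a \<Rightarrow> 'c) \<Rightarrow> real" where
  "cond_entropy \<mu> X Y = shannon_entropy \<mu> (\<lambda>x. (X x, Y x)) - shannon_entropy \<mu> Y"

lemma level_prob_nonneg [simp]: "level_prob \<mu> X v \<ge> 0"
  by (simp add: level_prob_def)

lemma level_prob_cong:
  "(\<And>x. x \<in> space \<mu> \<Longrightarrow> X x = Y x) \<Longrightarrow> level_prob \<mu> X v = level_prob \<mu> Y v"
  unfolding level_prob_def by (rule arg_cong[where f="measure \<mu>"]) auto

lemma shannon_entropy_cong:
  "(\<And>x. x \<in> space \<mu> \<Longrightarrow> X x = Y x) \<Longrightarrow> shannon_entropy \<mu> X = shannon_entropy \<mu> Y"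
  unfolding shannon_entropy_def
  by (intro arg_cong[where f=uminus] sum.cong) (auto simp: level_prob_cong[of \<mu> X Y])

context prob_space
begin

lemma level_prob_le_1 [simp]: "level_prob M X v \<le> 1"
  by (simp add: level_prob_def)

lemma level_prob_compose:
  assumes "simple_function M X"
  shows "level_prob M (\<lambda>x. g (X x)) w = (\<Sum>v | v \<in> X ` space M \<and> g v = w. level_prob M X v)"
proof -
  have fin: "finite {v \<in> X ` space M. g v = w}"
    using simple_functionD(1)[OF assms] by simp
  have "(\<lambda>x. g (X x)) -` {w} \<inter> space M = (\<Union>v\<in>{v \<in> X ` space M. g v = w}. X -` {v} \<inter> space M)"
    by auto
  moreover have "prob \<dots> = (\<Sum>v | v \<in> X ` space M \<and> g v = w. level_prob M X v)"
    unfolding level_prob_def using fin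
    by (intro finite_measure_finite_Union)
       (auto simp: disjoint_family_on_def intro: simple_functionD(2)[OF assms])
  ultimately show ?thesis by (simp add: level_prob_def)
qed

lemma sum_level_prob:
  assumes "simple_function M X"
  shows "(\<Sum>v\<in>X ` space M. level_prob M X v) = 1"
  using level_prob_compose[OF assms, of "\<lambda>_. ()" "()"]
  by (simp add: level_prob_def prob_space)

lemma sum_level_prob_Pair:
  assumes X: "simple_function M X" and Z: "simple_function M Z"
  shows "(\<Sum>a\<in>X ` space M. level_prob M (\<lambda>x. (X x, Z x)) (a, c)) = level_prob M Z c"
proof -
  have "Z -` {c} \<inter> space M = (\<Union>a\<in>X ` space M. (\<lambda>x. (X x, Z x)) -` {(a, c)} \<inter> space M)"
    by auto
  moreover have "prob \<dots> = (\<Sum>a\<in>X ` space M. level_prob M (\<lambda>x. (X x, Z x)) (a, c))"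
    unfolding level_prob_def using simple_functionD(1)[OF X] simple_functionD(2)[OF simple_function_Pair[OF X Z]]
    by (intro finite_measure_finite_Union) (auto simp: disjoint_family_on_def)
  ultimately show ?thesis by (simp add: level_prob_def)
qed

lemma level_prob_mono:
  assumes "simple_function M X" "v \<in> X ` space M"
  shows "level_prob M X v \<le> level_prob M (\<lambda>x. g (X x)) (g v)"
  unfolding level_prob_compose[OF assms(1)]
  using assms simple_functionD(1)[OF assms(1)] by (intro member_le_sum) auto

lemma sum_level_prob_compose:
  assumes "simple_function M X"
  shows "(\<Sum>w\<in>(\<lambda>x. g (X x)) ` space M. level_prob M (\<lambda>x. g (X x)) w * \<phi> w)
       = (\<Sum>v\<in>X ` space M. level_prob M X v * \<phi> (g v))"
proof -
  have fin: "finite (X ` space M)" using simple_functionD(1)[OF assms] .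
  have "(\<Sum>w\<in>(\<lambda>x. g (X x)) ` space M. level_prob M (\<lambda>x. g (X x)) w * \<phi> w)
      = (\<Sum>w\<in>g ` X ` space M. \<Sum>v\<in>{v \<in> X ` space M. g v = w}. level_prob M X v * \<phi> (g v))"
    unfolding level_prob_compose[OF assms] sum_distrib_right
    by (intro sum.cong) auto
  also have "\<dots> = (\<Sum>v\<in>X ` space M. level_prob M X v * \<phi> (g v))"
    using fin by (intro sum.group) auto
  finally show ?thesis .
qed

text \<open>This writes the entropy of a coarser function as an average over the levels of
  \<open>X\<close>, so that entropies of several functions of \<open>X\<close> can be compared term
  by term.\<close>

lemma shannon_entropy_compose:
  assumes "simple_function M X"
  shows "shannon_entropy M (\<lambda>x. g (X x))
    = - (\<Sum>v\<in>X ` space M. level_prob M X v * ln (level_prob M (\<lambda>x. g (X x)) (g v)))"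
  unfolding shannon_entropy_def by (subst sum_level_prob_compose[OF assms]) (rule refl)

lemma shannon_entropy_nonneg: "shannon_entropy M X \<ge> 0"
proof -
  have "level_prob M X v * ln (level_prob M X v) \<le> 0" for v
    by (cases "level_prob M X v = 0")
       (auto intro!: mult_nonneg_nonpos simp: less_le)
  then show ?thesis unfolding shannon_entropy_def by (simp add: sum_nonpos)
qed

text \<open>\<open>Y\<close> factors through \<open>X\<close>, each level of \<open>X\<close> lies
  in a level of \<open>Y\<close> of at least the same probability, and the logarithm is
  increasing.\<close>

lemma shannon_entropy_mono:
  assumes X: "simple_function M X"
    and det: "\<And>x y. x \<in> space M \<Longrightarrow> y \<in> space M \<Longrightarrow> X x = X y \<Longrightarrow> Y x = Y y"
  shows "shannon_entropy M Y \<le> shannon_entropy M X"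
proof -
  define g where "g v = Y (SOME x. x \<in> space M \<and> X x = v)" for v
  have g: "g (X x) = Y x" if "x \<in> space M" for x
  proof -
    have "(SOME y. y \<in> space M \<and> X y = X x) \<in> space M \<and> X (SOME y. y \<in> space M \<and> X y = X x) = X x"
      using that by (intro someI[of "\<lambda>y. y \<in> space M \<and> X y = X x"]) simp
    then show ?thesis using det that unfolding g_def by blast
  qed
  have "shannon_entropy M Y = shannon_entropy M (\<lambda>x. g (X x))"
    using g by (intro shannon_entropy_cong) simp
  also have "\<dots> \<le> shannon_entropy M X"
    unfolding shannon_entropy_compose[OF X]
    unfolding shannon_entropy_def
  proof (intro le_imp_neg_le sum_mono)
    fix v assume "v \<in> X ` space M"
    then have "level_prob M X v \<le> level_prob M (\<lambda>x. g (X x)) (g v)"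
      by (intro level_prob_mono X)
    then show "level_prob M X v * ln (level_prob M X v)
        \<le> level_prob M X v * ln (level_prob M (\<lambda>x. g (X x)) (g v))"
    proof (cases "level_prob M X v = 0")
      case False
      then have "level_prob M X v > 0" by (simp add: less_le)
      then show ?thesis using \<open>level_prob M X v \<le> _\<close> by (intro mult_left_mono ln_mono) auto
    qed simp
  qed
  finally show ?thesis .
qed

lemma shannon_entropy_eqI:
  assumes "simple_function M X" "simple_function M Y"
    and "\<And>x y. x \<in> space M \<Longrightarrow> y \<in> space M \<Longrightarrow> X x = X y \<longleftrightarrow> Y x = Y y"
  shows "shannon_entropy M X = shannon_entropy M Y"
  using assms by (intro antisym shannon_entropy_mono) blast+

text \<open>Strong subadditivity, that is, nonnegativity of conditional mutual information. All four
  entropies become averages over the joint law, and \<open>ln u \<le> u - 1\<close> is applied to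
  the ratio of \<open>p(a,c) p(b,c)\<close> to \<open>p(c) p(a,b,c)\<close>. The calculus of
  conditional entropy below rests on it.\<close>

lemma shannon_entropy_submodular:
  assumes X: "simple_function M X" and Y: "simple_function M Y" and Z: "simple_function M Z"
  shows "shannon_entropy M (\<lambda>x. (X x, Y x, Z x)) + shannon_entropy M Z
       \<le> shannon_entropy M (\<lambda>x. (X x, Z x)) + shannon_entropy M (\<lambda>x. (Y x, Z x))"
proof -
  define W where "W = (\<lambda>x. (X x, Y x, Z x))"
  define p where "p = level_prob M W"
  define pxz where "pxz = level_prob M (\<lambda>x. (X x, Z x))"
  define pyz where "pyz = level_prob M (\<lambda>x. (Y x, Z x))"
  define pz where "pz = level_prob M Z"
  have W: "simple_function M W" unfolding W_def using X Y Z by auto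
  have fin: "finite (W ` space M)" using simple_functionD(1)[OF W] .
  have eXZ: "(\<lambda>x. (X x, Z x)) = (\<lambda>x. (\<lambda>(a, b, c). (a, c)) (W x))"
    and eYZ: "(\<lambda>x. (Y x, Z x)) = (\<lambda>x. (\<lambda>(a, b, c). (b, c)) (W x))"
    and eZ: "Z = (\<lambda>x. (\<lambda>(a, b, c). c) (W x))"
    by (auto simp: W_def)
  have HXZ: "shannon_entropy M (\<lambda>x. (X x, Z x)) = - (\<Sum>(a, b, c)\<in>W ` space M. p (a, b, c) * ln (pxz (a, c)))"
    unfolding pxz_def p_def by (subst (1 2) eXZ, subst shannon_entropy_compose[OF W]) (auto intro!: sum.cong)
  have HYZ: "shannon_entropy M (\<lambda>x. (Y x, Z x)) = - (\<Sum>(a, b, c)\<in>W ` space M. p (a, b, c) * ln (pyz (b, c)))"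
    unfolding pyz_def p_def by (subst (1 2) eYZ, subst shannon_entropy_compose[OF W]) (auto intro!: sum.cong)
  have HZ: "shannon_entropy M Z = - (\<Sum>(a, b, c)\<in>W ` space M. p (a, b, c) * ln (pz c))"
    unfolding pz_def p_def by (subst (1 2) eZ, subst shannon_entropy_compose[OF W]) (auto intro!: sum.cong)
  have HW: "shannon_entropy M W = - (\<Sum>(a, b, c)\<in>W ` space M. p (a, b, c) * ln (p (a, b, c)))"
    unfolding p_def shannon_entropy_def by (auto intro!: sum.cong)
  have le: "p (a, b, c) \<le> pxz (a, c)" "p (a, b, c) \<le> pyz (b, c)" "p (a, b, c) \<le> pz c"
    if "(a, b, c) \<in> W ` space M" for a b c
    using level_prob_mono[OF W that, of "\<lambda>(a, b, c). (a, c)"]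
      level_prob_mono[OF W that, of "\<lambda>(a, b, c). (b, c)"]
      level_prob_mono[OF W that, of "\<lambda>(a, b, c). c"]
    by (simp_all add: p_def pxz_def pyz_def pz_def W_def)
  have pointwise: "p (a, b, c) * ln (p (a, b, c)) + p (a, b, c) * ln (pz c)
      - p (a, b, c) * ln (pxz (a, c)) - p (a, b, c) * ln (pyz (b, c))
      \<ge> p (a, b, c) - pxz (a, c) * pyz (b, c) / pz c" if "(a, b, c) \<in> W ` space M" for a b c
  proof (cases "p (a, b, c) = 0")
    case True
    then show ?thesis by (simp add: pxz_def pyz_def pz_def)
  next
    case False
    then have pos: "p (a, b, c) > 0" by (simp add: p_def less_le)
    then have pos': "pxz (a, c) > 0" "pyz (b, c) > 0" "pz c > 0" using le[OF that] by auto
    define u where "u = pxz (a, c) * pyz (b, c) / (pz c * p (a, b, c))"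
    have "u > 0" using pos pos' by (simp add: u_def)
    have "ln u = ln (pxz (a, c)) + ln (pyz (b, c)) - ln (pz c) - ln (p (a, b, c))"
      using pos pos' by (simp add: u_def ln_div ln_mult)
    moreover have "ln u \<le> u - 1" using \<open>u > 0\<close> by (rule ln_le_minus_one)
    ultimately have "1 - u \<le> ln (p (a, b, c)) + ln (pz c) - ln (pxz (a, c)) - ln (pyz (b, c))"
      by simp
    then have "p (a, b, c) * (1 - u) \<le> p (a, b, c) * (ln (p (a, b, c)) + ln (pz c) - ln (pxz (a, c)) - ln (pyz (b, c)))"
      using pos by (intro mult_left_mono) auto
    moreover have "p (a, b, c) * u = pxz (a, c) * pyz (b, c) / pz c"
      using pos by (simp add: u_def)
    ultimately show ?thesis by (simp add: algebra_simps)
  qed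
  define RX where "RX = X ` space M"
  define RY where "RY = Y ` space M"
  define RZ where "RZ = Z ` space M"
  have finR: "finite RX" "finite RY" "finite RZ"
    unfolding RX_def RY_def RZ_def using X Y Z by (auto dest: simple_functionD(1))
  have marg: "(\<Sum>a\<in>RX. pxz (a, c)) = pz c" for c
    unfolding RX_def pxz_def pz_def by (rule sum_level_prob_Pair[OF X Z])
  have marg': "(\<Sum>b\<in>RY. pyz (b, c)) = pz c" for c
    unfolding RY_def pyz_def pz_def by (rule sum_level_prob_Pair[OF Y Z])
  \<comment> \<open>The law that makes \<open>X\<close> and \<open>Y\<close> independent given
    \<open>Z\<close> has total mass 1 on the full product of ranges, hence at most 1 on the triples
    that occur.\<close>
  have "(\<Sum>(a, b, c)\<in>W ` space M. pxz (a, c) * pyz (b, c) / pz c)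
      \<le> (\<Sum>(a, b, c)\<in>RX \<times> RY \<times> RZ. pxz (a, c) * pyz (b, c) / pz c)"
    using finR by (intro sum_mono2) (auto simp: W_def RX_def RY_def RZ_def pxz_def pyz_def pz_def)
  also have "\<dots> = (\<Sum>c\<in>RZ. \<Sum>b\<in>RY. \<Sum>a\<in>RX. pxz (a, c) * pyz (b, c) / pz c)"
    unfolding sum.cartesian_product[symmetric]
    by (subst sum.swap, subst (2) sum.swap, subst (1) sum.swap) (rule refl)
  also have "\<dots> = (\<Sum>c\<in>RZ. pz c * pz c / pz c)"
  proof (intro sum.cong refl)
    fix c
    have "(\<Sum>b\<in>RY. \<Sum>a\<in>RX. pxz (a, c) * pyz (b, c) / pz c)
        = (\<Sum>b\<in>RY. pyz (b, c)) * (\<Sum>a\<in>RX. pxz (a, c)) / pz c"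
      unfolding sum_product sum_divide_distrib by (intro sum.cong refl) simp
    then show "(\<Sum>b\<in>RY. \<Sum>a\<in>RX. pxz (a, c) * pyz (b, c) / pz c) = pz c * pz c / pz c"
      by (simp only: marg marg')
  qed
  \<comment> \<open>Terms with \<open>pz c = 0\<close> agree as well, because division by zero gives
    0.\<close>
  also have "\<dots> = (\<Sum>c\<in>RZ. pz c)" by (intro sum.cong) auto
  also have "\<dots> = 1" unfolding RZ_def pz_def by (rule sum_level_prob[OF Z])
  finally have "(\<Sum>(a, b, c)\<in>W ` space M. pxz (a, c) * pyz (b, c) / pz c) \<le> 1" .
  moreover have "(\<Sum>(a, b, c)\<in>W ` space M. p (a, b, c)) = 1"
    using sum_level_prob[OF W] by (simp add: p_def case_prod_unfold)
  moreover have "(\<Sum>(a, b, c)\<in>W ` space M. p (a, b, c) - pxz (a, c) * pyz (b, c) / pz c)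
    \<le> (\<Sum>(a, b, c)\<in>W ` space M. p (a, b, c) * ln (p (a, b, c)) + p (a, b, c) * ln (pz c)
      - p (a, b, c) * ln (pxz (a, c)) - p (a, b, c) * ln (pyz (b, c)))"
    using pointwise by (intro sum_mono) auto
  ultimately have "0 \<le> (\<Sum>(a, b, c)\<in>W ` space M. p (a, b, c) * ln (p (a, b, c)) + p (a, b, c) * ln (pz c)
      - p (a, b, c) * ln (pxz (a, c)) - p (a, b, c) * ln (pyz (b, c)))"
    by (simp add: sum_subtractf case_prod_unfold)
  then show ?thesis
    unfolding W_def[symmetric] HXZ HYZ HZ HW by (simp add: sum_subtractf sum.distrib case_prod_unfold)
qed

end

section \<open>Conditional entropy\<close>

context prob_space
begin

lemma shannon_entropy_Pair_le:
  assumes X: "simple_function M X" and Y: "simple_function M Y"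
  shows "shannon_entropy M (\<lambda>x. (X x, Y x)) \<le> shannon_entropy M X + shannon_entropy M Y"
proof -
  have Z: "simple_function M (\<lambda>_. ())" by simp
  have "shannon_entropy M (\<lambda>x. (X x, Y x)) = shannon_entropy M (\<lambda>x. (X x, Y x, ()))"
    "shannon_entropy M (\<lambda>x. (X x, ())) = shannon_entropy M X"
    "shannon_entropy M (\<lambda>x. (Y x, ())) = shannon_entropy M Y"
    using X Y Z by (intro shannon_entropy_eqI simple_function_Pair; auto)+
  then show ?thesis
    using shannon_entropy_submodular[OF X Y Z] shannon_entropy_nonneg[of "\<lambda>_. ()"] by linarith
qed

lemma shannon_entropy_le_add_cond_entropy:
  assumes "simple_function M X" "simple_function M Y"
  shows "shannon_entropy M X \<le> shannon_entropy M Y + cond_entropy M X Y"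
  unfolding cond_entropy_def add_diff_inverse diff_add_cancel using assms
  by (simp, intro shannon_entropy_mono) auto

lemma cond_entropy_le:
  assumes "simple_function M X" "simple_function M Y"
  shows "cond_entropy M X Y \<le> shannon_entropy M X"
  using shannon_entropy_Pair_le[OF assms] by (simp add: cond_entropy_def)

text \<open>Submodularity, once it is noted that \<open>(Y, Z)\<close> generates the same partition
  as \<open>Y\<close>.\<close>

lemma cond_entropy_antimono:
  assumes X: "simple_function M X" and Y: "simple_function M Y" and Z: "simple_function M Z"
    and det: "\<And>x y. x \<in> space M \<Longrightarrow> y \<in> space M \<Longrightarrow> Y x = Y y \<Longrightarrow> Z x = Z y"
  shows "cond_entropy M X Y \<le> cond_entropy M X Z"
proof -
  have "shannon_entropy M (\<lambda>x. (X x, Y x)) = shannon_entropy M (\<lambda>x. (X x, Y x, Z x))"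
    "shannon_entropy M (\<lambda>x. (Y x, Z x)) = shannon_entropy M Y"
    using X Y Z by (intro shannon_entropy_eqI simple_function_Pair; auto intro: det)+
  then show ?thesis
    using shannon_entropy_submodular[OF X Y Z] by (simp add: cond_entropy_def)
qed

lemma cond_entropy_mono:
  assumes X: "simple_function M X" and Y: "simple_function M Y"
    and det: "\<And>x y. x \<in> space M \<Longrightarrow> y \<in> space M \<Longrightarrow> X x = X y \<Longrightarrow> X' x = X' y"
  shows "cond_entropy M X' Y \<le> cond_entropy M X Y"
  unfolding cond_entropy_def using X Y
  by (intro diff_right_mono shannon_entropy_mono simple_function_Pair) (auto intro: det)

lemma cond_entropy_Pair_le:
  assumes "simple_function M X" "simple_function M X'" "simple_function M Y"
  shows "cond_entropy M (\<lambda>x. (X x, X' x)) Y \<le> cond_entropy M X Y + cond_entropy M X' Y"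
proof -
  have "shannon_entropy M (\<lambda>x. ((X x, X' x), Y x)) = shannon_entropy M (\<lambda>x. (X x, X' x, Y x))"
    using assms by (intro shannon_entropy_eqI simple_function_Pair; auto)
  then show ?thesis
    using shannon_entropy_submodular[OF assms] by (simp add: cond_entropy_def)
qed

lemma cond_entropy_eq_0:
  assumes "simple_function M X" "simple_function M Y"
    and "\<And>x y. x \<in> space M \<Longrightarrow> y \<in> space M \<Longrightarrow> Y x = Y y \<Longrightarrow> X x = X y"
  shows "cond_entropy M X Y = 0"
proof -
  have "shannon_entropy M (\<lambda>x. (X x, Y x)) = shannon_entropy M Y"
    using assms(1,2) by (intro shannon_entropy_eqI simple_function_Pair) (auto intro: assms(3))
  then show ?thesis by (simp add: cond_entropy_def)
qed

text \<open>The bridge from families of sets to labellings. The family may contain the empty set,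
  whose term \<open>0 * ln 0\<close> vanishes.\<close>

lemma partition_entropy_eq:
  assumes Y: "simple_function M Y" and "finite Q"
    and levels: "Q - {{}} = (\<lambda>v. Y -` {v} \<inter> space M) ` Y ` space M"
  shows "partition_entropy M Q = shannon_entropy M Y"
proof -
  have "(\<Sum>A\<in>Q. measure M A * ln (measure M A)) = (\<Sum>A\<in>Q - {{}}. measure M A * ln (measure M A))"
    using \<open>finite Q\<close> by (intro sum.mono_neutral_right) auto
  also have "\<dots> = (\<Sum>v\<in>Y ` space M. level_prob M Y v * ln (level_prob M Y v))"
    unfolding levels by (subst sum.reindex) (auto simp: inj_on_def level_prob_def)
  finally show ?thesis by (simp add: partition_entropy_def shannon_entropy_def)
qed

end

section \<open>Entropy of measure-preserving maps\<close>

definition itinerary :: "('a \<Rightarrow> 'a) \<Rightarrow> ('a \<Rightarrow> 'b) \<Rightarrow> nat \<Rightarrow> 'a \<Rightarrow> 'b list" where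
  "itinerary T X n x = map (\<lambda>i. X ((T ^^ i) x)) [0..<n]"

definition entropy_rate :: "'a measure \<Rightarrow> ('a \<Rightarrow> 'a) \<Rightarrow> ('a \<Rightarrow> 'b) \<Rightarrow> real" where
  "entropy_rate \<mu> T X = lim (\<lambda>n. shannon_entropy \<mu> (itinerary T X n) / real n)"

lemma itinerary_eq_iff:
  "itinerary T X n x = itinerary T X n y \<longleftrightarrow> (\<forall>i<n. X ((T ^^ i) x) = X ((T ^^ i) y))"
  by (auto simp: itinerary_def)

locale measure_preserving = prob_space +
  fixes T :: "'a \<Rightarrow> 'a"
  assumes T_measurable [measurable]: "T \<in> M \<rightarrow>\<^sub>M M"
    and distr_T: "distr M M T = M"
begin

lemma funpow_measurable [measurable]: "T ^^ n \<in> M \<rightarrow>\<^sub>M M"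
  by (induction n) (auto simp: measurable_ident)

lemma funpow_space: "x \<in> space M \<Longrightarrow> (T ^^ n) x \<in> space M"
  by (rule measurable_space[OF funpow_measurable])

lemma distr_funpow: "distr M M (T ^^ n) = M"
proof (induction n)
  case (Suc n)
  have "distr M M (T ^^ Suc n) = distr (distr M M (T ^^ n)) M T"
    by (subst distr_distr) (auto simp: comp_def)
  then show ?case by (simp only: Suc distr_T)
qed (simp add: id_def)

lemma simple_function_funpow:
  assumes "simple_function M X"
  shows "simple_function M (\<lambda>x. X ((T ^^ n) x))"
proof -
  have "(\<lambda>x. X ((T ^^ n) x)) ` space M \<subseteq> X ` space M" using funpow_space by auto
  moreover have "X \<in> M \<rightarrow>\<^sub>M count_space UNIV" using assms by (rule measurable_simple_function)
  ultimately show ?thesis using assms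
    by (auto simp: simple_function_eq_measurable intro: finite_subset measurable_compose[OF funpow_measurable])
qed

lemma simple_function_itinerary:
  assumes X: "simple_function M X"
  shows "simple_function M (itinerary T X n)"
proof (induction n)
  case (Suc n)
  have "simple_function M (\<lambda>x. (\<lambda>xs v. xs @ [v]) (itinerary T X n x) (X ((T ^^ n) x)))"
    by (rule simple_function_compose2[OF Suc simple_function_funpow[OF X]])
  moreover have "itinerary T X (Suc n) = (\<lambda>x. itinerary T X n x @ [X ((T ^^ n) x)])"
    by (simp add: itinerary_def fun_eq_iff)
  ultimately show ?case by simp
qed (auto simp: itinerary_def)

lemma level_prob_funpow:
  assumes "simple_function M X"
  shows "level_prob M (\<lambda>x. X ((T ^^ n) x)) v = level_prob M X v"
proof -
  have "level_prob M X v = measure (distr M M (T ^^ n)) (X -` {v} \<inter> space M)"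
    by (simp add: distr_funpow level_prob_def)
  also have "\<dots> = measure M ((T ^^ n) -` (X -` {v} \<inter> space M) \<inter> space M)"
    using simple_functionD(2)[OF assms] by (intro measure_distr) auto
  also have "(T ^^ n) -` (X -` {v} \<inter> space M) \<inter> space M = (\<lambda>x. X ((T ^^ n) x)) -` {v} \<inter> space M"
    using funpow_space by auto
  finally show ?thesis by (simp add: level_prob_def)
qed

lemma shannon_entropy_funpow:
  assumes X: "simple_function M X"
  shows "shannon_entropy M (\<lambda>x. X ((T ^^ n) x)) = shannon_entropy M X"
proof -
  have "(\<Sum>v\<in>(\<lambda>x. X ((T ^^ n) x)) ` space M. level_prob M X v * ln (level_prob M X v))
      = (\<Sum>v\<in>X ` space M. level_prob M X v * ln (level_prob M X v))"
  proof (intro sum.mono_neutral_left ballI)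
    fix v assume "v \<in> X ` space M - (\<lambda>x. X ((T ^^ n) x)) ` space M"
    then have "(\<lambda>x. X ((T ^^ n) x)) -` {v} \<inter> space M = {}" by blast
    then have "level_prob M (\<lambda>x. X ((T ^^ n) x)) v = 0"
      by (simp add: level_prob_def)
    then show "level_prob M X v * ln (level_prob M X v) = 0"
      by (simp add: level_prob_funpow[OF X])
  qed (use funpow_space simple_functionD(1)[OF X] in auto)
  then show ?thesis by (simp add: shannon_entropy_def level_prob_funpow[OF X])
qed

lemma cond_entropy_funpow:
  assumes X: "simple_function M X" and Y: "simple_function M Y"
  shows "cond_entropy M (\<lambda>x. X ((T ^^ n) x)) (\<lambda>x. Y ((T ^^ n) x)) = cond_entropy M X Y"
  unfolding cond_entropy_def shannon_entropy_funpow[OF Y]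
  using shannon_entropy_funpow[OF simple_function_Pair[OF X Y]] by simp

lemma itinerary_add_eq_iff:
  "itinerary T X (m + n) x = itinerary T X (m + n) y \<longleftrightarrow>
    itinerary T X m x = itinerary T X m y \<and> itinerary T X n ((T ^^ m) x) = itinerary T X n ((T ^^ m) y)"
proof -
  have "(T ^^ i) ((T ^^ m) x) = (T ^^ (m + i)) x" for i x
    by (simp add: funpow_add add.commute[of m])
  moreover have "(\<forall>i<m + n. P i) \<longleftrightarrow> (\<forall>i<m. P i) \<and> (\<forall>i<n. P (m + i))" for P
  proof (intro iffI conjI allI impI; (elim conjE)?)
    fix i assume P: "\<forall>i<m. P i" "\<forall>i<n. P (m + i)" and i: "i < m + n"
    show "P i"
    proof (cases "i < m")
      case False
      then obtain k where "i = m + k" by (metis le_Suc_ex not_less)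
      then show ?thesis using P i by simp
    qed (use P in auto)
  qed auto
  ultimately show ?thesis by (simp add: itinerary_eq_iff)
qed

lemma shannon_entropy_itinerary_subadditive:
  assumes X: "simple_function M X"
  shows "shannon_entropy M (itinerary T X (m + n))
    \<le> shannon_entropy M (itinerary T X m) + shannon_entropy M (itinerary T X n)"
proof -
  note S = simple_function_itinerary[OF X]
  have "shannon_entropy M (itinerary T X (m + n))
      = shannon_entropy M (\<lambda>x. (itinerary T X m x, itinerary T X n ((T ^^ m) x)))"
    using S simple_function_funpow[OF S]
    by (intro shannon_entropy_eqI simple_function_Pair) (auto simp: itinerary_add_eq_iff)
  also have "\<dots> \<le> shannon_entropy M (itinerary T X m) + shannon_entropy M (\<lambda>x. itinerary T X n ((T ^^ m) x))"
    using S simple_function_funpow[OF S] by (intro shannon_entropy_Pair_le)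
  also have "shannon_entropy M (\<lambda>x. itinerary T X n ((T ^^ m) x)) = shannon_entropy M (itinerary T X n)"
    by (rule shannon_entropy_funpow[OF S])
  finally show ?thesis .
qed

lemma entropy_rate:
  assumes X: "simple_function M X"
  shows entropy_rate_tendsto:
      "(\<lambda>n. shannon_entropy M (itinerary T X n) / real n) \<longlonglongrightarrow> entropy_rate M T X" (is ?lim)
    and entropy_rate_le:
      "n \<ge> 1 \<Longrightarrow> entropy_rate M T X * real n \<le> shannon_entropy M (itinerary T X n)"
proof -
  obtain L where L: "(\<lambda>n. shannon_entropy M (itinerary T X n) / real n) \<longlonglongrightarrow> L"
    "\<And>n. n \<ge> 1 \<Longrightarrow> L * real n \<le> shannon_entropy M (itinerary T X n) + 0"
    by (rule fekete_limit[of 1 "\<lambda>n. shannon_entropy M (itinerary T X n)" 0 0])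
       (use shannon_entropy_itinerary_subadditive[OF X] shannon_entropy_nonneg in auto)
  have "L = entropy_rate M T X" unfolding entropy_rate_def using limI[OF L(1)] by simp
  then show ?lim "n \<ge> 1 \<Longrightarrow> entropy_rate M T X * real n \<le> shannon_entropy M (itinerary T X n)"
    using L by auto
qed

lemma entropy_rate_nonneg: "simple_function M X \<Longrightarrow> entropy_rate M T X \<ge> 0"
  by (rule tendsto_lowerbound[OF entropy_rate_tendsto]) (auto simp: shannon_entropy_nonneg)

text \<open>The labels at times \<open>k < n\<close> are added one at a time. For each, the
  conditioning is weakened to the window of \<open>Y\<close> from \<open>k\<close> to
  \<open>k + m - 1\<close>, which fits into length \<open>n + m\<close>, and invariance moves that
  window to time 0.\<close>

lemma cond_entropy_itinerary_le:
  assumes X: "simple_function M X" and Y: "simple_function M Y"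
  shows "cond_entropy M (itinerary T X n) (itinerary T Y (n + m))
    \<le> real n * cond_entropy M X (itinerary T Y m)"
proof -
  have "cond_entropy M (itinerary T X k) (itinerary T Y (n + m))
    \<le> real k * cond_entropy M X (itinerary T Y m)" if "k \<le> n" for k
    using that
  proof (induction k)
    case 0
    have "cond_entropy M (itinerary T X 0) (itinerary T Y (n + m)) = 0"
      by (rule cond_entropy_eq_0[OF simple_function_itinerary[OF X] simple_function_itinerary[OF Y]])
         (simp add: itinerary_def)
    then show ?case by simp
  next
    case (Suc k)
    note SX = simple_function_itinerary[OF X]
    note SY = simple_function_itinerary[OF Y]
    have "cond_entropy M (itinerary T X (Suc k)) (itinerary T Y (n + m))
        \<le> cond_entropy M (\<lambda>x. (itinerary T X k x, X ((T ^^ k) x))) (itinerary T Y (n + m))"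
      using SX SY simple_function_funpow[OF X]
      by (intro cond_entropy_mono simple_function_Pair) (auto simp: itinerary_eq_iff less_Suc_eq)
    also have "\<dots> \<le> cond_entropy M (itinerary T X k) (itinerary T Y (n + m))
        + cond_entropy M (\<lambda>x. X ((T ^^ k) x)) (itinerary T Y (n + m))"
      using SX SY simple_function_funpow[OF X] by (intro cond_entropy_Pair_le)
    also have "cond_entropy M (itinerary T X k) (itinerary T Y (n + m)) \<le> real k * cond_entropy M X (itinerary T Y m)"
      using Suc by simp
    also have "cond_entropy M (\<lambda>x. X ((T ^^ k) x)) (itinerary T Y (n + m))
        \<le> cond_entropy M (\<lambda>x. X ((T ^^ k) x)) (\<lambda>x. itinerary T Y m ((T ^^ k) x))"
    proof (rule cond_entropy_antimono)
      fix x y assume "itinerary T Y (n + m) x = itinerary T Y (n + m) y"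
      moreover have "n + m = (k + m) + (n - k)" using Suc by simp
      ultimately show "itinerary T Y m ((T ^^ k) x) = itinerary T Y m ((T ^^ k) y)"
        by (metis itinerary_add_eq_iff)
    qed (use SY simple_function_funpow[OF X] simple_function_funpow[OF SY] in auto)
    also have "\<dots> = cond_entropy M X (itinerary T Y m)" by (rule cond_entropy_funpow[OF X SY])
    finally show ?case by (simp add: algebra_simps)
  qed
  from this[of n] show ?thesis by simp
qed

text \<open>The itinerary of \<open>Y\<close> is \<open>m\<close> steps longer than that of
  \<open>X\<close>; after division by \<open>n\<close> this costs only the factor
  \<open>1 + m / n\<close>, which tends to 1.\<close>

lemma entropy_rate_le_add_cond_entropy:
  assumes X: "simple_function M X" and Y: "simple_function M Y"
  shows "entropy_rate M T X \<le> entropy_rate M T Y + cond_entropy M X (itinerary T Y m)"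
proof -
  define H where "H n = shannon_entropy M (itinerary T Y n)" for n
  have "(\<lambda>n. H (n + m) / real (n + m)) \<longlonglongrightarrow> entropy_rate M T Y"
    using LIMSEQ_ignore_initial_segment[OF entropy_rate_tendsto[OF Y]] by (simp add: H_def)
  moreover have "(\<lambda>n. 1 + real m / real n) \<longlonglongrightarrow> 1 + 0"
    by (intro tendsto_add tendsto_const lim_const_over_n)
  ultimately have lim: "(\<lambda>n. H (n + m) / real (n + m) * (1 + real m / real n)
      + cond_entropy M X (itinerary T Y m)) \<longlonglongrightarrow> entropy_rate M T Y * (1 + 0) + cond_entropy M X (itinerary T Y m)"
    by (intro tendsto_add tendsto_mult tendsto_const lim_const_over_n)
  show ?thesis
  proof (rule tendsto_le[OF _ _ entropy_rate_tendsto[OF X]])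
    show "(\<lambda>n. H (n + m) / real (n + m) * (1 + real m / real n)
      + cond_entropy M X (itinerary T Y m)) \<longlonglongrightarrow> entropy_rate M T Y + cond_entropy M X (itinerary T Y m)"
      using lim by simp
    show "eventually (\<lambda>n. shannon_entropy M (itinerary T X n) / real n
        \<le> H (n + m) / real (n + m) * (1 + real m / real n) + cond_entropy M X (itinerary T Y m)) sequentially"
      using eventually_gt_at_top[of 0]
    proof eventually_elim
      case (elim n)
      have "shannon_entropy M (itinerary T X n) \<le> H (n + m) + real n * cond_entropy M X (itinerary T Y m)"
        using shannon_entropy_le_add_cond_entropy[OF simple_function_itinerary[OF X] simple_function_itinerary[OF Y], of n "n + m"]
          cond_entropy_itinerary_le[OF X Y, of n m] by (simp add: H_def)
      then have "shannon_entropy M (itinerary T X n) / real n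
        \<le> (H (n + m) + real n * cond_entropy M X (itinerary T Y m)) / real n"
        by (intro divide_right_mono) auto
      also have "\<dots> = H (n + m) / real (n + m) * (1 + real m / real n) + cond_entropy M X (itinerary T Y m)"
      proof -
        have "1 + real m / real n = real (n + m) / real n" using elim by (simp add: field_simps)
        then show ?thesis using elim by (simp add: add_divide_distrib del: of_nat_add)
      qed
      finally show ?case .
    qed
  qed auto
qed

definition part :: "'a set set \<Rightarrow> 'a \<Rightarrow> 'a set" where
  "part P x = (THE A. A \<in> P \<and> x \<in> A)"

lemma part_eqI:
  assumes "partition_on (space M) P" "A \<in> P" "x \<in> A"
  shows "part P x = A"
  unfolding part_def using assms
  by (intro the_equality) (auto simp: partition_on_def disjoint_def)

lemma part_in:
  assumes "partition_on (space M) P" "x \<in> space M"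
  shows "part P x \<in> P" "x \<in> part P x"
proof -
  obtain A where "A \<in> P" "x \<in> A" using assms by (auto simp: partition_on_def)
  then show "part P x \<in> P" "x \<in> part P x" using part_eqI[OF assms(1)] by auto
qed

lemma simple_function_part:
  assumes "finite_measurable_partition M P"
  shows "simple_function M (part P)"
proof -
  have P: "partition_on (space M) P" "finite P" "P \<subseteq> sets M"
    using assms by (auto simp: finite_measurable_partition_def)
  have "part P ` space M \<subseteq> P" using part_in[OF P(1)] by auto
  moreover have "part P -` {A} \<inter> space M = A" if "A \<in> P" for A
    using part_in[OF P(1)] part_eqI[OF P(1) that] P(3) that sets.sets_into_space[OF subsetD[OF P(3) that]] by auto
  ultimately show ?thesis unfolding simple_function_def
    using P part_in(1)[OF P(1)] by (auto intro: finite_subset)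
qed

lemma entropy_wrt_partition_eq:
  assumes P: "finite_measurable_partition M P"
  shows "entropy_wrt_partition M T P = ereal (entropy_rate M T (part P))"
proof -
  have P': "partition_on (space M) P" "finite P" "P \<subseteq> sets M"
    using P by (auto simp: finite_measurable_partition_def)
  note S = simple_function_part[OF P]
  have "partition_entropy M (refined_partition M T P n) = shannon_entropy M (itinerary T (part P) n)" for n
  proof (rule partition_entropy_eq[OF simple_function_itinerary[OF S]])
    show "finite (refined_partition M T P n)"
      unfolding refined_partition_def using P' by (intro finite_imageI finite_PiE) auto
    \<comment> \<open>The fibres of the itinerary are exactly the nonempty members of the refined
      partition.\<close>
    have level: "itinerary T (part P) n -` {itinerary T (part P) n x} \<inter> space M
        = {y \<in> space M. \<forall>i<n. (T ^^ i) y \<in> part P ((T ^^ i) x)}" if "x \<in> space M" for x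
    proof -
      have "part P ((T ^^ i) y) = part P ((T ^^ i) x) \<longleftrightarrow> (T ^^ i) y \<in> part P ((T ^^ i) x)" if "y \<in> space M" for y i
        using part_in(1)[OF P'(1) funpow_space[OF \<open>x \<in> space M\<close>, of i]]
          part_in(2)[OF P'(1) funpow_space[OF that, of i]] part_eqI[OF P'(1)] by metis
      then show ?thesis by (auto simp: itinerary_eq_iff)
    qed
    show "refined_partition M T P n - {{}}
        = (\<lambda>v. itinerary T (part P) n -` {v} \<inter> space M) ` itinerary T (part P) n ` space M"
    proof (intro equalityI subsetI)
      fix B assume "B \<in> refined_partition M T P n - {{}}"
      then obtain A x where A: "A \<in> {..<n} \<rightarrow>\<^sub>E P" "B = {x \<in> space M. \<forall>i<n. (T ^^ i) x \<in> A i}" and x: "x \<in> B"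
        by (auto simp: refined_partition_def)
      have "part P ((T ^^ i) x) = A i" if "i < n" for i
        using A x that by (intro part_eqI[OF P'(1)]) auto
      moreover have xS: "x \<in> space M" using A x by simp
      ultimately have "B = itinerary T (part P) n -` {itinerary T (part P) n x} \<inter> space M"
        unfolding level[OF xS] A(2) by simp
      then show "B \<in> (\<lambda>v. itinerary T (part P) n -` {v} \<inter> space M) ` itinerary T (part P) n ` space M"
        using xS by blast
    next
      fix B assume "B \<in> (\<lambda>v. itinerary T (part P) n -` {v} \<inter> space M) ` itinerary T (part P) n ` space M"
      then obtain x where x: "x \<in> space M" "B = itinerary T (part P) n -` {itinerary T (part P) n x} \<inter> space M"
        by auto
      have "B = (\<lambda>A. {x \<in> space M. \<forall>i<n. (T ^^ i) x \<in> A i}) (\<lambda>i\<in>{..<n}. part P ((T ^^ i) x))"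
        unfolding x(2) level[OF x(1)] by auto
      moreover have "(\<lambda>i\<in>{..<n}. part P ((T ^^ i) x)) \<in> {..<n} \<rightarrow>\<^sub>E P"
        using part_in(1)[OF P'(1) funpow_space[OF x(1)]] by auto
      ultimately show "B \<in> refined_partition M T P n - {{}}"
        unfolding refined_partition_def using x by blast
    qed
  qed
  then show ?thesis
    unfolding entropy_wrt_partition_def using entropy_rate_tendsto[OF S]
    by (intro limI) simp
qed

lemma ks_entropy_le:
  assumes "\<And>P. finite_measurable_partition M P \<Longrightarrow> ereal (entropy_rate M T (part P)) \<le> c"
  shows "ks_entropy M T \<le> c"
  unfolding ks_entropy_def
proof (rule SUP_least)
  fix P assume "P \<in> {P. finite_measurable_partition M P}"
  then show "entropy_wrt_partition M T P \<le> c" using assms by (simp add: entropy_wrt_partition_eq)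
qed

lemma entropy_rate_le_ks_entropy:
  assumes X: "simple_function M X"
  shows "ereal (entropy_rate M T X) \<le> ks_entropy M T"
proof -
  define P where "P = (\<lambda>v. X -` {v} \<inter> space M) ` X ` space M"
  have part: "partition_on (space M) P"
  proof (intro partition_onI)
    fix p q assume "p \<in> P" "q \<in> P" "p \<noteq> q"
    from \<open>p \<in> P\<close> obtain v where v: "p = X -` {v} \<inter> space M" unfolding P_def by blast
    from \<open>q \<in> P\<close> obtain w where w: "q = X -` {w} \<inter> space M" unfolding P_def by blast
    from \<open>p \<noteq> q\<close> have "v \<noteq> w" unfolding v w by metis
    then show "disjnt p q" unfolding v w disjnt_iff by simp
  next
    show "{} \<notin> P" unfolding P_def by blast
    show "\<Union>P = space M" unfolding P_def by blast
  qed
  have P: "finite_measurable_partition M P"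
    unfolding finite_measurable_partition_def
  proof (intro conjI)
    show "finite P" unfolding P_def by (intro finite_imageI simple_functionD(1)[OF X])
    show "P \<subseteq> sets M" unfolding P_def using simple_functionD(2)[OF X] by blast
  qed (rule part)
  have part_eq: "part P x = X -` {X x} \<inter> space M" if "x \<in> space M" for x
    using that by (intro part_eqI[OF part]) (auto simp: P_def)
  have eq: "part P x = part P y \<longleftrightarrow> X x = X y" if "x \<in> space M" "y \<in> space M" for x y
  proof
    assume "part P x = part P y"
    moreover have "x \<in> part P x" using that part_in(2)[OF part] by simp
    ultimately have "x \<in> X -` {X y} \<inter> space M" using part_eq[OF that(2)] by simp
    then show "X x = X y" by simp
  qed (simp add: part_eq that)
  have "shannon_entropy M (itinerary T X n) = shannon_entropy M (itinerary T (part P) n)" for n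
    by (intro shannon_entropy_eqI simple_function_itinerary X simple_function_part[OF P])
       (simp add: itinerary_eq_iff eq funpow_space)
  then have "ereal (entropy_rate M T X) = entropy_wrt_partition M T P"
    unfolding entropy_wrt_partition_eq[OF P] by (simp add: entropy_rate_def)
  also have "\<dots> \<le> ks_entropy M T" unfolding ks_entropy_def using P by (intro SUP_upper) simp
  finally show ?thesis .
qed

end

section \<open>Continuity of entropy in the probabilities\<close>

lemma continuous_on_mult_ln: "continuous_on {0..} (\<lambda>x::real. x * ln x)"
  unfolding continuous_on_eq_continuous_within
proof
  fix x :: real assume "x \<in> {0..}"
  show "continuous (at x within {0..}) (\<lambda>x. x * ln x)"
  proof (cases "x = 0")
    case True
    have "((\<lambda>x::real. x * ln x) \<longlongrightarrow> 0) (at_right 0)" by real_asymp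
    then show ?thesis by (simp add: True continuous_within at_within_Ici_at_right)
  qed (use \<open>x \<in> {0..}\<close> in \<open>auto intro!: continuous_intros\<close>)
qed

lemma tendsto_mult_ln:
  fixes p :: "'b \<Rightarrow> real"
  assumes "(p \<longlongrightarrow> q) F" "\<And>k. p k \<ge> 0" "q \<ge> 0"
  shows "((\<lambda>k. p k * ln (p k)) \<longlongrightarrow> q * ln q) F"
  using continuous_on_tendsto_compose[OF continuous_on_mult_ln assms(1)] assms by simp

text \<open>This is \<open>ln u \<le> u - 1\<close> at \<open>u = exp (- b) / p\<close>. It serves
  twice: with \<open>b\<close> an energy it bounds the entropy of infinitely many letters, and with
  a normalised \<open>b\<close> it is the Gibbs inequality up to a constant.\<close>

lemma neg_mult_ln_le:
  fixes p b :: real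
  assumes "p \<ge> 0"
  shows "- (p * ln p) \<le> p * b + exp (- b)"
proof (cases "p = 0")
  case False
  then have p: "p > 0" using assms by simp
  have "ln (exp (- b) / p) \<le> exp (- b) / p - 1" using p by (intro ln_le_minus_one) simp
  then have "- b - ln p \<le> exp (- b) / p - 1" using p by (simp add: ln_div)
  then have "p * (- b - ln p) \<le> p * (exp (- b) / p - 1)" using p by (intro mult_left_mono) auto
  also have "\<dots> = exp (- b) - p" using p by (simp add: right_diff_distrib)
  finally show ?thesis using p by (simp add: algebra_simps)
qed simp

lemma shannon_entropy_superset:
  assumes "finite R" "X ` space \<mu> \<subseteq> R"
  shows "shannon_entropy \<mu> X = - (\<Sum>v\<in>R. level_prob \<mu> X v * ln (level_prob \<mu> X v))"
proof -
  have "level_prob \<mu> X v = 0" if "v \<notin> X ` space \<mu>" for v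
  proof -
    have "X -` {v} \<inter> space \<mu> = {}" using that by auto
    then show ?thesis by (simp add: level_prob_def)
  qed
  then show ?thesis unfolding shannon_entropy_def
    using assms by (intro arg_cong[where f=uminus] sum.mono_neutral_left) auto
qed

lemma tendsto_shannon_entropy:
  assumes "finite R" "\<And>k. X ` space (\<mu> k) \<subseteq> R" "X ` space \<nu> \<subseteq> R"
    and "\<And>v. v \<in> R \<Longrightarrow> ((\<lambda>k. level_prob (\<mu> k) X v) \<longlongrightarrow> level_prob \<nu> X v) F"
  shows "((\<lambda>k. shannon_entropy (\<mu> k) X) \<longlongrightarrow> shannon_entropy \<nu> X) F"
  unfolding shannon_entropy_superset[OF assms(1,2)] shannon_entropy_superset[OF assms(1,3)]
  using assms(4) by (intro tendsto_minus tendsto_sum tendsto_mult_ln) auto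

lemma (in prob_space) tendsto_shannon_entropy_indicator_0:
  assumes "\<And>k. A k \<in> sets M" "(\<lambda>k. prob (A k)) \<longlonglongrightarrow> 0"
  shows "(\<lambda>k. shannon_entropy M (\<lambda>x. x \<in> A k)) \<longlonglongrightarrow> 0"
proof -
  have T: "level_prob M (\<lambda>x. x \<in> A k) True = prob (A k)" for k
    unfolding level_prob_def using sets.sets_into_space[OF assms(1)]
    by (intro arg_cong[where f=prob]) auto
  have F: "level_prob M (\<lambda>x. x \<in> A k) False = 1 - prob (A k)" for k
    unfolding level_prob_def prob_compl[OF assms(1), symmetric]
    by (intro arg_cong[where f=prob]) auto
  have "(\<lambda>k. - (prob (A k) * ln (prob (A k)) + (1 - prob (A k)) * ln (1 - prob (A k))))
    \<longlonglongrightarrow> - (0 * ln 0 + (1 - 0) * ln (1 - 0))"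
    by (intro tendsto_minus tendsto_add tendsto_mult_ln tendsto_diff tendsto_const assms) auto
  moreover have "shannon_entropy M (\<lambda>x. x \<in> A k)
      = - (prob (A k) * ln (prob (A k)) + (1 - prob (A k)) * ln (1 - prob (A k)))" for k
    by (subst shannon_entropy_superset[of "UNIV :: bool set"]) (auto simp: UNIV_bool T F)
  ultimately show ?thesis by simp
qed

section \<open>Invariant measures of a Markov shift\<close>

text \<open>Truncation by \<open>min\<close> makes \<open>letter N\<close> a function of
  \<open>letter N'\<close> whenever \<open>N \<le> N'\<close>, so the finite partitions are nested;
  it also depends on one coordinate only and is therefore continuous.\<close>

definition letter :: "nat \<Rightarrow> (nat \<Rightarrow> nat) \<Rightarrow> nat" where
  "letter N x = min (x 0) N"

abbreviation block :: "nat \<Rightarrow> nat \<Rightarrow> (nat \<Rightarrow> nat) \<Rightarrow> nat list" where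
  "block N n \<equiv> itinerary shift_map (letter N) n"

lemma shift_map_funpow: "(shift_map ^^ n) x i = x (n + i)"
  by (induction n arbitrary: x) (auto simp: shift_map_def simp del: funpow.simps simp: funpow_Suc_right)

lemma shift_map_funpow_shift_space: "x \<in> shift_space M \<Longrightarrow> (shift_map ^^ n) x \<in> shift_space M"
  by (auto simp: shift_space_def shift_map_funpow)

lemma continuous_on_shift_map_funpow: "continuous_on A (shift_map ^^ n :: (nat \<Rightarrow> 'a::topological_space) \<Rightarrow> _)"
  by (rule continuous_on_coordinatewise_then_product)
     (simp add: shift_map_funpow continuous_on_product_coordinates continuous_on_subset[OF continuous_on_product_coordinates])

lemma continuous_on_coordinate: "continuous_on A (\<lambda>x :: nat \<Rightarrow> nat. g (x i))"
proof -
  have "continuous_on A (\<lambda>x :: nat \<Rightarrow> nat. x i)"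
    by (rule continuous_on_subset[OF continuous_on_product_coordinates subset_UNIV])
  then show ?thesis
    using continuous_on_compose2[OF Topological_Spaces.continuous_on_discrete[of UNIV g]] by blast
qed

lemma block_eq_iff: "block N n x = block N n y \<longleftrightarrow> (\<forall>i<n. min (x i) N = min (y i) N)"
  by (simp add: itinerary_eq_iff letter_def shift_map_funpow)

lemma block_range: "block N n x \<in> {w. set w \<subseteq> {..N} \<and> length w = n}"
  by (auto simp: itinerary_def letter_def)

lemma finite_block_range: "finite {w. set w \<subseteq> {..N::nat} \<and> length w = n}"
  using finite_lists_length_eq[of "{..N}" n] by simp

locale shift_measure = measure_preserving \<nu> shift_map for \<nu> :: "(nat \<Rightarrow> nat) measure" +
  fixes M :: "nat \<Rightarrow> nat \<Rightarrow> nat"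
  assumes sets_eq: "sets \<nu> = sets (restrict_space borel (shift_space M))"

text \<open>Measurability of the shift is not a clause of \<open>invariant_measures\<close>; it
  follows from continuity and from the forward invariance of the shift space.\<close>

lemma invariant_measures_shift_measure:
  assumes "\<nu> \<in> invariant_measures M"
  shows "shift_measure \<nu> M"
proof -
  have \<nu>: "prob_space \<nu>" "sets \<nu> = sets (restrict_space borel (shift_space M))" "distr \<nu> \<nu> shift_map = \<nu>"
    using assms by (auto simp: invariant_measures_def)
  have "shift_map \<in> restrict_space borel (shift_space M) \<rightarrow>\<^sub>M restrict_space borel (shift_space M)"
  proof (rule measurable_restrict_space2)
    show "shift_map \<in> restrict_space borel (shift_space M) \<rightarrow>\<^sub>M borel"
      using continuous_on_shift_map_funpow[of _ 1] by (intro borel_measurable_continuous_on_restrict) simp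
  qed (use shift_map_funpow_shift_space[of _ M 1] in \<open>auto simp: space_restrict_space\<close>)
  then have "shift_map \<in> \<nu> \<rightarrow>\<^sub>M \<nu>"
    using measurable_cong_sets[OF \<nu>(2) \<nu>(2)] by simp
  then show ?thesis using \<nu>
    by (auto simp: shift_measure_def shift_measure_axioms_def measure_preserving_def measure_preserving_axioms_def)
qed

context shift_measure
begin

lemma space_eq [simp]: "space \<nu> = shift_space M"
  using sets_eq_imp_space_eq[OF sets_eq] by (simp add: space_restrict_space)

lemma prob_shift_space [simp]: "prob (shift_space M) = 1"
  using prob_space by simp

lemma borel_measurable_continuous:
  fixes g :: "(nat \<Rightarrow> nat) \<Rightarrow> 'b :: topological_space"
  shows "continuous_on (shift_space M) g \<Longrightarrow> g \<in> borel_measurable \<nu>"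
  using borel_measurable_continuous_on_restrict[of "shift_space M" g] measurable_cong_sets[OF sets_eq refl]
  by blast

lemma coordinate_measurable [measurable]:
  "(\<lambda>x. g (x i) :: 'b :: topological_space) \<in> borel_measurable \<nu>"
  by (intro borel_measurable_continuous continuous_on_coordinate)

lemma coordinate_sets: "{x \<in> shift_space M. P (x i)} \<in> sets \<nu>"
proof -
  have "(\<lambda>x. (of_bool (P (x i)) :: real)) -` {1} \<inter> space \<nu> \<in> sets \<nu>"
    by (rule measurable_sets[OF coordinate_measurable]) simp
  moreover have "(\<lambda>x. (of_bool (P (x i)) :: real)) -` {1} \<inter> space \<nu> = {x \<in> shift_space M. P (x i)}" by auto
  ultimately show ?thesis by simp
qed

lemma simple_function_letter: "simple_function \<nu> (letter N)"
proof -
  have "letter N ` space \<nu> \<subseteq> {..N}" by (auto simp: letter_def)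
  then have "finite (letter N ` space \<nu>)" by (rule finite_subset) simp
  then show ?thesis unfolding letter_def
    by (intro simple_function_borel_measurable coordinate_measurable)
qed

lemmas simple_function_block = simple_function_itinerary[OF simple_function_letter]

lemma simple_function_mem: "B \<in> sets \<nu> \<Longrightarrow> simple_function \<nu> (\<lambda>x. x \<in> B)"
  by (auto simp: simple_function_eq_measurable intro: finite_subset[of _ UNIV])

section \<open>Blocks generate the Borel sets\<close>

text \<open>One good block is enough: longer and finer blocks inherit the bound by
  \<open>cond_entropy_block_mono\<close>, so that finitely many sets can share a block.\<close>

definition block_approximable :: "(nat \<Rightarrow> nat) set \<Rightarrow> bool" where
  "block_approximable B \<longleftrightarrow> (\<forall>\<epsilon>>0. \<exists>N m. cond_entropy \<nu> (\<lambda>x. x \<in> B) (block N m) < \<epsilon>)"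

lemma cond_entropy_block_mono:
  assumes "simple_function \<nu> X" "N \<le> N'" "m \<le> m'"
  shows "cond_entropy \<nu> X (block N' m') \<le> cond_entropy \<nu> X (block N m)"
proof (rule cond_entropy_antimono[OF assms(1) simple_function_block simple_function_block])
  fix x y assume *: "block N' m' x = block N' m' y"
  have "min (x i) N = min (y i) N" if "i < m" for i
  proof -
    have "min (x i) N' = min (y i) N'" using * that assms(3) by (simp add: block_eq_iff)
    then show ?thesis using assms(2) by (auto simp: min_def split: if_splits)
  qed
  then show "block N m x = block N m y" by (simp add: block_eq_iff)
qed

text \<open>The approximable sets form a sigma-algebra, which replaces a martingale argument for generators.\<close>

lemma block_approximable_Un:
  assumes "block_approximable A" "block_approximable B" "A \<in> sets \<nu>" "B \<in> sets \<nu>"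
  shows "block_approximable (A \<union> B)"
  unfolding block_approximable_def
proof (intro allI impI)
  fix \<epsilon> :: real assume "\<epsilon> > 0"
  note S = simple_function_mem[OF assms(3)] simple_function_mem[OF assms(4)]
  obtain N m where 1: "cond_entropy \<nu> (\<lambda>x. x \<in> A) (block N m) < \<epsilon> / 2"
    using assms(1) \<open>\<epsilon> > 0\<close> unfolding block_approximable_def by (meson half_gt_zero)
  obtain N' m' where 2: "cond_entropy \<nu> (\<lambda>x. x \<in> B) (block N' m') < \<epsilon> / 2"
    using assms(2) \<open>\<epsilon> > 0\<close> unfolding block_approximable_def by (meson half_gt_zero)
  let ?Y = "block (max N N') (max m m')"
  have "cond_entropy \<nu> (\<lambda>x. x \<in> A \<union> B) ?Y \<le> cond_entropy \<nu> (\<lambda>x. (x \<in> A, x \<in> B)) ?Y"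
    using S by (intro cond_entropy_mono simple_function_Pair simple_function_block) auto
  also have "\<dots> \<le> cond_entropy \<nu> (\<lambda>x. x \<in> A) ?Y + cond_entropy \<nu> (\<lambda>x. x \<in> B) ?Y"
    using S by (intro cond_entropy_Pair_le simple_function_block)
  also have "\<dots> \<le> cond_entropy \<nu> (\<lambda>x. x \<in> A) (block N m) + cond_entropy \<nu> (\<lambda>x. x \<in> B) (block N' m')"
    using S by (intro add_mono cond_entropy_block_mono) auto
  also have "\<dots> < \<epsilon>" using 1 2 by simp
  finally show "\<exists>N m. cond_entropy \<nu> (\<lambda>x. x \<in> A \<union> B) (block N m) < \<epsilon>" by blast
qed

lemma block_approximable_coordinate: "block_approximable {x \<in> shift_space M. x i = j}"
  unfolding block_approximable_def
proof (intro allI impI exI)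
  fix \<epsilon> :: real assume "\<epsilon> > 0"
  have "cond_entropy \<nu> (\<lambda>x. x \<in> {x \<in> shift_space M. x i = j}) (block (Suc j) (Suc i)) = 0"
  proof (rule cond_entropy_eq_0[OF simple_function_mem[OF coordinate_sets] simple_function_block])
    fix x y assume "x \<in> space \<nu>" "y \<in> space \<nu>" "block (Suc j) (Suc i) x = block (Suc j) (Suc i) y"
    then have "min (x i) (Suc j) = min (y i) (Suc j)" by (simp add: block_eq_iff)
    then have "x i = j \<longleftrightarrow> y i = j" by (auto simp: min_def split: if_splits)
    then show "(x \<in> {x \<in> shift_space M. x i = j}) = (y \<in> {x \<in> shift_space M. x i = j})"
      using \<open>x \<in> space \<nu>\<close> \<open>y \<in> space \<nu>\<close> by simp
  qed
  then show "cond_entropy \<nu> (\<lambda>x. x \<in> {x \<in> shift_space M. x i = j}) (block (Suc j) (Suc i)) < \<epsilon>"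
    using \<open>\<epsilon> > 0\<close> by simp
qed

lemma block_approximable_empty: "block_approximable {}"
proof -
  have "cond_entropy \<nu> (\<lambda>x. x \<in> {}) (block 0 0) = 0"
    by (rule cond_entropy_eq_0[OF _ simple_function_block]) auto
  then show ?thesis unfolding block_approximable_def by metis
qed

text \<open>The union splits into a finite part, approximable by induction, and a rest
  \<open>R k\<close> whose probability tends to 0; the entropy of the indicator of
  \<open>R k\<close> then tends to 0 too and bounds its conditional entropy.\<close>

lemma block_approximable_UN:
  fixes A :: "nat \<Rightarrow> (nat \<Rightarrow> nat) set"
  assumes A: "\<And>i. A i \<in> sets \<nu>" "\<And>i. block_approximable (A i)"
  shows "block_approximable (\<Union>i. A i)"
  unfolding block_approximable_def
proof (intro allI impI)
  fix \<epsilon> :: real assume "\<epsilon> > 0"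
  define B where "B k = (\<Union>i<k. A i)" for k
  define R where "R k = (\<Union>i. A i) - B k" for k
  have B: "B k \<in> sets \<nu>" for k unfolding B_def using A by auto
  have R: "R k \<in> sets \<nu>" for k unfolding R_def using A B by auto
  have Bapp: "block_approximable (B k)" for k
  proof (induction k)
    case 0 then show ?case by (simp add: B_def block_approximable_empty)
  next
    case (Suc k)
    then have "block_approximable (B k \<union> A k)" by (intro block_approximable_Un A B)
    moreover have "B (Suc k) = B k \<union> A k" by (auto simp: B_def less_Suc_eq)
    ultimately show ?case by simp
  qed
  have "(\<lambda>k. measure \<nu> (R k)) \<longlonglongrightarrow> measure \<nu> (\<Inter>k. R k)"
    using R by (intro finite_Lim_measure_decseq) (auto simp: decseq_def R_def B_def)
  moreover have "(\<Inter>k. R k) = {}" by (auto simp: R_def B_def)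
  ultimately have "(\<lambda>k. shannon_entropy \<nu> (\<lambda>x. x \<in> R k)) \<longlonglongrightarrow> 0"
    by (intro tendsto_shannon_entropy_indicator_0 R) simp
  then have "eventually (\<lambda>k. shannon_entropy \<nu> (\<lambda>x. x \<in> R k) < \<epsilon> / 2) sequentially"
    using \<open>\<epsilon> > 0\<close> by (intro order_tendstoD(2)) auto
  then obtain k where k: "shannon_entropy \<nu> (\<lambda>x. x \<in> R k) < \<epsilon> / 2"
    by (auto simp: eventually_sequentially)
  obtain N m where Nm: "cond_entropy \<nu> (\<lambda>x. x \<in> B k) (block N m) < \<epsilon> / 2"
    using Bapp[of k] \<open>\<epsilon> > 0\<close> unfolding block_approximable_def by (meson half_gt_zero)
  note S = simple_function_mem[OF B] simple_function_mem[OF R] simple_function_block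
  have "cond_entropy \<nu> (\<lambda>x. x \<in> (\<Union>i. A i)) (block N m) \<le> cond_entropy \<nu> (\<lambda>x. (x \<in> B k, x \<in> R k)) (block N m)"
  proof (rule cond_entropy_mono[OF simple_function_Pair[OF S(1,2)] S(3)])
    fix x y assume "(x \<in> B k, x \<in> R k) = (y \<in> B k, y \<in> R k)"
    moreover have "z \<in> (\<Union>i. A i) \<longleftrightarrow> z \<in> B k \<or> z \<in> R k" for z
      by (auto simp: R_def B_def)
    ultimately show "(x \<in> (\<Union>i. A i)) = (y \<in> (\<Union>i. A i))" by simp
  qed
  also have "\<dots> \<le> cond_entropy \<nu> (\<lambda>x. x \<in> B k) (block N m) + cond_entropy \<nu> (\<lambda>x. x \<in> R k) (block N m)"
    by (rule cond_entropy_Pair_le[OF S])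
  also have "cond_entropy \<nu> (\<lambda>x. x \<in> R k) (block N m) \<le> shannon_entropy \<nu> (\<lambda>x. x \<in> R k)"
    by (rule cond_entropy_le[OF S(2,3)])
  also have "cond_entropy \<nu> (\<lambda>x. x \<in> B k) (block N m) + shannon_entropy \<nu> (\<lambda>x. x \<in> R k) < \<epsilon>"
    using Nm k by simp
  finally show "\<exists>N m. cond_entropy \<nu> (\<lambda>x. x \<in> (\<Union>i. A i)) (block N m) < \<epsilon>" by auto
qed

lemma sets_borel_seq: "sets (borel :: (nat \<Rightarrow> nat) measure) = sigma_sets UNIV {{x. x i \<in> A} | i A. True}"
  using sets_PiM_equal_borel[where 'a=nat and 'b=nat] sets_PiM_single[of "UNIV :: nat set" "\<lambda>_. borel :: nat measure"]
  by (simp add: sets_borel_eq_count_space)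

lemma block_approximable_sets:
  assumes "B \<in> sets \<nu>"
  shows "block_approximable B"
proof -
  have into: "C \<inter> shift_space M \<in> sets \<nu>" if "C \<in> sets borel" for C
    using that by (auto simp: sets_eq sets_restrict_space)
  obtain C where C: "C \<in> sets borel" "B = C \<inter> shift_space M"
    using assms by (auto simp: sets_eq sets_restrict_space)
  have "C \<in> sigma_sets UNIV {{x :: nat \<Rightarrow> nat. x i \<in> A} | i A. True}"
    using C(1) by (simp add: sets_borel_seq)
  then have "C \<in> sets borel \<and> block_approximable (C \<inter> shift_space M)"
  proof induction
    case (Basic a)
    then obtain i A where a: "a = {x. x i \<in> A}" by blast
    have "open ((\<lambda>x :: nat \<Rightarrow> nat. x i) -` A)"
      by (rule open_vimage[OF Topological_Spaces.open_discrete continuous_on_product_coordinates])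
    then have "a \<in> sets borel" unfolding a vimage_def by (rule borel_open)
    define D where "D j = {x \<in> shift_space M. x i = j \<and> j \<in> A}" for j
    have D: "D j \<in> sets \<nu>" for j
      unfolding D_def by (rule coordinate_sets[of "\<lambda>v. v = j \<and> j \<in> A" i])
    have "block_approximable (D j)" for j
    proof (cases "j \<in> A")
      case True
      then have "D j = {x \<in> shift_space M. x i = j}" unfolding D_def by simp
      then show ?thesis using block_approximable_coordinate by simp
    qed (simp add: D_def block_approximable_empty)
    then have "block_approximable (\<Union>j. D j)" by (rule block_approximable_UN[OF D])
    moreover have "(\<Union>j. D j) = a \<inter> shift_space M"
    proof (intro set_eqI)
      fix x show "x \<in> (\<Union>j. D j) \<longleftrightarrow> x \<in> a \<inter> shift_space M" by (auto simp: D_def a)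
    qed
    ultimately show ?case using \<open>a \<in> sets borel\<close> by simp
  next
    case Empty
    then show ?case by (simp add: block_approximable_empty)
  next
    case (Compl a)
    have "cond_entropy \<nu> (\<lambda>x. x \<in> (UNIV - a) \<inter> shift_space M) (block N m)
        \<le> cond_entropy \<nu> (\<lambda>x. x \<in> a \<inter> shift_space M) (block N m)" for N m
    proof (rule cond_entropy_mono[OF simple_function_mem simple_function_block])
      show "a \<inter> shift_space M \<in> sets \<nu>" using Compl.IH into by blast
      fix x y assume "x \<in> space \<nu>" "y \<in> space \<nu>" "(x \<in> a \<inter> shift_space M) = (y \<in> a \<inter> shift_space M)"
      then show "(x \<in> (UNIV - a) \<inter> shift_space M) = (y \<in> (UNIV - a) \<inter> shift_space M)"
        by (metis Diff_iff IntI Int_iff UNIV_I space_eq)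
    qed
    then have "block_approximable ((UNIV - a) \<inter> shift_space M)"
      using Compl.IH unfolding block_approximable_def by (meson le_less_trans)
    moreover have "UNIV - a \<in> sets borel" using Compl.IH by (simp add: Compl_eq_Diff_UNIV[symmetric] borel_comp)
    ultimately show ?case by simp
  next
    case (Union a)
    then have "block_approximable (\<Union>i. a i \<inter> shift_space M)"
      by (intro block_approximable_UN into) auto
    moreover have "(\<Union>i. a i \<inter> shift_space M) = (\<Union>i. a i) \<inter> shift_space M" by auto
    ultimately show ?case using Union by auto
  qed
  then show ?thesis using C by simp
qed

lemma part_block_approximable:
  assumes P: "finite_measurable_partition \<nu> P" and "\<epsilon> > 0"
  obtains N m where "cond_entropy \<nu> (part P) (block N m) < \<epsilon>"
proof -
  have P': "partition_on (space \<nu>) P" "finite P" "P \<subseteq> sets \<nu>"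
    using P by (auto simp: finite_measurable_partition_def)
  \<comment> \<open>Labelling a point by the set of members that contain it makes sense for every
    subfamily, which permits induction over the finite partition.\<close>
  define X where "X F x = {A \<in> F. x \<in> A}" for F and x :: "nat \<Rightarrow> nat"
  have "F \<subseteq> P \<Longrightarrow> simple_function \<nu> (X F) \<and> (\<forall>\<epsilon>>0. \<exists>N m. cond_entropy \<nu> (X F) (block N m) < \<epsilon>)" if "finite F" for F
    using that
  proof (induction F)
    case empty
    have S: "simple_function \<nu> (X {})"
      by (rule simple_function_cong[THEN iffD2, OF _ simple_function_const[of \<nu> "{}"]]) (simp add: X_def)
    have "cond_entropy \<nu> (X {}) (block 0 0) = 0"
      by (rule cond_entropy_eq_0[OF S simple_function_block]) (simp add: X_def)
    then show ?case using S by metis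
  next
    case (insert A F)
    then have A: "A \<in> sets \<nu>" and IH: "simple_function \<nu> (X F)"
      "\<And>\<epsilon>. \<epsilon> > 0 \<Longrightarrow> \<exists>N m. cond_entropy \<nu> (X F) (block N m) < \<epsilon>"
      using P' by auto
    note S = simple_function_mem[OF A] IH(1)
    have eq: "X (insert A F) = (\<lambda>x. (if x \<in> A then {A} else {}) \<union> X F x)"
      by (auto simp: X_def fun_eq_iff)
    have "simple_function \<nu> (X (insert A F))"
      unfolding eq using simple_function_compose2[OF S, of "\<lambda>a B. (if a then {A} else {}) \<union> B"] by simp
    moreover have "\<exists>N m. cond_entropy \<nu> (X (insert A F)) (block N m) < \<epsilon>" if "\<epsilon> > 0" for \<epsilon> :: real
    proof -
      obtain N m where 1: "cond_entropy \<nu> (\<lambda>x. x \<in> A) (block N m) < \<epsilon> / 2"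
        using block_approximable_sets[OF A] \<open>\<epsilon> > 0\<close> unfolding block_approximable_def by (meson half_gt_zero)
      obtain N' m' where 2: "cond_entropy \<nu> (X F) (block N' m') < \<epsilon> / 2"
        using IH(2)[of "\<epsilon> / 2"] \<open>\<epsilon> > 0\<close> by auto
      let ?Y = "block (max N N') (max m m')"
      have "cond_entropy \<nu> (X (insert A F)) ?Y \<le> cond_entropy \<nu> (\<lambda>x. (x \<in> A, X F x)) ?Y"
        unfolding eq by (intro cond_entropy_mono simple_function_Pair simple_function_block S) auto
      also have "\<dots> \<le> cond_entropy \<nu> (\<lambda>x. x \<in> A) ?Y + cond_entropy \<nu> (X F) ?Y"
        by (intro cond_entropy_Pair_le simple_function_block S)
      also have "\<dots> \<le> cond_entropy \<nu> (\<lambda>x. x \<in> A) (block N m) + cond_entropy \<nu> (X F) (block N' m')"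
        by (intro add_mono cond_entropy_block_mono S) auto
      also have "\<dots> < \<epsilon>" using 1 2 by simp
      finally show ?thesis by blast
    qed
    ultimately show ?case by blast
  qed
  from this[OF P'(2) order.refl] \<open>\<epsilon> > 0\<close> obtain N m where
    Nm: "simple_function \<nu> (X P)" "cond_entropy \<nu> (X P) (block N m) < \<epsilon>" by blast
  have "cond_entropy \<nu> (part P) (block N m) \<le> cond_entropy \<nu> (X P) (block N m)"
  proof (rule cond_entropy_mono[OF Nm(1) simple_function_block])
    fix x y assume "X P x = X P y"
    then have "A \<in> P \<and> x \<in> A \<longleftrightarrow> A \<in> P \<and> y \<in> A" for A by (auto simp: X_def set_eq_iff)
    then show "part P x = part P y" by (simp add: part_def)
  qed
  then show ?thesis using Nm(2) by (intro that[of N m]) simp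
qed

text \<open>The Kolmogorov-Sinai generator argument: given a suitable block, the label of any finite
  partition has conditional entropy below \<open>\<epsilon>\<close>, so its rate exceeds that of a
  letter partition by at most \<open>\<epsilon>\<close>. Only large \<open>N\<close> matter, since a
  finer block is at least as good.\<close>

lemma ks_entropy_le_of_letters:
  assumes "\<And>N. N \<ge> N0 \<Longrightarrow> entropy_rate \<nu> shift_map (letter N) \<le> c"
  shows "ks_entropy \<nu> shift_map \<le> ereal c"
proof (rule ks_entropy_le)
  fix P assume P: "finite_measurable_partition \<nu> P"
  have "entropy_rate \<nu> shift_map (part P) \<le> c + \<epsilon>" if "\<epsilon> > 0" for \<epsilon>
  proof -
    obtain N m where "cond_entropy \<nu> (part P) (block N m) < \<epsilon>"
      using part_block_approximable[OF P \<open>\<epsilon> > 0\<close>] by blast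
    then have "cond_entropy \<nu> (part P) (block (max N N0) m) < \<epsilon>"
      using cond_entropy_block_mono[OF simple_function_part[OF P], of N "max N N0" m m] by simp
    then show ?thesis
      using entropy_rate_le_add_cond_entropy[OF simple_function_part[OF P] simple_function_letter, of "max N N0" m]
        assms[of "max N N0"] by simp
  qed
  then show "ereal (entropy_rate \<nu> shift_map (part P)) \<le> ereal c"
    using field_le_epsilon by auto
qed

end

section \<open>Entropy lost by lumping letters\<close>

context shift_measure
begin

lemma level_prob_letter:
  "v < N \<Longrightarrow> level_prob \<nu> (letter N) v = prob {x \<in> shift_space M. x 0 = v}"
  "level_prob \<nu> (letter N) N = prob {x \<in> shift_space M. N \<le> x 0}"
  unfolding level_prob_def by (rule arg_cong[where f=prob], auto simp: letter_def)+

lemma shannon_entropy_letter: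
  "shannon_entropy \<nu> (letter N) =
    - (\<Sum>i<N. prob {x \<in> shift_space M. x 0 = i} * ln (prob {x \<in> shift_space M. x 0 = i}))
    - prob {x \<in> shift_space M. N \<le> x 0} * ln (prob {x \<in> shift_space M. N \<le> x 0})"
proof -
  have "shannon_entropy \<nu> (letter N) = - (\<Sum>v\<le>N. level_prob \<nu> (letter N) v * ln (level_prob \<nu> (letter N) v))"
    by (rule shannon_entropy_superset) (auto simp: letter_def)
  then show ?thesis by (simp add: level_prob_letter lessThan_Suc_atMost[symmetric])
qed

text \<open>The rates differ by at most the conditional entropy of \<open>letter N'\<close> given
  \<open>letter N\<close>, which is a difference of Shannon entropies because the partitions are
  nested. The letters from \<open>N\<close> to \<open>N' - 1\<close> are estimated by
  \<open>neg_mult_ln_le\<close>; the new lumped letter \<open>N'\<close> keeps its own term.\<close>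

lemma entropy_rate_letter_le:
  assumes "N \<le> N'"
  shows "entropy_rate \<nu> shift_map (letter N') \<le> entropy_rate \<nu> shift_map (letter N)
    + (\<Sum>i\<in>{N..<N'}. prob {x \<in> shift_space M. x 0 = i} * b i + exp (- b i))
    - prob {x \<in> shift_space M. N' \<le> x 0} * ln (prob {x \<in> shift_space M. N' \<le> x 0})"
proof -
  define p where "p i = prob {x \<in> shift_space M. x 0 = i}" for i
  define q where "q N = prob {x \<in> shift_space M. N \<le> x 0}" for N
  have pair: "shannon_entropy \<nu> (\<lambda>x. (letter N' x, block N 1 x)) = shannon_entropy \<nu> (letter N')"
  proof (rule shannon_entropy_eqI[OF simple_function_Pair[OF simple_function_letter simple_function_block] simple_function_letter])
    fix x y :: "nat \<Rightarrow> nat"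
    show "((letter N' x, block N 1 x) = (letter N' y, block N 1 y)) = (letter N' x = letter N' y)"
      using assms by (auto simp: block_eq_iff letter_def min_def split: if_splits)
  qed
  have single: "shannon_entropy \<nu> (block N 1) = shannon_entropy \<nu> (letter N)"
    by (rule shannon_entropy_eqI[OF simple_function_block simple_function_letter])
       (auto simp: block_eq_iff letter_def)
  have "cond_entropy \<nu> (letter N') (block N 1) = shannon_entropy \<nu> (letter N') - shannon_entropy \<nu> (letter N)"
    unfolding cond_entropy_def pair single ..
  also have "\<dots> = (\<Sum>i<N. p i * ln (p i)) - (\<Sum>i<N'. p i * ln (p i)) - q N' * ln (q N') + q N * ln (q N)"
    unfolding shannon_entropy_letter p_def q_def by simp
  also have "(\<Sum>i<N. p i * ln (p i)) - (\<Sum>i<N'. p i * ln (p i)) = (\<Sum>i\<in>{N..<N'}. - (p i * ln (p i)))"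
  proof -
    have "{..<N'} = {..<N} \<union> {N..<N'}" using assms by auto
    then have "(\<Sum>i<N'. p i * ln (p i)) = (\<Sum>i<N. p i * ln (p i)) + (\<Sum>i\<in>{N..<N'}. p i * ln (p i))"
      by (simp add: sum.union_disjoint ivl_disj_int)
    then show ?thesis by (simp add: sum_negf)
  qed
  also have "\<dots> \<le> (\<Sum>i\<in>{N..<N'}. p i * b i + exp (- b i))"
    by (intro sum_mono neg_mult_ln_le) (simp add: p_def)
  also have "q N * ln (q N) \<le> 0"
  proof (cases "q N = 0")
    case False
    then have "0 < q N" "q N \<le> 1" by (auto simp: q_def less_le)
    then show ?thesis by (intro mult_nonneg_nonpos) auto
  qed simp
  finally have "cond_entropy \<nu> (letter N') (block N 1) \<le> (\<Sum>i\<in>{N..<N'}. p i * b i + exp (- b i)) - q N' * ln (q N')"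
    by simp
  then show ?thesis
    using entropy_rate_le_add_cond_entropy[OF simple_function_letter simple_function_letter, of N' N 1]
    unfolding p_def q_def by linarith
qed

lemma tendsto_prob_tail: "(\<lambda>N. prob {x \<in> shift_space M. N \<le> x 0}) \<longlonglongrightarrow> 0"
proof -
  have "(\<lambda>N. prob {x \<in> shift_space M. N \<le> x 0}) \<longlonglongrightarrow> prob (\<Inter>N. {x \<in> shift_space M. N \<le> x 0})"
  proof (rule finite_Lim_measure_decseq)
    show "range (\<lambda>N. {x \<in> shift_space M. N \<le> x 0}) \<subseteq> sets \<nu>"
    proof (rule image_subsetI)
      fix N show "{x \<in> shift_space M. N \<le> x 0} \<in> sets \<nu>" by (rule coordinate_sets[of "\<lambda>v. N \<le> v" 0])
    qed
  qed (force simp: decseq_def)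
  moreover have "(\<Inter>N. {x \<in> shift_space M. N \<le> x 0}) = {}"
  proof -
    have "x \<notin> (\<Inter>N. {x \<in> shift_space M. N \<le> x 0})" for x
      by (auto intro!: exI[of _ "Suc (x 0)"])
    then show ?thesis by auto
  qed
  ultimately show ?thesis by simp
qed

text \<open>For large \<open>N'\<close> the term of the lumped letter is negligible because the tail
  probability tends to 0, while the sums over the intermediate letters stay below the integral and
  the series. The generator argument then concludes.\<close>

lemma ks_entropy_le_tail:
  assumes b: "\<And>i. i \<ge> N \<Longrightarrow> b i \<ge> 0"
    and int: "integrable \<nu> (\<lambda>x. if N \<le> x 0 then b (x 0) else 0)"
    and sum: "summable (\<lambda>i. exp (- b i))"
  shows "ks_entropy \<nu> shift_map \<le> ereal (entropy_rate \<nu> shift_map (letter N)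
    + (\<integral>x. (if N \<le> x 0 then b (x 0) else 0) \<partial>\<nu>) + (\<Sum>i. exp (- b (i + N))))"
proof -
  define p where "p i = prob {x \<in> shift_space M. x 0 = i}" for i
  define q where "q N = prob {x \<in> shift_space M. N \<le> x 0}" for N
  define S where "S = entropy_rate \<nu> shift_map (letter N)
    + (\<integral>x. (if N \<le> x 0 then b (x 0) else 0) \<partial>\<nu>) + (\<Sum>i. exp (- b (i + N)))"
  have rate: "entropy_rate \<nu> shift_map (letter N') \<le> S - q N' * ln (q N')" if "N \<le> N'" for N'
  proof -
    have int_p: "integrable \<nu> (\<lambda>x. b i * indicator {x \<in> shift_space M. x 0 = i} x)" for i
      by (intro integrable_mult_right integrable_real_indicator coordinate_sets[of "\<lambda>v. v = i" 0]) (simp add: less_top[symmetric])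
    have "(\<Sum>i\<in>{N..<N'}. p i * b i) = (\<Sum>i\<in>{N..<N'}. \<integral>x. b i * indicator {x \<in> shift_space M. x 0 = i} x \<partial>\<nu>)"
    proof (intro sum.cong refl)
      fix i
      have "{x \<in> shift_space M. x 0 = i} \<inter> space \<nu> = {x \<in> shift_space M. x 0 = i}" by auto
      then show "p i * b i = (\<integral>x. b i * indicator {x \<in> shift_space M. x 0 = i} x \<partial>\<nu>)"
        by (simp add: p_def mult.commute)
    qed
    also have "\<dots> = (\<integral>x. (\<Sum>i\<in>{N..<N'}. b i * indicator {x \<in> shift_space M. x 0 = i} x) \<partial>\<nu>)"
      by (rule Bochner_Integration.integral_sum[symmetric, OF int_p])
    also have "\<dots> \<le> (\<integral>x. (if N \<le> x 0 then b (x 0) else 0) \<partial>\<nu>)"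
    proof (rule integral_mono[OF _ int])
      show "integrable \<nu> (\<lambda>x. \<Sum>i\<in>{N..<N'}. b i * indicator {x \<in> shift_space M. x 0 = i} x)"
        using int_p by (rule Bochner_Integration.integrable_sum)
      fix x assume x: "x \<in> space \<nu>"
      have "(\<Sum>i\<in>{N..<N'}. b i * indicator {x \<in> shift_space M. x 0 = i} x)
          = (\<Sum>i\<in>{N..<N'}. if i = x 0 then b i else 0)"
        using x by (intro sum.cong refl) (simp add: indicator_def)
      also have "\<dots> \<le> (if N \<le> x 0 then b (x 0) else 0)" using b by auto
      finally show "(\<Sum>i\<in>{N..<N'}. b i * indicator {x \<in> shift_space M. x 0 = i} x)
        \<le> (if N \<le> x 0 then b (x 0) else 0)" .
    qed
    finally have 1: "(\<Sum>i\<in>{N..<N'}. p i * b i) \<le> (\<integral>x. (if N \<le> x 0 then b (x 0) else 0) \<partial>\<nu>)" .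
    have "(\<Sum>i\<in>{N..<N'}. exp (- b i)) = (\<Sum>i<N' - N. exp (- b (i + N)))"
      using that by (intro sum.reindex_bij_witness[of _ "\<lambda>i. i + N" "\<lambda>i. i - N"]) auto
    also have "\<dots> \<le> (\<Sum>i. exp (- b (i + N)))"
      using summable_ignore_initial_segment[OF sum, of N] by (intro sum_le_suminf) auto
    finally show ?thesis
      using entropy_rate_letter_le[OF that, of b] 1 unfolding S_def p_def q_def
      by (simp add: sum.distrib)
  qed
  have "(\<lambda>N. - (q N * ln (q N))) \<longlonglongrightarrow> - (0 * ln 0)"
    unfolding q_def by (intro tendsto_minus tendsto_mult_ln tendsto_prob_tail) auto
  then have lim: "(\<lambda>N. - (q N * ln (q N))) \<longlonglongrightarrow> 0" by simp
  have "ks_entropy \<nu> shift_map \<le> ereal (S + \<epsilon>)" if "\<epsilon> > 0" for \<epsilon>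
  proof -
    have "eventually (\<lambda>N. - (q N * ln (q N)) < \<epsilon>) sequentially"
      using lim that by (rule order_tendstoD)
    then obtain N1 where N1: "\<And>n. n \<ge> N1 \<Longrightarrow> - (q n * ln (q n)) < \<epsilon>"
      by (auto simp: eventually_sequentially)
    show ?thesis
    proof (rule ks_entropy_le_of_letters)
      fix n assume "n \<ge> max N N1"
      then show "entropy_rate \<nu> shift_map (letter n) \<le> S + \<epsilon>" using rate[of n] N1[of n] by simp
    qed
  qed
  then have "ks_entropy \<nu> shift_map \<le> ereal S + ereal \<epsilon>" if "\<epsilon> > 0" for \<epsilon> using that by simp
  then have "ks_entropy \<nu> shift_map \<le> ereal S" by (rule ereal_le_epsilon2)
  then show ?thesis by (simp add: S_def)
qed

end

section \<open>Passing to weak limits\<close>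

text \<open>The levels of a block are clopen, so their indicators are admissible test functions, and
  there are finitely many of them.\<close>

lemma tendsto_entropy_block:
  assumes \<nu>: "\<And>k. shift_measure (\<nu> k) M" "shift_measure \<nu>' M" and w: "weakly_converges M \<nu> \<nu>'"
  shows "(\<lambda>k. shannon_entropy (\<nu> k) (block N n)) \<longlonglongrightarrow> shannon_entropy \<nu>' (block N n)"
proof (rule tendsto_shannon_entropy[OF finite_block_range])
  fix v
  define D where "D = {x \<in> shift_space M. block N n x = v}"
  have lp: "level_prob \<kappa> (block N n) v = (\<integral>x. indicator D x \<partial>\<kappa>)" if "shift_measure \<kappa> M" for \<kappa>
  proof -
    interpret shift_measure \<kappa> M by fact
    have "block N n -` {v} \<inter> space \<kappa> = D" by (auto simp: D_def)
    moreover have "D \<inter> space \<kappa> = D" by (auto simp: D_def)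
    ultimately show ?thesis by (simp add: level_prob_def)
  qed
  have "continuous_on (shift_space M) (\<lambda>x. of_bool (block N n x = v) :: real)"
  proof -
    \<comment> \<open>A finite product of functions of single coordinates is continuous; the first
      factor disposes of words \<open>v\<close> of the wrong length.\<close>
    have "(of_bool (block N n x = v) :: real)
        = of_bool (length v = n) * (\<Prod>i<n. of_bool (min (x i) N = v ! i))" for x
    proof (cases "length v = n")
      case True
      have "block N n x = v \<longleftrightarrow> (\<forall>i<n. min (x i) N = v ! i)"
        using True by (auto simp: itinerary_def letter_def shift_map_funpow list_eq_iff_nth_eq)
      then show ?thesis using True by (auto simp: prod_eq_1_iff intro!: prod_zero)
    qed (auto simp: itinerary_def)
    then show ?thesis
      by (simp only:) (intro continuous_intros continuous_on_coordinate)
  qed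
  then have "continuous_on (shift_space M) (\<lambda>x. indicator D x :: real)"
    by (rule continuous_on_eq) (simp add: D_def indicator_def)
  moreover have "bounded ((\<lambda>x. indicator D x :: real) ` shift_space M)"
    by (intro boundedI[of _ 1]) (auto simp: indicator_def)
  ultimately have "(\<lambda>k. \<integral>x. indicator D x \<partial>\<nu> k) \<longlonglongrightarrow> (\<integral>x. indicator D x \<partial>\<nu>' :: real)"
    using w unfolding weakly_converges_def by blast
  then show "(\<lambda>k. level_prob (\<nu> k) (block N n) v) \<longlonglongrightarrow> level_prob \<nu>' (block N n) v"
    using lp \<nu> by simp
qed (use block_range in blast)+

text \<open>As \<open>g\<close> may be unbounded below, the test functions are its truncations at
  \<open>- R\<close>. Their integrals dominate that of \<open>g\<close>, so the bound
  \<open>c\<close> survives the limit; monotone convergence in \<open>R\<close> then gives both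
  integrability and the bound. The assumption is only frequent so that it can be met inside a proof
  by contradiction.\<close>

lemma weakly_converges_integral_ge:
  fixes g :: "(nat \<Rightarrow> nat) \<Rightarrow> real"
  assumes \<nu>: "\<And>k. shift_measure (\<nu> k) M" "shift_measure \<nu>' M" and w: "weakly_converges M \<nu> \<nu>'"
    and g: "continuous_on (shift_space M) g" "\<And>x. x \<in> shift_space M \<Longrightarrow> g x \<le> B"
      "\<And>k. integrable (\<nu> k) g"
    and freq: "\<exists>\<^sub>F k in sequentially. (\<integral>x. g x \<partial>\<nu> k) \<ge> c"
  shows "integrable \<nu>' g" "(\<integral>x. g x \<partial>\<nu>') \<ge> c"
proof -
  interpret \<nu>': shift_measure \<nu>' M by fact
  define gR where "gR R x = max (g x) (- real R)" for R x
  have cont: "continuous_on (shift_space M) (gR R)" for R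
    unfolding gR_def by (intro continuous_intros g)
  have bd: "\<bar>gR R x\<bar> \<le> \<bar>B\<bar> + real R" if "x \<in> shift_space M" for R x
    using g(2)[OF that] by (auto simp: gR_def max_def)
  have int: "integrable \<kappa> (gR R)" if "shift_measure \<kappa> M" for R \<kappa>
  proof -
    interpret shift_measure \<kappa> M by fact
    show ?thesis using bd borel_measurable_continuous[OF cont]
      by (intro integrable_const_bound[of _ "\<bar>B\<bar> + real R"]) auto
  qed
  have ge: "(\<integral>x. gR R x \<partial>\<nu>') \<ge> c" for R
  proof (rule ccontr)
    assume "\<not> (\<integral>x. gR R x \<partial>\<nu>') \<ge> c"
    moreover have "(\<lambda>k. \<integral>x. gR R x \<partial>\<nu> k) \<longlonglongrightarrow> (\<integral>x. gR R x \<partial>\<nu>')"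
    proof -
      have "bounded (gR R ` shift_space M)"
        using bd by (intro boundedI[of _ "\<bar>B\<bar> + real R"]) auto
      then show ?thesis using w cont unfolding weakly_converges_def by blast
    qed
    ultimately have "eventually (\<lambda>k. (\<integral>x. gR R x \<partial>\<nu> k) < c) sequentially"
      by (auto intro: order_tendstoD)
    with freq have "\<exists>\<^sub>F k in sequentially. (\<integral>x. g x \<partial>\<nu> k) \<ge> c \<and> (\<integral>x. gR R x \<partial>\<nu> k) < c"
      by (rule frequently_eventually_frequently)
    then obtain k where k: "(\<integral>x. g x \<partial>\<nu> k) \<ge> c" "(\<integral>x. gR R x \<partial>\<nu> k) < c"
      by (auto dest: frequently_ex)
    have "(\<integral>x. g x \<partial>\<nu> k) \<le> (\<integral>x. gR R x \<partial>\<nu> k)"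
      by (rule integral_mono[OF g(3) int[OF \<nu>(1)]]) (simp add: gR_def)
    then show False using k by simp
  qed
  \<comment> \<open>With the sign changed the integrals increase in \<open>R\<close> and are bounded
    by \<open>- c\<close>, as monotone convergence requires.\<close>
  define a where "a R = (\<integral>x. - gR R x \<partial>\<nu>')" for R
  have int': "integrable \<nu>' (\<lambda>x. - gR R x)" for R using int[OF \<nu>(2)] by simp
  have "incseq a" unfolding a_def
    by (intro incseq_SucI integral_mono[OF int' int']) (simp add: gR_def)
  moreover have "a R \<le> - c" for R using ge[of R] by (simp add: a_def)
  ultimately obtain L where L: "a \<longlonglongrightarrow> L" "\<And>R. a R \<le> L" using incseq_convergent[of a "- c"] by blast
  have "L \<le> - c" using L(1) \<open>\<And>R. a R \<le> - c\<close> by (intro LIMSEQ_le_const2) auto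
  have conv: "AE x in \<nu>'. (\<lambda>R. - gR R x) \<longlonglongrightarrow> - g x"
  proof (intro AE_I2 tendsto_minus)
    fix x
    obtain R0 :: nat where "- g x \<le> real R0" using real_arch_simple by blast
    then have "eventually (\<lambda>R. gR R x = g x) sequentially"
      unfolding eventually_sequentially by (intro exI[of _ R0]) (auto simp: gR_def max_def)
    then show "(\<lambda>R. gR R x) \<longlonglongrightarrow> g x" by (rule tendsto_eventually)
  qed
  have mono: "AE x in \<nu>'. mono (\<lambda>R. - gR R x)" by (auto simp: gR_def mono_def)
  have meas: "(\<lambda>x. - g x) \<in> borel_measurable \<nu>'"
    using \<nu>'.borel_measurable_continuous[OF g(1)] by simp
  have ilim: "(\<lambda>R. \<integral>x. - gR R x \<partial>\<nu>') \<longlonglongrightarrow> L" using L(1) unfolding a_def .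
  have "integrable \<nu>' (\<lambda>x. - g x)" "(\<integral>x. - g x \<partial>\<nu>') = L"
    using integrable_monotone_convergence[OF int' mono conv ilim meas]
      integral_monotone_convergence[OF int' mono conv ilim meas] by auto
  then show "integrable \<nu>' g" "(\<integral>x. g x \<partial>\<nu>') \<ge> c"
    using \<open>L \<le> - c\<close> by auto
qed

section \<open>Almost-additive potentials\<close>

text \<open>The constants are parameters instead of being hidden in existential quantifiers, so that
  the locale can be instantiated again for a multiple of the potential. The value \<open>s i\<close>
  may be any upper bound of \<open>f 1\<close> on the letter \<open>i\<close> for which the
  exponentials are summable.\<close>

locale markov_potential =
  fixes M :: "nat \<Rightarrow> nat \<Rightarrow> nat" and f :: "nat \<Rightarrow> (nat \<Rightarrow> nat) \<Rightarrow> real" and C :: real and s :: "nat \<Rightarrow> real"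
  assumes C_nonneg: "C \<ge> 0"
    and continuous: "n \<ge> 1 \<Longrightarrow> continuous_on (shift_space M) (f n)"
    and almost_add_le: "n \<ge> 1 \<Longrightarrow> m \<ge> 1 \<Longrightarrow> x \<in> shift_space M \<Longrightarrow>
      f (n + m) x \<le> f n x + f m ((shift_map ^^ n) x) + C"
    and almost_add_ge: "n \<ge> 1 \<Longrightarrow> m \<ge> 1 \<Longrightarrow> x \<in> shift_space M \<Longrightarrow>
      f n x + f m ((shift_map ^^ n) x) - C \<le> f (n + m) x"
    and variation: "n \<ge> 1 \<Longrightarrow> x \<in> shift_space M \<Longrightarrow> y \<in> shift_space M \<Longrightarrow> (\<And>i. i < n \<Longrightarrow> x i = y i) \<Longrightarrow>
      \<bar>f n x - f n y\<bar> \<le> C"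
    and le_letter: "x \<in> shift_space M \<Longrightarrow> f 1 x \<le> s (x 0)"
    and summable_exp: "summable (\<lambda>i. exp (s i))"
begin

text \<open>Everything proved for the potential becomes available for its multiples. Summability
  persists because \<open>s i \<le> 0\<close> for large \<open>i\<close>, where
  \<open>t * s i \<le> s i\<close>.\<close>

lemma scale:
  assumes "t \<ge> 1"
  shows "markov_potential M (\<lambda>n x. t * f n x) (t * C) (\<lambda>i. t * s i)"
proof
  show "t * C \<ge> 0" using assms C_nonneg by simp
  show "continuous_on (shift_space M) (\<lambda>x. t * f n x)" if "n \<ge> 1" for n
    using continuous[OF that] by (intro continuous_intros)
  fix n m x assume nm: "n \<ge> (1::nat)" "m \<ge> (1::nat)" "x \<in> shift_space M"
  have "t * f (n + m) x \<le> t * (f n x + f m ((shift_map ^^ n) x) + C)"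
    using almost_add_le[OF nm] assms by (intro mult_left_mono) auto
  then show "t * f (n + m) x \<le> t * f n x + t * f m ((shift_map ^^ n) x) + t * C"
    by (simp add: algebra_simps)
  have "t * (f n x + f m ((shift_map ^^ n) x) - C) \<le> t * f (n + m) x"
    using almost_add_ge[OF nm] assms by (intro mult_left_mono) auto
  then show "t * f n x + t * f m ((shift_map ^^ n) x) - t * C \<le> t * f (n + m) x"
    by (simp add: algebra_simps)
next
  fix n x y assume "n \<ge> (1::nat)" "x \<in> shift_space M" "y \<in> shift_space M" "\<And>i. i < n \<Longrightarrow> x i = y i"
  then have "\<bar>t\<bar> * \<bar>f n x - f n y\<bar> \<le> \<bar>t\<bar> * C" by (intro mult_left_mono variation) auto
  then show "\<bar>t * f n x - t * f n y\<bar> \<le> t * C"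
    unfolding right_diff_distrib[symmetric] abs_mult using assms by simp
next
  fix x assume "x \<in> shift_space M"
  then show "t * f 1 x \<le> t * s (x 0)" using le_letter assms by (intro mult_left_mono) auto
next
  have "(\<lambda>i. exp (s i)) \<longlonglongrightarrow> 0" using summable_exp by (rule summable_LIMSEQ_zero)
  then have "eventually (\<lambda>i. exp (s i) < 1) sequentially" by (rule order_tendstoD) simp
  then have "eventually (\<lambda>i. norm (exp (t * s i)) \<le> exp (s i)) sequentially"
  proof eventually_elim
    case (elim i)
    then have "s i \<le> 0" by simp
    then have "t * s i \<le> 1 * s i" using assms by (intro mult_right_mono_neg)
    then show ?case by simp
  qed
  then show "summable (\<lambda>i. exp (t * s i))" using summable_exp by (rule summable_comparison_test_ev)
qed

lemma eventually_letter_le: "eventually (\<lambda>i. s i \<le> - L) sequentially"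
proof -
  have "(\<lambda>i. exp (s i)) \<longlonglongrightarrow> 0" using summable_exp by (rule summable_LIMSEQ_zero)
  then have "eventually (\<lambda>i. exp (s i) < exp (- L)) sequentially" by (rule order_tendstoD) simp
  then show ?thesis by eventually_elim simp
qed

text \<open>Each \<open>exp (s i)\<close> is at most the whole series, so the logarithm of the
  series bounds every \<open>s i\<close>; the absolute value makes the bound nonnegative.\<close>

definition s_max :: real where "s_max = \<bar>ln (\<Sum>i. exp (s i))\<bar>"

lemma letter_le_s_max: "s i \<le> s_max" and s_max_nonneg: "0 \<le> s_max"
proof -
  have "(\<Sum>j\<in>{i}. exp (s j)) \<le> (\<Sum>i. exp (s i))"
    using summable_exp by (intro sum_le_suminf) auto
  then have le: "exp (s i) \<le> (\<Sum>i. exp (s i))" by simp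
  then have "ln (exp (s i)) \<le> ln (\<Sum>i. exp (s i))" by (intro ln_mono) (auto intro: less_le_trans[OF _ le])
  then show "s i \<le> s_max" unfolding s_max_def by simp
qed (simp add: s_max_def)

lemma le_sum_f1:
  assumes "n \<ge> 1" "x \<in> shift_space M"
  shows "\<bar>f n x - (\<Sum>j<n. f 1 ((shift_map ^^ j) x))\<bar> \<le> real n * C"
  using assms(1)
proof (induction n rule: dec_induct)
  case base
  then show ?case using C_nonneg by simp
next
  case (step n)
  have "\<bar>f (n + 1) x - (f n x + f 1 ((shift_map ^^ n) x))\<bar> \<le> C"
    using almost_add_le[OF step(1), of 1 x] almost_add_ge[OF step(1), of 1 x] assms(2) by simp
  then show ?case using step.IH by (simp add: algebra_simps)
qed

lemma le_sum_letters:
  assumes "n \<ge> 1" "x \<in> shift_space M"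
  shows "f n x \<le> (\<Sum>j<n. s (x j)) + real n * C"
proof -
  have "f 1 ((shift_map ^^ j) x) \<le> s (x j)" for j
    using le_letter[OF shift_map_funpow_shift_space[OF assms(2), of j]] by (simp add: shift_map_funpow)
  then have "(\<Sum>j<n. f 1 ((shift_map ^^ j) x)) \<le> (\<Sum>j<n. s (x j))" by (intro sum_mono)
  then show ?thesis using le_sum_f1[OF assms] by linarith
qed

lemma le_const:
  assumes "n \<ge> 1" "x \<in> shift_space M"
  shows "f n x \<le> real n * (s_max + C)"
proof -
  have "(\<Sum>j<n. s (x j)) \<le> (\<Sum>j<n. s_max)" by (intro sum_mono letter_le_s_max)
  then show ?thesis using le_sum_letters[OF assms] by (simp add: algebra_simps)
qed

end

section \<open>Integrals of the potential and mean values\<close>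

context prob_space
begin

lemma extended_integral_eq:
  fixes g :: "'a \<Rightarrow> real"
  assumes "integrable M g"
  shows "extended_integral M g = ereal (\<integral>x. g x \<partial>M)"
proof -
  have fin: "(\<integral>\<^sup>+x. ennreal (g x) \<partial>M) < \<infinity>" "(\<integral>\<^sup>+x. ennreal (- g x) \<partial>M) < \<infinity>"
    using assms unfolding real_integrable_def by (auto simp: less_top)
  then obtain u v where u: "(\<integral>\<^sup>+x. ennreal (g x) \<partial>M) = ennreal u" "u \<ge> 0"
    and v: "(\<integral>\<^sup>+x. ennreal (- g x) \<partial>M) = ennreal v" "v \<ge> 0"
    by (auto simp: less_top_ennreal)
  then show ?thesis
    unfolding extended_integral_def real_lebesgue_integral_def[OF assms] by (simp add: enn2ereal_ennreal)
qed

lemma extended_integral_eq_minus_infinity: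
  fixes g :: "'a \<Rightarrow> real"
  assumes [measurable]: "g \<in> borel_measurable M" and "\<not> integrable M g" and le: "\<And>x. x \<in> space M \<Longrightarrow> g x \<le> B"
  shows "extended_integral M g = - \<infinity>"
proof -
  have "(\<integral>\<^sup>+x. ennreal (g x) \<partial>M) \<le> (\<integral>\<^sup>+x. ennreal B \<partial>M)"
    using le by (intro nn_integral_mono ennreal_leI)
  also have "\<dots> < \<infinity>" by (simp add: emeasure_space_1)
  finally have fin: "(\<integral>\<^sup>+x. ennreal (g x) \<partial>M) < \<infinity>" .
  then have "(\<integral>\<^sup>+x. ennreal (- g x) \<partial>M) = \<infinity>"
    using assms unfolding real_integrable_def by auto
  moreover obtain u where "(\<integral>\<^sup>+x. ennreal (g x) \<partial>M) = ennreal u" "u \<ge> 0"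
    using fin by (auto simp: less_top_ennreal)
  ultimately show ?thesis unfolding extended_integral_def by (simp add: enn2ereal_ennreal)
qed

end

text \<open>Fekete's lemma for both \<open>a\<close> and \<open>- a\<close> keeps the sequence
  within \<open>C\<close> of a linear one for every \<open>n\<close>, not merely within
  \<open>o(n)\<close>. The semicontinuity arguments depend on this uniform error.\<close>

lemma almost_additive_mean:
  fixes a :: "nat \<Rightarrow> real"
  assumes "\<And>m n. m \<ge> 1 \<Longrightarrow> n \<ge> 1 \<Longrightarrow> \<bar>a (m + n) - (a m + a n)\<bar> \<le> C"
  obtains L where "(\<lambda>n. a n / real n) \<longlonglongrightarrow> L" "\<And>n. n \<ge> 1 \<Longrightarrow> \<bar>a n - L * real n\<bar> \<le> C"
proof -
  have C: "C \<ge> 0" using assms[of 1 1] by simp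
  have bound: "\<bar>a n\<bar> \<le> (\<bar>a 1\<bar> + C) * real n" if "n \<ge> 1" for n
    using that
  proof (induction n rule: dec_induct)
    case (step n)
    then show ?case using assms[of n 1] by (simp add: algebra_simps)
  qed (use C in simp)
  obtain L where L: "(\<lambda>n. a n / real n) \<longlonglongrightarrow> L" "\<And>n. n \<ge> 1 \<Longrightarrow> L * real n \<le> a n + C"
  proof (rule fekete_limit[of 1 a C "\<bar>a 1\<bar> + C"])
    fix m n :: nat assume "m \<ge> 1" "n \<ge> 1"
    then show "a (m + n) \<le> a m + a n + C" using assms[of m n] by simp
  next
    fix n :: nat assume "n \<ge> 1"
    then show "- (\<bar>a 1\<bar> + C) * real n \<le> a n" using bound[of n] by (simp add: algebra_simps)
  qed auto
  obtain L' where L': "(\<lambda>n. - a n / real n) \<longlonglongrightarrow> L'" "\<And>n. n \<ge> 1 \<Longrightarrow> L' * real n \<le> - a n + C"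
  proof (rule fekete_limit[of 1 "\<lambda>n. - a n" C "\<bar>a 1\<bar> + C"])
    fix m n :: nat assume "m \<ge> 1" "n \<ge> 1"
    then show "- a (m + n) \<le> - a m + - a n + C" using assms[of m n] by simp
  next
    fix n :: nat assume "n \<ge> 1"
    then show "- (\<bar>a 1\<bar> + C) * real n \<le> - a n" using bound[of n] by (simp add: algebra_simps)
  qed auto
  have "L' = - L"
    using LIMSEQ_unique[OF L'(1)] tendsto_minus[OF L(1)] by simp
  show ?thesis
  proof (rule that[OF L(1)])
    fix n :: nat assume "n \<ge> 1"
    then show "\<bar>a n - L * real n\<bar> \<le> C" using L(2)[of n] L'(2)[of n] \<open>L' = - L\<close> by simp
  qed
qed

locale potential_measure = markov_potential M f C s + shift_measure \<nu> M
  for M f C s \<nu>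
begin

lemma f_measurable [measurable]: "n \<ge> 1 \<Longrightarrow> f n \<in> borel_measurable \<nu>"
  using continuous by (rule borel_measurable_continuous)

lemma integral_funpow:
  fixes g :: "(nat \<Rightarrow> nat) \<Rightarrow> real"
  assumes "g \<in> borel_measurable \<nu>"
  shows "(\<integral>x. g ((shift_map ^^ n) x) \<partial>\<nu>) = (\<integral>x. g x \<partial>\<nu>)"
  using integral_distr[OF funpow_measurable assms, of n] by (simp add: distr_funpow)

lemma integrable_funpow:
  fixes g :: "(nat \<Rightarrow> nat) \<Rightarrow> real"
  assumes "integrable \<nu> g"
  shows "integrable \<nu> (\<lambda>x. g ((shift_map ^^ n) x))"
  using integrable_distr[OF funpow_measurable, of n g] assms by (simp add: distr_funpow)

lemma integrable_f:
  assumes "integrable \<nu> (f 1)" "n \<ge> 1"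
  shows "integrable \<nu> (f n)"
proof -
  have int: "integrable \<nu> (\<lambda>x. (\<Sum>j<n. \<bar>f 1 ((shift_map ^^ j) x)\<bar>) + real n * C)"
    using integrable_funpow[OF assms(1)] by (intro Bochner_Integration.integrable_add Bochner_Integration.integrable_sum integrable_abs) auto
  show ?thesis
  proof (rule Bochner_Integration.integrable_bound[OF int])
    have "norm (f n x) \<le> norm ((\<Sum>j<n. \<bar>f 1 ((shift_map ^^ j) x)\<bar>) + real n * C)" if "x \<in> space \<nu>" for x
    proof -
      have "\<bar>f n x\<bar> \<le> \<bar>\<Sum>j<n. f 1 ((shift_map ^^ j) x)\<bar> + real n * C"
        using le_sum_f1[OF assms(2), of x] that by simp
      also have "\<bar>\<Sum>j<n. f 1 ((shift_map ^^ j) x)\<bar> \<le> (\<Sum>j<n. \<bar>f 1 ((shift_map ^^ j) x)\<bar>)" by (rule sum_abs)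
      finally show ?thesis by simp
    qed
    then show "AE x in \<nu>. norm (f n x) \<le> norm ((\<Sum>j<n. \<bar>f 1 ((shift_map ^^ j) x)\<bar>) + real n * C)" by (rule AE_I2)
  qed (use f_measurable assms in auto)
qed

lemma integral_f_almost_additive:
  assumes f1: "integrable \<nu> (f 1)" and nm: "m \<ge> 1" "n \<ge> 1"
  shows "\<bar>(\<integral>x. f (m + n) x \<partial>\<nu>) - ((\<integral>x. f m x \<partial>\<nu>) + (\<integral>x. f n x \<partial>\<nu>))\<bar> \<le> C"
proof -
  have int: "integrable \<nu> (f m)" "integrable \<nu> (f n)" "integrable \<nu> (f (m + n))"
    "integrable \<nu> (\<lambda>x. f n ((shift_map ^^ m) x))"
    using integrable_f[OF f1] nm integrable_funpow by auto
  have shift: "(\<integral>x. f n ((shift_map ^^ m) x) \<partial>\<nu>) = (\<integral>x. f n x \<partial>\<nu>)"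
    using integral_funpow f_measurable nm by simp
  have "(\<integral>x. f (m + n) x \<partial>\<nu>) \<le> (\<integral>x. f m x + f n ((shift_map ^^ m) x) + C \<partial>\<nu>)"
    using int almost_add_le nm by (intro integral_mono) auto
  moreover have "(\<integral>x. f m x + f n ((shift_map ^^ m) x) - C \<partial>\<nu>) \<le> (\<integral>x. f (m + n) x \<partial>\<nu>)"
    using int almost_add_ge nm by (intro integral_mono) auto
  ultimately show ?thesis using int shift by (simp add: prob_space)
qed

lemma mean_value_integrable:
  assumes "integrable \<nu> (f 1)"
  obtains L where "mean_value f \<nu> = ereal L" "(\<lambda>n. (\<integral>x. f n x \<partial>\<nu>) / real n) \<longlonglongrightarrow> L"
    "\<And>n. n \<ge> 1 \<Longrightarrow> \<bar>(\<integral>x. f n x \<partial>\<nu>) - L * real n\<bar> \<le> C"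
proof -
  obtain L where L: "(\<lambda>n. (\<integral>x. f n x \<partial>\<nu>) / real n) \<longlonglongrightarrow> L"
    "\<And>n. n \<ge> 1 \<Longrightarrow> \<bar>(\<integral>x. f n x \<partial>\<nu>) - L * real n\<bar> \<le> C"
    using almost_additive_mean[of "\<lambda>n. \<integral>x. f n x \<partial>\<nu>" C] integral_f_almost_additive[OF assms] by blast
  have "eventually (\<lambda>n. ereal ((\<integral>x. f n x \<partial>\<nu>) / real n) = extended_integral \<nu> (f n) / ereal (real n)) sequentially"
    using eventually_ge_at_top[of 1]
    by eventually_elim (simp add: extended_integral_eq integrable_f[OF assms])
  then have "(\<lambda>n. extended_integral \<nu> (f n) / ereal (real n)) \<longlonglongrightarrow> ereal L"
    using L(1) by (subst (asm) lim_ereal[symmetric]) (rule Lim_transform_eventually)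
  then have "mean_value f \<nu> = ereal L" unfolding mean_value_def by (rule limI)
  then show ?thesis using L that by blast
qed

text \<open>Since \<open>f n\<close> is at most \<open>f 1\<close> plus a constant and
  \<open>f 1\<close> is bounded above, integrability of any \<open>f n\<close> would imply that of
  \<open>f 1\<close>. Hence all the extended integrals are -\<infinity>.\<close>

lemma mean_value_not_integrable:
  assumes "\<not> integrable \<nu> (f 1)"
  shows "mean_value f \<nu> = - \<infinity>"
proof -
  have not_int: "\<not> integrable \<nu> (f n)" if "n \<ge> 1" for n
  proof (cases "n = 1")
    case False
    then have n: "n - 1 \<ge> 1" "n = 1 + (n - 1)" using that by auto
    define K where "K = real (n - 1) * (s_max + C) + C"
    have ge: "f n x - K \<le> f 1 x" if "x \<in> shift_space M" for x
    proof -
      have "f (1 + (n - 1)) x \<le> f 1 x + f (n - 1) ((shift_map ^^ 1) x) + C"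
        using that n by (intro almost_add_le) auto
      moreover have "f (n - 1) ((shift_map ^^ 1) x) \<le> real (n - 1) * (s_max + C)"
        using n(1) shift_map_funpow_shift_space[OF that, of 1] by (intro le_const)
      ultimately show ?thesis using n(2) by (simp add: K_def)
    qed
    have "integrable \<nu> (f 1)" if int: "integrable \<nu> (f n)"
    proof (rule Bochner_Integration.integrable_bound)
      show "integrable \<nu> (\<lambda>x. \<bar>f n x - K\<bar> + \<bar>s_max + C\<bar>)" using int by simp
      show "f 1 \<in> borel_measurable \<nu>" by (rule f_measurable) simp
      have "norm (f 1 x) \<le> norm (\<bar>f n x - K\<bar> + \<bar>s_max + C\<bar>)" if "x \<in> space \<nu>" for x
        using ge[of x] le_const[of 1 x] that by simp
      then show "AE x in \<nu>. norm (f 1 x) \<le> norm (\<bar>f n x - K\<bar> + \<bar>s_max + C\<bar>)" by (rule AE_I2)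
    qed
    then show ?thesis using assms by blast
  qed (use assms in simp)
  have "extended_integral \<nu> (f n) / ereal (real n) = - \<infinity>" if "n \<ge> 1" for n
    using extended_integral_eq_minus_infinity[OF f_measurable[OF that] not_int[OF that] le_const[OF that]] that
    by simp
  then have "eventually (\<lambda>n. extended_integral \<nu> (f n) / ereal (real n) = - \<infinity>) sequentially"
    unfolding eventually_sequentially by blast
  then have "(\<lambda>n. extended_integral \<nu> (f n) / ereal (real n)) \<longlonglongrightarrow> - \<infinity>" by (rule tendsto_eventually)
  then show ?thesis unfolding mean_value_def by (rule limI)
qed

text \<open>From \<open>f 1 x \<le> s (x 0) \<le> s_max\<close> the letter bound is large in
  absolute value only where \<open>f 1\<close> is.\<close>

lemma integrable_letter:
  assumes "integrable \<nu> (f 1)"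
  shows "integrable \<nu> (\<lambda>x. if N \<le> x 0 then - s (x 0) else 0)"
proof (rule Bochner_Integration.integrable_bound)
  show "integrable \<nu> (\<lambda>x. \<bar>f 1 x\<bar> + s_max)" using assms by simp
  show "(\<lambda>x. if N \<le> x 0 then - s (x 0) else 0) \<in> borel_measurable \<nu>"
    using coordinate_measurable[of "\<lambda>v. if N \<le> v then - s v else 0" 0] .
  have "norm (if N \<le> x 0 then - s (x 0) else 0) \<le> norm (\<bar>f 1 x\<bar> + s_max)" if "x \<in> space \<nu>" for x
  proof -
    have "\<bar>s (x 0)\<bar> \<le> \<bar>f 1 x\<bar> + s_max"
      using le_letter[of x] letter_le_s_max[of "x 0"] s_max_nonneg that by simp
    then show ?thesis using s_max_nonneg by simp
  qed
  then show "AE x in \<nu>. norm (if N \<le> x 0 then - s (x 0) else 0) \<le> norm (\<bar>f 1 x\<bar> + s_max)" by (rule AE_I2)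
qed

lemma ks_entropy_le_letter_tail:
  assumes "integrable \<nu> (f 1)" "\<And>i. i \<ge> N \<Longrightarrow> s i \<le> 0"
  shows "ks_entropy \<nu> shift_map \<le> ereal (entropy_rate \<nu> shift_map (letter N)
    + (\<integral>x. (if N \<le> x 0 then - s (x 0) else 0) \<partial>\<nu>) + (\<Sum>i. exp (s (i + N))))"
  using ks_entropy_le_tail[of N "\<lambda>i. - s i"] integrable_letter[OF assms(1)] assms(2) summable_exp by simp

lemma ks_entropy_real:
  assumes "integrable \<nu> (f 1)"
  obtains h where "ks_entropy \<nu> shift_map = ereal h" "h \<ge> 0"
proof -
  obtain N where "\<And>i. i \<ge> N \<Longrightarrow> s i \<le> 0"
    using eventually_letter_le[of 0] by (auto simp: eventually_sequentially)
  then have "ks_entropy \<nu> shift_map < \<infinity>" using ks_entropy_le_letter_tail[OF assms, of N] by (auto simp: less_top)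
  moreover have "0 \<le> ks_entropy \<nu> shift_map"
    using entropy_rate_le_ks_entropy[OF simple_function_letter, of 0] entropy_rate_nonneg[OF simple_function_letter, of 0]
    by (metis ereal_less_eq(5) order_trans)
  ultimately show ?thesis using that by (cases "ks_entropy \<nu> shift_map") auto
qed

end

section \<open>Periodic points and the Gurevich pressure\<close>

text \<open>Here \<open>n\<close> counts edges, so the path visits \<open>n + 1\<close> letters.
  Paths are total functions whose later values are ignored, which makes gluing and periodic
  extension plain index arithmetic.\<close>

definition word_path :: "(nat \<Rightarrow> nat \<Rightarrow> nat) \<Rightarrow> nat \<Rightarrow> (nat \<Rightarrow> nat) \<Rightarrow> bool" where
  "word_path M n p \<longleftrightarrow> (\<forall>i<n. M (p i) (p (Suc i)) = 1)"

definition glue :: "nat \<Rightarrow> (nat \<Rightarrow> 'a) \<Rightarrow> (nat \<Rightarrow> 'a) \<Rightarrow> nat \<Rightarrow> 'a" where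
  "glue n p q i = (if i < n then p i else q (i - n))"

definition periodic :: "nat \<Rightarrow> (nat \<Rightarrow> 'a) \<Rightarrow> nat \<Rightarrow> 'a" where
  "periodic n p i = p (i mod n)"

lemma path_glue:
  assumes "word_path M n p" "word_path M m q" "p n = q 0"
  shows "word_path M (n + m) (glue n p q)"
  unfolding word_path_def
proof (intro allI impI)
  fix i assume i: "i < n + m"
  consider "Suc i < n" | "Suc i = n" | "n \<le> i" by linarith
  then show "M (glue n p q i) (glue n p q (Suc i)) = 1"
  proof cases
    case 2
    then have "M (p i) (p n) = 1" using assms(1) by (auto simp: word_path_def)
    then show ?thesis using 2 assms(3) by (simp add: glue_def)
  qed (use assms i in \<open>auto simp: word_path_def glue_def Suc_diff_le\<close>)
qed

lemma path_shift_space: "x \<in> shift_space M \<Longrightarrow> word_path M n x"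
  by (simp add: word_path_def shift_space_def)

lemma path_admissible:
  assumes "admissible M w" "length w = Suc n"
  shows "word_path M n (\<lambda>i. w ! i)"
  using assms by (auto simp: word_path_def admissible_def)

lemma periodic_shift_space:
  assumes "word_path M n p" "p n = p 0" "n \<ge> 1"
  shows "periodic n p \<in> shift_space M"
  unfolding shift_space_def
proof (intro CollectI allI)
  fix i
  have "i mod n < n" using assms(3) by simp
  then have "M (p (i mod n)) (p (Suc (i mod n))) = 1" using assms(1) by (auto simp: word_path_def)
  then show "M (periodic n p i) (periodic n p (Suc i)) = 1"
    using assms(2) by (cases "Suc (i mod n) = n") (simp_all add: periodic_def mod_Suc)
qed

lemma shift_map_periodic: "(shift_map ^^ n) (periodic n p) = periodic n p"
  by (simp add: fun_eq_iff shift_map_funpow periodic_def)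

lemma periodic_less [simp]: "i < n \<Longrightarrow> periodic n p i = p i"
  by (simp add: periodic_def)

lemma shift_map_fixed_mod:
  assumes "(shift_map ^^ n) x = x" "n \<ge> 1"
  shows "x i = x (i mod n)"
proof (induction i rule: less_induct)
  case (less i)
  show ?case
  proof (cases "i < n")
    case False
    have "x i = (shift_map ^^ n) x (i - n)" using False by (simp add: shift_map_funpow)
    also have "\<dots> = x (i - n)" using assms(1) by simp
    also have "\<dots> = x ((i - n) mod n)" using False assms(2) by (intro less) auto
    also have "(i - n) mod n = i mod n" using False by (simp add: le_mod_geq)
    finally show ?thesis .
  qed simp
qed

lemma shift_map_fixed_eqI:
  assumes "(shift_map ^^ n) x = x" "(shift_map ^^ n) y = y" "n \<ge> 1" "\<And>i. i < n \<Longrightarrow> x i = y i"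
  shows "x = y"
proof
  fix i
  have "x (i mod n) = y (i mod n)" using assms(3,4) by simp
  then show "x i = y i" using shift_map_fixed_mod[OF assms(1,3)] shift_map_fixed_mod[OF assms(2,3)] by metis
qed

locale mixing_potential = markov_potential +
  fixes a :: nat
  assumes mixing: "topologically_mixing M"
begin

definition Per :: "nat \<Rightarrow> (nat \<Rightarrow> nat) set" where
  "Per n = {x \<in> shift_space M. (shift_map ^^ n) x = x \<and> x 0 = a}"

text \<open>The real-valued partition function, on which logarithms can be used; for
  \<open>n \<ge> 1\<close> it agrees with \<open>periodic_sum\<close>.\<close>

definition Z :: "nat \<Rightarrow> real" where
  "Z n = infsum (\<lambda>x. exp (f n x)) (Per n)"

text \<open>The cost of one more period step: the total weight of the letters times
  \<open>exp C\<close> for one error of almost additivity.\<close>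

definition Z_base :: real where "Z_base = exp C * (\<Sum>i. exp (s i))"

lemma Z_base_pos: "Z_base > 0"
proof -
  have "(\<Sum>j\<in>{0}. exp (s j)) \<le> (\<Sum>i. exp (s i))"
    using summable_exp by (intro sum_le_suminf) auto
  then show ?thesis unfolding Z_base_def by (intro mult_pos_pos) (auto intro: less_le_trans[of _ "exp (s 0)"])
qed

text \<open>A point of period \<open>n\<close> is determined by its first \<open>n\<close> letters,
  and its weight is at most a product over them. Summing over all words factorises.\<close>

lemma sum_Per_le:
  assumes "n \<ge> 1" "finite F" "F \<subseteq> Per n"
  shows "(\<Sum>x\<in>F. exp (f n x)) \<le> Z_base ^ n"
proof -
  \<comment> \<open>Finitely many periodic points use finitely many letters, so the product of sums
    is expanded over a finite alphabet.\<close>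
  obtain R where R: "\<And>x j. x \<in> F \<Longrightarrow> j < n \<Longrightarrow> x j < R"
  proof -
    have "finite ((\<lambda>(x, j). x j) ` (F \<times> {..<n}))" using assms(2) by simp
    then obtain R where "\<forall>v\<in>(\<lambda>(x, j). x j) ` (F \<times> {..<n}). v < R"
      using finite_nat_set_iff_bounded by blast
    then show ?thesis using that[of R] by auto
  qed
  have inj: "inj_on (\<lambda>x. restrict x {..<n}) F"
  proof (rule inj_onI)
    fix x y assume xy: "x \<in> F" "y \<in> F" "restrict x {..<n} = restrict y {..<n}"
    then have "x i = y i" if "i < n" for i using that by (metis lessThan_iff restrict_apply)
    moreover have "x \<in> Per n" "y \<in> Per n" using xy(1,2) assms(3) by auto
    ultimately show "x = y"
      using shift_map_fixed_eqI[of n x y] assms(1) by (simp add: Per_def)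
  qed
  have "(\<Sum>x\<in>F. exp (f n x)) \<le> (\<Sum>x\<in>F. \<Prod>j<n. exp (s (x j) + C))"
  proof (rule sum_mono)
    fix x assume "x \<in> F"
    then have "f n x \<le> (\<Sum>j<n. s (x j)) + real n * C"
      using assms by (intro le_sum_letters) (auto simp: Per_def)
    then show "exp (f n x) \<le> (\<Prod>j<n. exp (s (x j) + C))"
      by (simp add: exp_sum[symmetric] sum.distrib)
  qed
  also have "\<dots> = (\<Sum>g\<in>(\<lambda>x. restrict x {..<n}) ` F. \<Prod>j<n. exp (s (g j) + C))"
    by (subst sum.reindex[OF inj]) (auto intro!: sum.cong prod.cong)
  also have "\<dots> \<le> (\<Sum>g\<in>PiE {..<n} (\<lambda>_. {..<R}). \<Prod>j<n. exp (s (g j) + C))"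
    using R by (intro sum_mono2 finite_PiE) (auto intro!: prod_nonneg split: if_splits)
  also have "\<dots> = (\<Prod>j<n. \<Sum>i<R. exp (s i + C))"
    by (subst prod_sum_PiE) auto
  also have "\<dots> = (\<Sum>i<R. exp (s i + C)) ^ n" by simp
  also have "\<dots> \<le> Z_base ^ n"
  proof (rule power_mono)
    have "(\<Sum>i<R. exp (s i + C)) = exp C * (\<Sum>i<R. exp (s i))"
      by (simp add: exp_add sum_distrib_left mult.commute)
    also have "\<dots> \<le> Z_base" unfolding Z_base_def
      using summable_exp by (intro mult_left_mono sum_le_suminf) auto
    finally show "(\<Sum>i<R. exp (s i + C)) \<le> Z_base" .
  qed (simp add: sum_nonneg)
  finally show ?thesis .
qed

lemma Per_summable:
  assumes "n \<ge> 1"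
  shows "(\<lambda>x. exp (f n x)) summable_on Per n"
  using sum_Per_le[OF assms]
  by (intro nonneg_bdd_above_summable_on) (auto intro!: bdd_aboveI[of _ "Z_base ^ n"])

lemma sum_le_Z: "n \<ge> 1 \<Longrightarrow> finite F \<Longrightarrow> F \<subseteq> Per n \<Longrightarrow> (\<Sum>x\<in>F. exp (f n x)) \<le> Z n"
  unfolding Z_def by (intro finite_sum_le_infsum Per_summable) auto

lemma Z_leI: "n \<ge> 1 \<Longrightarrow> (\<And>F. finite F \<Longrightarrow> F \<subseteq> Per n \<Longrightarrow> (\<Sum>x\<in>F. exp (f n x)) \<le> c) \<Longrightarrow> Z n \<le> c"
  unfolding Z_def by (intro infsum_le_finite_sums Per_summable)

lemma Z_nonneg: "Z n \<ge> 0"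
  unfolding Z_def by (intro infsum_nonneg) simp

lemma Z_le_power: "n \<ge> 1 \<Longrightarrow> Z n \<le> Z_base ^ n"
  by (intro Z_leI sum_Per_le)

lemma periodic_sum_eq:
  assumes "n \<ge> 1"
  shows "periodic_sum M a f n = ennreal (Z n)"
proof -
  have "periodic_sum M a f n = infsum (\<lambda>x. ennreal (exp (f n x))) (Per n)"
    unfolding periodic_sum_def
    by (intro infsum_cong_neutral) (auto simp: Per_def cylinder_def indicator_def)
  also have "\<dots> = (SUP F\<in>{F. finite F \<and> F \<subseteq> Per n}. (\<Sum>x\<in>F. ennreal (exp (f n x))))"
    by (rule nonneg_infsum_complete) simp
  also have "\<dots> = (SUP F\<in>{F. finite F \<and> F \<subseteq> Per n}. ennreal (\<Sum>x\<in>F. exp (f n x)))"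
    by (intro SUP_cong refl) simp
  also have "\<dots> = ennreal (Z n)"
    unfolding Z_def using Per_summable[OF assms]
    by (intro infsum_nonneg_is_SUPREMUM_ennreal[symmetric]) auto
  finally show ?thesis .
qed

text \<open>Both orbits start at \<open>a\<close>, so their periods can be concatenated. One
  \<open>C\<close> pays for splitting \<open>f (n + m)\<close>, and bounded variation pays two more
  for replacing the glued point by \<open>x\<close> and by \<open>y\<close>.\<close>

lemma Per_glue:
  assumes n: "n \<ge> 1" "m \<ge> 1" and x: "x \<in> Per n" and y: "y \<in> Per m"
  defines "z \<equiv> periodic (n + m) (glue n x y)"
  shows "z \<in> Per (n + m)" "\<And>i. i < n \<Longrightarrow> z i = x i" "\<And>i. i < m \<Longrightarrow> z (n + i) = y i"
    "f n x + f m y \<le> f (n + m) z + 3 * C"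
proof -
  have x': "x \<in> shift_space M" "x n = a" "x 0 = a" "(shift_map ^^ n) x = x"
    using x shift_map_funpow[of n x 0] by (auto simp: Per_def)
  have y': "y \<in> shift_space M" "y m = a" "y 0 = a" "(shift_map ^^ m) y = y"
    using y shift_map_funpow[of m y 0] by (auto simp: Per_def)
  have z: "z \<in> shift_space M" unfolding z_def
    using x' y' n by (intro periodic_shift_space path_glue path_shift_space) (auto simp: glue_def)
  show zx: "\<And>i. i < n \<Longrightarrow> z i = x i" by (simp add: z_def glue_def)
  show zy: "\<And>i. i < m \<Longrightarrow> z (n + i) = y i" by (simp add: z_def glue_def)
  show "z \<in> Per (n + m)"
    unfolding Per_def using z zx[of 0] n x' by (simp add: z_def shift_map_periodic)
  have "f n z + f m ((shift_map ^^ n) z) - C \<le> f (n + m) z"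
    using n z by (intro almost_add_ge)
  moreover have "\<bar>f n z - f n x\<bar> \<le> C" using n z x' zx by (intro variation)
  moreover have "\<bar>f m ((shift_map ^^ n) z) - f m y\<bar> \<le> C"
    using n z y' zy by (intro variation shift_map_funpow_shift_space) (auto simp: shift_map_funpow)
  ultimately show "f n x + f m y \<le> f (n + m) z + 3 * C" by linarith
qed

text \<open>Gluing is injective on pairs of periodic points. The estimate is made for finite subsums
  and extended to the infinite sums one factor at a time.\<close>

lemma Z_supermultiplicative:
  assumes n: "n \<ge> 1" "m \<ge> 1"
  shows "Z n * Z m \<le> exp (3 * C) * Z (n + m)"
proof -
  define K where "K = exp (3 * C) * Z (n + m)"
  have fin: "(\<Sum>x\<in>F. exp (f n x)) * (\<Sum>y\<in>G. exp (f m y)) \<le> K"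
    if F: "finite F" "F \<subseteq> Per n" and G: "finite G" "G \<subseteq> Per m" for F G
  proof -
    define z where "z = (\<lambda>(x :: nat \<Rightarrow> nat, y). periodic (n + m) (glue n x y))"
    have inj: "inj_on z (F \<times> G)"
    proof (rule inj_onI, clarify)
      fix x y x' y' assume xy: "x \<in> F" "y \<in> G" "x' \<in> F" "y' \<in> G" and eq: "z (x, y) = z (x', y')"
      have P: "x \<in> Per n" "x' \<in> Per n" "y \<in> Per m" "y' \<in> Per m" using xy F G by auto
      have "x i = x' i" if "i < n" for i
        using Per_glue(2)[OF n P(1,3) that] Per_glue(2)[OF n P(2,4) that] eq by (simp add: z_def)
      moreover have "y i = y' i" if "i < m" for i
        using Per_glue(3)[OF n P(1,3) that] Per_glue(3)[OF n P(2,4) that] eq by (simp add: z_def)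
      ultimately show "x = x' \<and> y = y'"
        using P n shift_map_fixed_eqI[of n x x'] shift_map_fixed_eqI[of m y y'] by (auto simp: Per_def)
    qed
    have "(\<Sum>x\<in>F. exp (f n x)) * (\<Sum>y\<in>G. exp (f m y)) = (\<Sum>(x, y)\<in>F \<times> G. exp (f n x + f m y))"
      by (simp add: sum_product sum.cartesian_product exp_add)
    also have "\<dots> \<le> (\<Sum>p\<in>F \<times> G. exp (3 * C) * exp (f (n + m) (z p)))"
    proof (rule sum_mono, clarify)
      fix x y assume "x \<in> F" "y \<in> G"
      then have "f n x + f m y \<le> f (n + m) (z (x, y)) + 3 * C"
        unfolding z_def using Per_glue(4)[OF n] F G by auto
      then show "exp (f n x + f m y) \<le> exp (3 * C) * exp (f (n + m) (z (x, y)))"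
        by (simp add: exp_add[symmetric] add.commute)
    qed
    also have "\<dots> = exp (3 * C) * (\<Sum>p\<in>z ` (F \<times> G). exp (f (n + m) p))"
      by (simp add: sum.reindex[OF inj] sum_distrib_left)
    also have "\<dots> \<le> K" unfolding K_def
    proof (rule mult_left_mono)
      show "(\<Sum>p\<in>z ` (F \<times> G). exp (f (n + m) p)) \<le> Z (n + m)"
        using F G n Per_glue(1)[OF n] by (intro sum_le_Z) (auto simp: z_def)
    qed simp
    finally show ?thesis .
  qed
  have K: "K \<ge> 0" using Z_nonneg by (simp add: K_def)
  have 1: "Z n * (\<Sum>y\<in>G. exp (f m y)) \<le> K" if G: "finite G" "G \<subseteq> Per m" for G
  proof (cases "(\<Sum>y\<in>G. exp (f m y)) = 0")
    case False
    then have pos: "(\<Sum>y\<in>G. exp (f m y)) > 0" by (simp add: less_le sum_nonneg)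
    have "Z n \<le> K / (\<Sum>y\<in>G. exp (f m y))"
      using fin[OF _ _ G] pos n by (intro Z_leI) (auto simp: pos_le_divide_eq)
    then show ?thesis using pos by (simp add: pos_le_divide_eq)
  qed (use K in simp)
  show ?thesis
  proof (cases "Z n = 0")
    case False
    then have pos: "Z n > 0" using Z_nonneg[of n] by simp
    have "Z m \<le> K / Z n"
      using 1 pos n by (intro Z_leI) (auto simp: pos_le_divide_eq mult.commute)
    then show ?thesis using pos by (simp add: pos_le_divide_eq mult.commute K_def)
  qed (use K in \<open>simp add: K_def\<close>)
qed

lemma mixing_path:
  obtains N where "\<And>n. n \<ge> N \<Longrightarrow> \<exists>p. word_path M n p \<and> p 0 = b \<and> p n = c"
proof -
  obtain N where N: "\<And>n. n \<ge> N \<Longrightarrow> \<exists>w. admissible M w \<and> length w = n \<and> hd w = b \<and> last w = c"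
    using mixing unfolding topologically_mixing_def by metis
  show ?thesis
  proof (rule that[of N])
    fix n assume "n \<ge> N"
    then obtain w where w: "admissible M w" "length w = Suc n" "hd w = b" "last w = c"
      using N[of "Suc n"] by auto
    then have "w \<noteq> []" by auto
    then have "w ! 0 = b" "w ! n = c" using w by (auto simp: hd_conv_nth last_conv_nth)
    then show "\<exists>p. word_path M n p \<and> p 0 = b \<and> p n = c"
      using path_admissible[OF w(1,2)] by (intro exI[of _ "\<lambda>i. w ! i"]) simp
  qed
qed

text \<open>Mixing provides a closed path through \<open>a\<close> of every sufficiently large
  length.\<close>

lemma Z_pos:
  obtains N where "N \<ge> 1" "\<And>n. n \<ge> N \<Longrightarrow> Z n > 0"
proof -
  obtain N where N: "\<And>n. n \<ge> N \<Longrightarrow> \<exists>p. word_path M n p \<and> p 0 = a \<and> p n = a"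
    using mixing_path by blast
  show ?thesis
  proof (rule that[of "max N 1"])
    fix n assume n: "n \<ge> max N 1"
    then obtain p where p: "word_path M n p" "p 0 = a" "p n = a" using N by auto
    have "periodic n p \<in> Per n"
      using periodic_shift_space[OF p(1)] p n by (auto simp: Per_def shift_map_periodic)
    then have "(\<Sum>x\<in>{periodic n p}. exp (f n x)) \<le> Z n" using n by (intro sum_le_Z) auto
    then show "Z n > 0" by (auto intro: less_le_trans[of _ "exp (f n (periodic n p))"])
  qed simp
qed

text \<open>\<open>- ln (Z n)\<close> is subadditive up to \<open>3 * C\<close> once
  \<open>Z\<close> is positive, and \<open>Z_base\<close> bounds it below. Fekete's lemma gives the
  limit together with the upper bound for each single \<open>Z n\<close>, which the counting of
  blocks uses.\<close>

lemma gurevich_pressure_eq: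
  obtains P N where "gurevich_pressure M a f = ereal P" "N \<ge> 1" "\<And>n. n \<ge> N \<Longrightarrow> Z n \<le> exp (real n * P + 3 * C)"
proof -
  obtain N where N: "N \<ge> 1" "\<And>n. n \<ge> N \<Longrightarrow> Z n > 0" by (rule Z_pos) blast
  obtain L where L: "(\<lambda>n. - ln (Z n) / real n) \<longlonglongrightarrow> L" "\<And>n. n \<ge> N \<Longrightarrow> L * real n \<le> - ln (Z n) + 3 * C"
  proof (rule fekete_limit[of N "\<lambda>n. - ln (Z n)" "3 * C" "ln Z_base"])
    fix m n assume mn: "m \<ge> N" "n \<ge> N"
    have pos: "Z m > 0" "Z n > 0" "Z (m + n) > 0" using N mn by auto
    have "Z m * Z n \<le> exp (3 * C) * Z (m + n)" using mn N by (intro Z_supermultiplicative) auto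
    then have "ln (Z m * Z n) \<le> ln (exp (3 * C) * Z (m + n))" using pos by (intro ln_mono) auto
    then show "- ln (Z (m + n)) \<le> - ln (Z m) + - ln (Z n) + 3 * C"
      using pos by (simp add: ln_mult)
  next
    fix n assume n: "n \<ge> N"
    then have "ln (Z n) \<le> ln (Z_base ^ n)" using N Z_le_power[of n] by (intro ln_mono) auto
    then show "- ln Z_base * real n \<le> - ln (Z n)" using Z_base_pos by (simp add: ln_realpow mult.commute)
  qed (use N in auto)
  have "(\<lambda>n. ln (Z n) / real n) \<longlonglongrightarrow> - L" using tendsto_minus[OF L(1)] by simp
  moreover have "eventually (\<lambda>n. ereal (ln (Z n) / real n) = extended_ln (periodic_sum M a f n) / ereal (real n)) sequentially"
    using eventually_ge_at_top[of N]
  proof eventually_elim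
    case (elim n)
    then have "Z n > 0" "n \<ge> 1" using N by auto
    then show ?case by (simp add: periodic_sum_eq extended_ln_def)
  qed
  ultimately have "(\<lambda>n. extended_ln (periodic_sum M a f n) / ereal (real n)) \<longlonglongrightarrow> ereal (- L)"
    by (subst (asm) lim_ereal[symmetric]) (rule Lim_transform_eventually)
  then have "gurevich_pressure M a f = ereal (- L)" unfolding gurevich_pressure_def by (rule limI)
  then show ?thesis
  proof (rule that[OF _ N(1)])
    fix n assume n: "n \<ge> N"
    then have "ln (Z n) \<le> real n * - L + 3 * C" using L(2)[of n] by (simp add: mult.commute)
    then show "Z n \<le> exp (real n * - L + 3 * C)" using N(2)[OF n] by (metis exp_le_cancel_iff exp_ln)
  qed
qed

end

section \<open>The variational inequality\<close>

context mixing_potential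
begin

lemma word_lower_bound:
  assumes "n \<ge> 1"
  obtains d where "\<And>x. x \<in> shift_space M \<Longrightarrow> (\<And>j. j < n \<Longrightarrow> x j = p j) \<Longrightarrow> d \<le> f n x"
proof (cases "\<exists>x\<in>shift_space M. \<forall>j<n. x j = p j")
  case True
  then obtain x0 where x0: "x0 \<in> shift_space M" "\<And>j. j < n \<Longrightarrow> x0 j = p j" by blast
  show ?thesis
  proof (rule that[of "f n x0 - C"])
    fix x assume "x \<in> shift_space M" "\<And>j. j < n \<Longrightarrow> x j = p j"
    then have "\<bar>f n x0 - f n x\<bar> \<le> C" using x0 assms by (intro variation) auto
    then show "f n x0 - C \<le> f n x" by linarith
  qed
qed (use that in blast)

text \<open>
  Words between letters below \<open>N\<close> are closed up to periodic orbits through \<open>a\<close> at a bounded cost: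
  only finitely many connecting paths are needed.
\<close>

lemma closing:
  obtains k D where "k \<ge> 2" "k \<ge> N1"
    "\<And>m y. m \<ge> 1 \<Longrightarrow> y \<in> shift_space M \<Longrightarrow> y 0 < N \<Longrightarrow> y (m - 1) < N \<Longrightarrow>
      \<exists>z\<in>Per (k + (m + (k - 1))). (\<forall>j<m. z (k + j) = y j) \<and> f m y \<le> f (k + (m + (k - 1))) z + D"
proof -
  have "\<exists>K. \<forall>n\<ge>K. (\<exists>p. word_path M n p \<and> p 0 = a \<and> p n = b) \<and> (\<exists>p. word_path M n p \<and> p 0 = b \<and> p n = a)" for b
  proof -
    obtain K1 where K1: "\<And>n. n \<ge> K1 \<Longrightarrow> \<exists>p. word_path M n p \<and> p 0 = a \<and> p n = b" by (rule mixing_path) blast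
    obtain K2 where K2: "\<And>n. n \<ge> K2 \<Longrightarrow> \<exists>p. word_path M n p \<and> p 0 = b \<and> p n = a" by (rule mixing_path) blast
    show ?thesis using K1 K2 by (intro exI[of _ "max K1 K2"]) auto
  qed
  then obtain K where K: "\<And>b n. n \<ge> K b \<Longrightarrow> \<exists>p. word_path M n p \<and> p 0 = a \<and> p n = b"
    "\<And>b n. n \<ge> K b \<Longrightarrow> \<exists>p. word_path M n p \<and> p 0 = b \<and> p n = a" by metis
  \<comment> \<open>A common length for all connecting paths: it exceeds the mixing times of the
    finitely many letters below \<open>N\<close>, makes the final period at least \<open>N1\<close>,
    and leaves \<open>k - 1 \<ge> 1\<close>.\<close>
  define k where "k = (\<Sum>b<N. K b) + N1 + 2"
  have Kk: "K b \<le> k" if "b < N" for b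
    using member_le_sum[of b "{..<N}" K] that by (simp add: k_def)
  have k1: "k \<ge> 1" "k - 1 \<ge> 1" by (auto simp: k_def)
  have "\<forall>b. \<exists>u. b < N \<longrightarrow> word_path M k u \<and> u 0 = a \<and> u k = b" using K(1) Kk by blast
  then obtain u where u: "\<And>b. b < N \<Longrightarrow> word_path M k (u b) \<and> u b 0 = a \<and> u b k = b" by metis
  have "\<forall>b. \<exists>v. b < N \<longrightarrow> word_path M k v \<and> v 0 = b \<and> v k = a" using K(2) Kk by blast
  then obtain v where v: "\<And>b. b < N \<Longrightarrow> word_path M k (v b) \<and> v b 0 = b \<and> v b k = a" by metis
  have "\<forall>b. \<exists>d. \<forall>x\<in>shift_space M. (\<forall>j<k. x j = u b j) \<longrightarrow> d \<le> f k x"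
    using word_lower_bound[OF k1(1)] by metis
  then obtain d1 where d1: "\<And>b x. x \<in> shift_space M \<Longrightarrow> (\<And>j. j < k \<Longrightarrow> x j = u b j) \<Longrightarrow> d1 b \<le> f k x" by metis
  have "\<forall>b. \<exists>d. \<forall>x\<in>shift_space M. (\<forall>j<k - 1. x j = v b (Suc j)) \<longrightarrow> d \<le> f (k - 1) x"
  proof
    fix b
    obtain d where "\<And>x. x \<in> shift_space M \<Longrightarrow> (\<And>j. j < k - 1 \<Longrightarrow> x j = v b (Suc j)) \<Longrightarrow> d \<le> f (k - 1) x"
      by (rule word_lower_bound[OF k1(2), of "\<lambda>j. v b (Suc j)"]) blast
    then show "\<exists>d. \<forall>x\<in>shift_space M. (\<forall>j<k - 1. x j = v b (Suc j)) \<longrightarrow> d \<le> f (k - 1) x" by blast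
  qed
  then obtain d2 where d2: "\<And>b x. x \<in> shift_space M \<Longrightarrow> (\<And>j. j < k - 1 \<Longrightarrow> x j = v b (Suc j)) \<Longrightarrow> d2 b \<le> f (k - 1) x"
    by metis
  \<comment> \<open>Two splittings and one comparison by bounded variation cost
    \<open>3 * C\<close>; the sums bound the least values of the potential along the connecting
    paths.\<close>
  define D where "D = 3 * C + (\<Sum>b<N. \<bar>d1 b\<bar>) + (\<Sum>b<N. \<bar>d2 b\<bar>)"
  show ?thesis
  proof (rule that)
    show "k \<ge> 2" "k \<ge> N1" by (auto simp: k_def)
    fix m y assume m: "m \<ge> (1::nat)" and y: "y \<in> shift_space M" and b: "y 0 < N" and c: "y (m - 1) < N"
    define p where "p = k + (m + (k - 1))"
    have p: "p = k + (m - 1 + k)" using m k1 by (simp add: p_def)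
    then have p1: "p \<ge> 1" using k1 by simp
    \<comment> \<open>From \<open>a\<close> to \<open>y 0\<close> in \<open>k\<close> edges, along
      \<open>y\<close> for \<open>m - 1\<close> edges, and back to \<open>a\<close> in
      \<open>k\<close> edges.\<close>
    define W where "W = glue k (u (y 0)) (glue (m - 1) y (v (y (m - 1))))"
    define z where "z = periodic p W"
    have W0: "W 0 = a" using u[OF b] k1 by (simp add: W_def glue_def)
    have "word_path M p W" unfolding p W_def
      using u[OF b] v[OF c] path_shift_space[OF y] by (intro path_glue) (auto simp: glue_def)
    moreover have "W p = W 0" unfolding W0 using v[OF c] by (simp add: W_def glue_def p)
    ultimately have zS: "z \<in> shift_space M" unfolding z_def
      using p1 by (rule periodic_shift_space)
    have zP: "z \<in> Per p" unfolding Per_def using zS W0 p1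
      by (simp add: z_def shift_map_periodic)
    have z1: "z j = u (y 0) j" if "j < k" for j
      using that by (simp add: z_def p W_def glue_def)
    have z2: "z (k + j) = y j" if "j < m" for j
    proof (cases "j = m - 1")
      case True
      then show ?thesis using v[OF c] m k1 by (auto simp: z_def p W_def glue_def)
    next
      case False
      then have "j < m - 1" using that by simp
      then show ?thesis by (simp add: z_def p W_def glue_def)
    qed
    \<comment> \<open>The return path starts at \<open>y (m - 1)\<close>, already counted among the
      \<open>m\<close> letters of \<open>y\<close>; hence \<open>Suc j\<close>, and only
      \<open>k - 1\<close> further letters.\<close>
    have z3: "z (k + (m + j)) = v (y (m - 1)) (Suc j)" if "j < k - 1" for j
    proof -
      have "k + (m + j) < p" using that by (simp add: p_def)
      moreover have "m + j - (m - 1) = Suc j" using m by simp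
      moreover have "\<not> m + j < m - 1" by simp
      ultimately show ?thesis using m by (simp add: z_def W_def glue_def)
    qed
    have S: "(shift_map ^^ k) z \<in> shift_space M" "(shift_map ^^ m) ((shift_map ^^ k) z) \<in> shift_space M"
      using zS by (auto intro: shift_map_funpow_shift_space)
    have "f k z + f (m + (k - 1)) ((shift_map ^^ k) z) - C \<le> f p z"
      unfolding p_def using k1 zS m by (intro almost_add_ge) auto
    moreover have "f m ((shift_map ^^ k) z) + f (k - 1) ((shift_map ^^ m) ((shift_map ^^ k) z)) - C
        \<le> f (m + (k - 1)) ((shift_map ^^ k) z)"
      using k1 S m by (intro almost_add_ge) auto
    moreover have "d1 (y 0) \<le> f k z" using z1 zS by (intro d1) auto
    moreover have "\<bar>f m ((shift_map ^^ k) z) - f m y\<bar> \<le> C"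
      using z2 S y m by (intro variation) (auto simp: shift_map_funpow)
    moreover have "d2 (y (m - 1)) \<le> f (k - 1) ((shift_map ^^ m) ((shift_map ^^ k) z))"
      using z3 S by (intro d2) (auto simp: shift_map_funpow)
    moreover have "\<bar>d1 (y 0)\<bar> \<le> (\<Sum>b<N. \<bar>d1 b\<bar>)" "\<bar>d2 (y (m - 1))\<bar> \<le> (\<Sum>b<N. \<bar>d2 b\<bar>)"
      using b c by (auto intro!: member_le_sum)
    ultimately have "f m y \<le> f p z + D" unfolding D_def by linarith
    then show "\<exists>z\<in>Per (k + (m + (k - 1))). (\<forall>j<m. z (k + j) = y j) \<and> f m y \<le> f (k + (m + (k - 1))) z + D"
      using zP z2 unfolding p_def by blast
  qed
qed

text \<open>With \<open>P\<close> the pressure, a run of such letters weighs at most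
  \<open>exp P\<close> per letter, no more than the growth that is allowed anyway.\<close>

lemma le_sum_large_letters:
  assumes x: "x \<in> shift_space M" and "n \<ge> 1" and P: "\<And>q. q < n \<Longrightarrow> s (x q) + C \<le> P"
  shows "f n x \<le> real n * P"
proof -
  have "(\<Sum>j<n. s (x j) + C) \<le> (\<Sum>j<n. P)" using P by (intro sum_mono) auto
  then show ?thesis using le_sum_letters[OF assms(2) x] by (simp add: sum.distrib)
qed

lemma le_large_prefix:
  assumes x: "x \<in> shift_space M" and "m \<ge> 1" and P: "\<And>q. q < i \<Longrightarrow> s (x q) + C \<le> P"
  shows "f (i + m) x \<le> real i * P + f m ((shift_map ^^ i) x) + C"
proof (cases "i = 0")
  case False
  then have "f i x \<le> real i * P" using P by (intro le_sum_large_letters x) auto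
  then show ?thesis using almost_add_le[of i m x] False assms(1,2) by simp
qed (use C_nonneg in simp)

lemma le_large_suffix:
  assumes x: "x \<in> shift_space M" and "m \<ge> 1" and P: "\<And>q. q < j \<Longrightarrow> s (x (m + q)) + C \<le> P"
  shows "f (m + j) x \<le> f m x + real j * P + C"
proof (cases "j = 0")
  case False
  have "f j ((shift_map ^^ m) x) \<le> real j * P"
    using False P by (intro le_sum_large_letters shift_map_funpow_shift_space x) (auto simp: shift_map_funpow)
  then show ?thesis
    using almost_add_le[of m j x] False assms(1,2) by simp
qed (use C_nonneg in simp)

text \<open>
  The points \<open>V\<close> have pairwise distinct blocks. They are grouped by the positions of the first and the
  last letter below \<open>N\<close>; each group injects into the periodic points of one period.
\<close>

lemma sum_blocks_le:
  assumes P: "\<And>n. n \<ge> N1 \<Longrightarrow> Z n \<le> exp (real n * P + 3 * C)"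
    and N: "\<And>i. i \<ge> N \<Longrightarrow> s i + C \<le> P"
  obtains A where "A > 0"
    "\<And>n V. n \<ge> 1 \<Longrightarrow> finite V \<Longrightarrow> V \<subseteq> shift_space M \<Longrightarrow> inj_on (block N n) V \<Longrightarrow>
      (\<Sum>x\<in>V. exp (f n x)) \<le> A * (real n ^ 2 + 1) * exp (real n * P)"
proof -
  obtain k D where k: "k \<ge> 2" "k \<ge> N1" and close:
    "\<And>m y. m \<ge> 1 \<Longrightarrow> y \<in> shift_space M \<Longrightarrow> y 0 < N \<Longrightarrow> y (m - 1) < N \<Longrightarrow>
      \<exists>z\<in>Per (k + (m + (k - 1))). (\<forall>j<m. z (k + j) = y j) \<and> f m y \<le> f (k + (m + (k - 1))) z + D"
    using closing[of N1 N] by metis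
  \<comment> \<open>The estimate \<open>(n - m) P + 2 C + D\<close> for a point and
    \<open>p P + 3 C\<close> for the periodic sum add up to \<open>n P\<close> plus this exponent,
    since \<open>p = m + 2 k - 1\<close>.\<close>
  define A' where "A' = exp ((2 * real k - 1) * P + 5 * C + D)"
  show ?thesis
  proof (rule that[of "A' + 1"])
    show "A' + 1 > 0" unfolding A'_def by (simp add: add_pos_pos)
    fix n V assume n: "n \<ge> (1::nat)" and V: "finite V" "V \<subseteq> shift_space M" and inj: "inj_on (block N n) V"
    define V0 where "V0 = {x \<in> V. \<forall>q<n. N \<le> x q}"
    define V1 where "V1 = {x \<in> V. \<exists>q<n. x q < N}"
    \<comment> \<open>The window of length \<open>m\<close> starting at \<open>i\<close> runs from
      the first to the last letter below \<open>N\<close>.\<close>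
    define T where "T i m x \<longleftrightarrow> m \<ge> 1 \<and> i + m \<le> n \<and> x i < N \<and> x (i + m - 1) < N \<and> (\<forall>q<i. N \<le> x q)
        \<and> (\<forall>q. i + m \<le> q \<longrightarrow> q < n \<longrightarrow> N \<le> x q)" for i m and x :: "nat \<Rightarrow> nat"
    have "\<exists>t. T (fst t) (snd t) x" if "x \<in> V1" for x
    proof -
      define Q where "Q = {q. q < n \<and> x q < N}"
      have Q: "finite Q" "Q \<noteq> {}" using that by (auto simp: Q_def V1_def)
      then have mem: "Min Q \<in> Q" "Max Q \<in> Q" by (rule Min_in, rule Max_in)
      have le: "Min Q \<le> Max Q" using Q mem by (auto intro: Min_le)
      have "N \<le> x q" if "q < Min Q" for q
        using Min_le[OF Q(1), of q] that mem by (fastforce simp: Q_def)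
      moreover have "N \<le> x q" if "Max Q < q" "q < n" for q
        using Max_ge[OF Q(1), of q] that by (fastforce simp: Q_def)
      ultimately have "T (Min Q) (Max Q - Min Q + 1) x"
        using mem le by (auto simp: T_def Q_def)
      then show ?thesis by (intro exI[of _ "(Min Q, Max Q - Min Q + 1)"]) simp
    qed
    then obtain ty where ty: "\<And>x. x \<in> V1 \<Longrightarrow> T (fst (ty x)) (snd (ty x)) x" by metis
    have group: "(\<Sum>x | x \<in> V1 \<and> ty x = t. exp (f n x)) \<le> A' * exp (real n * P)" for t
    proof -
      obtain i m where t: "t = (i, m)" by (cases t)
      define U where "U = {x \<in> V1. ty x = t}"
      show ?thesis
      proof (cases "U = {}")
        case True
        then show ?thesis unfolding U_def[symmetric] by (simp add: A'_def)
      next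
        case False
        have UT: "T i m x" if "x \<in> U" for x using ty[of x] that t by (simp add: U_def)
        have UV: "U \<subseteq> V" by (auto simp: U_def V1_def)
        have m: "m \<ge> 1" "i + m \<le> n" using False UT by (auto simp: T_def)
        define p where "p = k + (m + (k - 1))"
        have "\<exists>z\<in>Per p. (\<forall>j<m. z (k + j) = x (i + j)) \<and> f m ((shift_map ^^ i) x) \<le> f p z + D"
          if "x \<in> U" for x
        proof -
          have "\<exists>z\<in>Per p. (\<forall>j<m. z (k + j) = (shift_map ^^ i) x j) \<and> f m ((shift_map ^^ i) x) \<le> f p z + D"
            unfolding p_def using m UT[OF that] UV V(2) that
            by (intro close shift_map_funpow_shift_space) (auto simp: shift_map_funpow T_def)
          then show ?thesis by (simp add: shift_map_funpow)
        qed
        then obtain z where z: "\<And>x. x \<in> U \<Longrightarrow> z x \<in> Per p"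
          "\<And>x j. x \<in> U \<Longrightarrow> j < m \<Longrightarrow> z x (k + j) = x (i + j)"
          "\<And>x. x \<in> U \<Longrightarrow> f m ((shift_map ^^ i) x) \<le> f p (z x) + D" by metis
        \<comment> \<open>Inside the window the letters can be read off the periodic point; outside
          it all letters are lumped together, so the block is recovered.\<close>
        have inj_z: "inj_on z U"
        proof (rule inj_onI)
          fix x y assume xy: "x \<in> U" "y \<in> U" "z x = z y"
          have "min (x q) N = min (y q) N" if "q < n" for q
          proof -
            consider "q < i" | "i \<le> q" "q < i + m" | "i + m \<le> q" by linarith
            then show ?thesis
            proof cases
              case 2
              then have "x (i + (q - i)) = y (i + (q - i))"
                using z(2)[OF xy(1), of "q - i"] z(2)[OF xy(2), of "q - i"] xy(3) by simp
              then show ?thesis using 2 by simp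
            qed (use UT[OF xy(1)] UT[OF xy(2)] that in \<open>auto simp: T_def\<close>)
          qed
          then have "block N n x = block N n y" by (simp add: block_eq_iff)
          then show "x = y" using inj xy UV by (auto dest: inj_onD)
        qed
        have bound: "f n x \<le> (real n - real m) * P + 2 * C + D + f p (z x)" if x: "x \<in> U" for x
        proof -
          have xS: "x \<in> shift_space M" using x UV V by auto
          define j where "j = n - (i + m)"
          have n_eq: "n = i + (m + j)" using m by (simp add: j_def)
          have "f (i + (m + j)) x \<le> real i * P + f (m + j) ((shift_map ^^ i) x) + C"
            using UT[OF x] m xS by (intro le_large_prefix N) (auto simp: T_def)
          moreover have "f (m + j) ((shift_map ^^ i) x) \<le> f m ((shift_map ^^ i) x) + real j * P + C"
            using UT[OF x] m xS n_eq
            by (intro le_large_suffix N shift_map_funpow_shift_space) (auto simp: T_def shift_map_funpow)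
          moreover have "f m ((shift_map ^^ i) x) \<le> f p (z x) + D" using z(3)[OF x] .
          moreover have "(real n - real m) * P = real i * P + real j * P"
            unfolding n_eq by (simp add: algebra_simps)
          ultimately show ?thesis using n_eq by simp
        qed
        have "(\<Sum>x\<in>U. exp (f n x)) \<le> (\<Sum>x\<in>U. exp ((real n - real m) * P + 2 * C + D) * exp (f p (z x)))"
          using bound by (intro sum_mono) (simp add: exp_add[symmetric])
        also have "\<dots> = exp ((real n - real m) * P + 2 * C + D) * (\<Sum>x\<in>z ` U. exp (f p x))"
          by (simp add: sum_distrib_left sum.reindex[OF inj_z])
        also have "(\<Sum>x\<in>z ` U. exp (f p x)) \<le> Z p"
          using z(1) k V UV by (intro sum_le_Z) (auto simp: p_def intro: finite_subset)
        also have "Z p \<le> exp (real p * P + 3 * C)" using k by (intro P) (simp add: p_def)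
        also have "exp ((real n - real m) * P + 2 * C + D) * exp (real p * P + 3 * C) = A' * exp (real n * P)"
        proof -
          have p_eq: "real p = 2 * real k + real m - 1" using k by (simp add: p_def of_nat_diff)
          show ?thesis unfolding A'_def exp_add[symmetric] p_eq by (simp add: algebra_simps)
        qed
        finally show ?thesis by (simp add: U_def mult_left_mono)
      qed
    qed
    \<comment> \<open>There are at most \<open>n ^ 2\<close> windows, a factor that disappears in
      the exponential growth rate.\<close>
    have "(\<Sum>x\<in>V1. exp (f n x)) = (\<Sum>t\<in>{..<n} \<times> {1..n}. \<Sum>x | x \<in> V1 \<and> ty x = t. exp (f n x))"
    proof (rule sum.group[symmetric])
      show "ty ` V1 \<subseteq> {..<n} \<times> {1..n}"
      proof (rule image_subsetI)
        fix x assume "x \<in> V1"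
        then show "ty x \<in> {..<n} \<times> {1..n}" using ty[of x] by (cases "ty x") (auto simp: T_def)
      qed
    qed (use V in \<open>auto simp: V1_def\<close>)
    also have "\<dots> \<le> (\<Sum>t\<in>{..<n} \<times> {1..n}. A' * exp (real n * P))" by (intro sum_mono group)
    also have "\<dots> = real n ^ 2 * (A' * exp (real n * P))" by (simp add: power2_eq_square)
    finally have S1: "(\<Sum>x\<in>V1. exp (f n x)) \<le> real n ^ 2 * (A' * exp (real n * P))" .
    \<comment> \<open>Points without a letter below \<open>N\<close> all have the same
      block.\<close>
    have "card V0 \<le> 1"
    proof -
      have "x = y" if "x \<in> V0" "y \<in> V0" for x y
      proof -
        have "block N n x = block N n y" using that by (simp add: block_eq_iff V0_def)
        then show ?thesis using inj that by (auto simp: V0_def dest: inj_onD)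
      qed
      then show ?thesis using V by (intro card_le_Suc0_iff_eq[THEN iffD2, unfolded One_nat_def[symmetric]]) (auto simp: V0_def)
    qed
    moreover have "(\<Sum>x\<in>V0. exp (f n x)) \<le> real (card V0) * exp (real n * P)"
    proof (rule sum_bounded_above)
      fix x assume "x \<in> V0"
      then show "exp (f n x) \<le> exp (real n * P)"
        using n V N by (auto simp: V0_def intro!: le_sum_large_letters)
    qed
    ultimately have S0: "(\<Sum>x\<in>V0. exp (f n x)) \<le> exp (real n * P)"
      by (auto intro: order_trans mult_left_le_one_le)
    have "V = V0 \<union> V1" "V0 \<inter> V1 = {}" by (auto simp: V0_def V1_def not_less)
    then have "(\<Sum>x\<in>V. exp (f n x)) = (\<Sum>x\<in>V0. exp (f n x)) + (\<Sum>x\<in>V1. exp (f n x))"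
      using V(1) by (metis sum.union_disjoint finite_Un)
    also have "\<dots> \<le> exp (real n * P) + real n ^ 2 * (A' * exp (real n * P))" using S0 S1 by simp
    also have "\<dots> \<le> (A' + 1) * (real n ^ 2 + 1) * exp (real n * P)"
    proof -
      have "A' \<ge> 0" by (simp add: A'_def)
      then have "1 + real n ^ 2 * A' \<le> (A' + 1) * (real n ^ 2 + 1)" by (simp add: algebra_simps)
      then have "(1 + real n ^ 2 * A') * exp (real n * P) \<le> (A' + 1) * (real n ^ 2 + 1) * exp (real n * P)"
        by (intro mult_right_mono) auto
      then show ?thesis by (simp add: algebra_simps)
    qed
    finally show "(\<Sum>x\<in>V. exp (f n x)) \<le> (A' + 1) * (real n ^ 2 + 1) * exp (real n * P)" .
  qed
qed

end

lemma (in prob_space) integral_simple_function: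
  fixes \<phi> :: "'b \<Rightarrow> real"
  assumes X: "simple_function M X"
  shows "integrable M (\<lambda>x. \<phi> (X x))" "(\<integral>x. \<phi> (X x) \<partial>M) = (\<Sum>v\<in>X ` space M. level_prob M X v * \<phi> v)"
proof -
  have int: "integrable M (\<lambda>x. \<phi> v * indicator (X -` {v} \<inter> space M) x)" for v
    using simple_functionD(2)[OF X] by (intro integrable_mult_right integrable_real_indicator) (auto simp: less_top[symmetric])
  have eq: "(\<Sum>v\<in>X ` space M. \<phi> v * indicator (X -` {v} \<inter> space M) x) = \<phi> (X x)" if "x \<in> space M" for x
  proof -
    have "(\<Sum>v\<in>X ` space M. \<phi> v * indicator (X -` {v} \<inter> space M) x) = (\<Sum>v\<in>X ` space M. if v = X x then \<phi> v else 0)"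
      using that by (intro sum.cong) (auto simp: indicator_def)
    then show ?thesis using that simple_functionD(1)[OF X] by simp
  qed
  have "integrable M (\<lambda>x. \<Sum>v\<in>X ` space M. \<phi> v * indicator (X -` {v} \<inter> space M) x)"
    using int by (rule Bochner_Integration.integrable_sum)
  then show "integrable M (\<lambda>x. \<phi> (X x))"
    using eq by (subst (asm) Bochner_Integration.integrable_cong) auto
  have "(\<integral>x. \<phi> (X x) \<partial>M) = (\<integral>x. (\<Sum>v\<in>X ` space M. \<phi> v * indicator (X -` {v} \<inter> space M) x) \<partial>M)"
    using eq by (intro Bochner_Integration.integral_cong) auto
  also have "\<dots> = (\<Sum>v\<in>X ` space M. \<integral>x. \<phi> v * indicator (X -` {v} \<inter> space M) x \<partial>M)"
    using int by (rule Bochner_Integration.integral_sum)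
  also have "\<dots> = (\<Sum>v\<in>X ` space M. level_prob M X v * \<phi> v)"
    by (intro sum.cong) (auto simp: level_prob_def mult.commute)
  finally show "(\<integral>x. \<phi> (X x) \<partial>M) = (\<Sum>v\<in>X ` space M. level_prob M X v * \<phi> v)" .
qed

locale mixing_potential_measure = mixing_potential M f C s a + potential_measure M f C s \<nu>
  for M f C s a \<nu>
begin

text \<open>The Gibbs inequality for the partition into blocks. On a block with lumped letters
  \<open>f n\<close> is bounded above but its supremum need not be attained, so \<open>V\<close>
  consists of maximisers up to 1. That error and the one from \<open>neg_mult_ln_le\<close> make up
  the constant 2.\<close>

lemma block_entropy_le:
  assumes f1: "integrable \<nu> (f 1)" and n: "n \<ge> 1"
  obtains V where "finite V" "V \<noteq> {}" "V \<subseteq> shift_space M" "inj_on (block N n) V"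
    "shannon_entropy \<nu> (block N n) + (\<integral>x. f n x \<partial>\<nu>) \<le> ln (\<Sum>x\<in>V. exp (f n x)) + 2"
proof -
  define B where "B = block N n ` shift_space M"
  have finB: "finite B" unfolding B_def using simple_functionD(1)[OF simple_function_block[of N n]] by simp
  have "\<exists>x\<in>shift_space M. block N n x = v \<and> (\<forall>y\<in>shift_space M. block N n y = v \<longrightarrow> f n y \<le> f n x + 1)"
    if "v \<in> B" for v
  proof -
    define Y where "Y = f n ` {y \<in> shift_space M. block N n y = v}"
    have "Y \<noteq> {}" using that by (auto simp: Y_def B_def)
    moreover have bdd: "bdd_above Y" unfolding Y_def
      using le_const[OF n] by (intro bdd_aboveI[of _ "real n * (s_max + C)"]) auto
    ultimately have "\<exists>r\<in>Y. Sup Y - 1 < r" using less_cSup_iff[of Y "Sup Y - 1"] by simp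
    then obtain x where x: "x \<in> shift_space M" "block N n x = v" "Sup Y - 1 < f n x" by (auto simp: Y_def)
    have "f n y \<le> f n x + 1" if "y \<in> shift_space M" "block N n y = v" for y
    proof -
      have "f n y \<le> Sup Y" using that bdd by (intro cSup_upper) (auto simp: Y_def)
      then show ?thesis using x by simp
    qed
    then show ?thesis using x by blast
  qed
  then obtain r where r: "\<And>v. v \<in> B \<Longrightarrow> r v \<in> shift_space M" "\<And>v. v \<in> B \<Longrightarrow> block N n (r v) = v"
    "\<And>v y. v \<in> B \<Longrightarrow> y \<in> shift_space M \<Longrightarrow> block N n y = v \<Longrightarrow> f n y \<le> f n (r v) + 1"
    by metis
  define V where "V = r ` B"
  have inj_r: "inj_on r B" by (rule inj_on_inverseI[of B "block N n"]) (rule r(2))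
  define F where "F v = f n (r v) + 1" for v
  define W where "W = (\<Sum>v\<in>B. exp (F v))"
  have Bne: "B \<noteq> {}" using not_empty by (auto simp: B_def)
  have Wpos: "W > 0" unfolding W_def using finB Bne by (intro sum_pos) auto
  define p where "p v = level_prob \<nu> (block N n) v" for v
  have sum_p: "(\<Sum>v\<in>B. p v) = 1"
    unfolding p_def B_def using sum_level_prob[OF simple_function_block[of N n]] by simp
  have "(\<integral>x. f n x \<partial>\<nu>) \<le> (\<integral>x. F (block N n x) \<partial>\<nu>)"
    using integrable_f[OF f1 n] integral_simple_function(1)[OF simple_function_block] r(3)
    by (intro integral_mono) (auto simp: F_def B_def)
  also have "\<dots> = (\<Sum>v\<in>B. p v * F v)"
    using integral_simple_function(2)[OF simple_function_block[of N n], of F] by (simp add: B_def p_def)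
  finally have int: "(\<integral>x. f n x \<partial>\<nu>) \<le> (\<Sum>v\<in>B. p v * F v)" .
  have "shannon_entropy \<nu> (block N n) = (\<Sum>v\<in>B. - (p v * ln (p v)))"
    by (simp add: shannon_entropy_def p_def B_def sum_negf)
  \<comment> \<open>With this \<open>b\<close> the exponentials are the Gibbs weights
    \<open>exp (F v) / W\<close>, which sum to 1.\<close>
  also have "\<dots> \<le> (\<Sum>v\<in>B. p v * (ln W - F v) + exp (- (ln W - F v)))"
    by (intro sum_mono neg_mult_ln_le) (simp add: p_def)
  also have "\<dots> = (\<Sum>v\<in>B. ln W * p v - p v * F v + exp (F v) / W)"
    using Wpos by (intro sum.cong) (auto simp: exp_diff algebra_simps)
  also have "\<dots> = ln W * (\<Sum>v\<in>B. p v) - (\<Sum>v\<in>B. p v * F v) + (\<Sum>v\<in>B. exp (F v)) / W"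
    by (simp add: sum.distrib sum_subtractf sum_distrib_left sum_divide_distrib)
  also have "\<dots> = ln W - (\<Sum>v\<in>B. p v * F v) + 1" using Wpos sum_p by (simp add: W_def)
  finally have H: "shannon_entropy \<nu> (block N n) + (\<integral>x. f n x \<partial>\<nu>) \<le> ln W + 1" using int by simp
  have "W = exp 1 * (\<Sum>x\<in>V. exp (f n x))"
    unfolding W_def V_def F_def by (simp add: sum.reindex[OF inj_r] exp_add sum_distrib_left mult.commute)
  moreover have "(\<Sum>x\<in>V. exp (f n x)) > 0"
    unfolding V_def using finB Bne by (intro sum_pos) auto
  ultimately have "ln W = 1 + ln (\<Sum>x\<in>V. exp (f n x))" by (simp add: ln_mult)
  then have "shannon_entropy \<nu> (block N n) + (\<integral>x. f n x \<partial>\<nu>) \<le> ln (\<Sum>x\<in>V. exp (f n x)) + 2" using H by simp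
  moreover have "inj_on (block N n) V" unfolding V_def
    using r(2) by (intro inj_onI) auto
  ultimately show ?thesis using r(1) finB Bne by (intro that[of V]) (auto simp: V_def)
qed

text \<open>Division by \<open>n\<close> removes the polynomial factor of the block count, giving
  the inequality for each \<open>letter N\<close> with \<open>N\<close> large; the generator
  argument passes to the full entropy.\<close>

lemma ks_entropy_add_mean_value_le:
  assumes f1: "integrable \<nu> (f 1)" and L: "mean_value f \<nu> = ereal L" and h: "ks_entropy \<nu> shift_map = ereal h"
  obtains P where "gurevich_pressure M a f = ereal P" "h + L \<le> P"
proof -
  obtain P N1 where P: "gurevich_pressure M a f = ereal P" and "N1 \<ge> 1"
    and Z: "\<And>n. n \<ge> N1 \<Longrightarrow> Z n \<le> exp (real n * P + 3 * C)" by (rule gurevich_pressure_eq) blast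
  have L_lim: "(\<lambda>n. (\<integral>x. f n x \<partial>\<nu>) / real n) \<longlonglongrightarrow> L"
    using mean_value_integrable[OF f1] L by (metis ereal.inject)
  \<comment> \<open>From this index on \<open>s i + C \<le> P\<close>, the condition under which
    long runs of large letters are harmless.\<close>
  obtain N0 where N0: "\<And>i. i \<ge> N0 \<Longrightarrow> s i \<le> - (C - P)"
    using eventually_letter_le[of "C - P"] by (auto simp: eventually_sequentially)
  have "entropy_rate \<nu> shift_map (letter N) \<le> P - L" if "N \<ge> N0" for N
  proof -
    have N: "s i + C \<le> P" if "i \<ge> N" for i using N0[of i] that \<open>N \<ge> N0\<close> by simp
    obtain A where A: "A > 0" "\<And>n V. n \<ge> 1 \<Longrightarrow> finite V \<Longrightarrow> V \<subseteq> shift_space M \<Longrightarrow> inj_on (block N n) V \<Longrightarrow>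
      (\<Sum>x\<in>V. exp (f n x)) \<le> A * (real n ^ 2 + 1) * exp (real n * P)"
      using sum_blocks_le[OF Z N] by metis
    have bound: "shannon_entropy \<nu> (block N n) / real n + (\<integral>x. f n x \<partial>\<nu>) / real n
        \<le> P + (ln A + 2 + ln (real n ^ 2 + 1)) / real n" if n: "n \<ge> 1" for n
    proof -
      obtain V where V: "finite V" "V \<noteq> {}" "V \<subseteq> shift_space M" "inj_on (block N n) V"
        "shannon_entropy \<nu> (block N n) + (\<integral>x. f n x \<partial>\<nu>) \<le> ln (\<Sum>x\<in>V. exp (f n x)) + 2"
        by (rule block_entropy_le[OF f1 n])
      have pos: "(\<Sum>x\<in>V. exp (f n x)) > 0" using V by (intro sum_pos) auto
      have "ln (\<Sum>x\<in>V. exp (f n x)) \<le> ln (A * (real n ^ 2 + 1) * exp (real n * P))"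
        using A(2)[OF n V(1,3,4)] pos by (intro ln_mono) auto
      also have "\<dots> = ln A + ln (real n ^ 2 + 1) + real n * P"
      proof -
        have "real n ^ 2 + 1 > 0" by (simp add: add_nonneg_pos)
        then show ?thesis using A(1) by (simp add: ln_mult)
      qed
      finally have "shannon_entropy \<nu> (block N n) + (\<integral>x. f n x \<partial>\<nu>) \<le> real n * P + (ln A + 2 + ln (real n ^ 2 + 1))"
        using V(5) by simp
      then have "(shannon_entropy \<nu> (block N n) + (\<integral>x. f n x \<partial>\<nu>)) / real n
          \<le> (real n * P + (ln A + 2 + ln (real n ^ 2 + 1))) / real n"
        by (intro divide_right_mono) auto
      then show ?thesis using n by (simp add: add_divide_distrib)
    qed
    have "(\<lambda>n. P + (ln A + 2 + ln (real n ^ 2 + 1)) / real n) \<longlonglongrightarrow> P"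
      by real_asymp
    moreover have "(\<lambda>n. shannon_entropy \<nu> (block N n) / real n + (\<integral>x. f n x \<partial>\<nu>) / real n)
        \<longlonglongrightarrow> entropy_rate \<nu> shift_map (letter N) + L"
      by (intro tendsto_add entropy_rate_tendsto simple_function_letter L_lim)
    ultimately have "entropy_rate \<nu> shift_map (letter N) + L \<le> P"
      using bound by (intro LIMSEQ_le) auto
    then show ?thesis by simp
  qed
  then have "ks_entropy \<nu> shift_map \<le> ereal (P - L)" by (rule ks_entropy_le_of_letters)
  then show ?thesis using h P that by simp
qed

end

section \<open>Equilibrium states at low temperature\<close>

context potential_measure
begin

text \<open>The part of the entropy bound that weak convergence does not control by itself, its
  integrand being in general unbounded.\<close>

definition letter_tail :: "nat \<Rightarrow> real" where
  "letter_tail N = (\<integral>x. (if N \<le> x 0 then - s (x 0) else 0) \<partial>\<nu>)"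

lemma letter_tail_tendsto_0:
  assumes "integrable \<nu> (f 1)"
  shows "letter_tail \<longlonglongrightarrow> 0"
proof -
  have "(\<lambda>N. \<integral>x. (if N \<le> x 0 then - s (x 0) else 0) \<partial>\<nu>) \<longlonglongrightarrow> (\<integral>x. 0 \<partial>\<nu>)"
  proof (rule integral_dominated_convergence)
    show "integrable \<nu> (\<lambda>x. \<bar>if 0 \<le> x 0 then - s (x 0) else 0\<bar>)"
      by (rule integrable_abs[OF integrable_letter[OF assms]])
    show "(\<lambda>x. if N \<le> x 0 then - s (x 0) else 0) \<in> borel_measurable \<nu>" for N
      using integrable_letter[OF assms] by (rule borel_measurable_integrable)
    show "AE x in \<nu>. (\<lambda>N. if N \<le> x 0 then - s (x 0) else 0) \<longlonglongrightarrow> 0"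
    proof (rule AE_I2)
      fix x :: "nat \<Rightarrow> nat"
      have "eventually (\<lambda>N. (if N \<le> x 0 then - s (x 0) else 0) = 0) sequentially"
        using eventually_gt_at_top[of "x 0"] by eventually_elim simp
      then show "(\<lambda>N. if N \<le> x 0 then - s (x 0) else 0) \<longlonglongrightarrow> 0" by (rule tendsto_eventually)
    qed
  qed auto
  then show ?thesis by (simp add: letter_tail_def[abs_def])
qed

text \<open>By invariance each of the \<open>n\<close> coordinates contributes the same tail, so an
  excess in the tail is multiplied by \<open>n\<close>, whereas the error in the integral of
  \<open>f n\<close> stays bounded.\<close>

lemma integral_add_letters:
  fixes N n :: nat
  assumes f1: "integrable \<nu> (f 1)" and n: "n \<ge> 1"
  defines "g \<equiv> \<lambda>x. f n x + (\<Sum>j<n. if N \<le> x j then - s (x j) else 0)"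
  shows "integrable \<nu> g" "(\<integral>x. g x \<partial>\<nu>) = (\<integral>x. f n x \<partial>\<nu>) + real n * letter_tail N"
proof -
  define \<tau> where "\<tau> x = (if N \<le> x 0 then - s (x 0) else 0)" for x :: "nat \<Rightarrow> nat"
  have \<tau>: "integrable \<nu> \<tau>" unfolding \<tau>_def by (rule integrable_letter[OF f1])
  have g: "g = (\<lambda>x. f n x + (\<Sum>j<n. \<tau> ((shift_map ^^ j) x)))"
    by (simp add: g_def \<tau>_def shift_map_funpow cong: if_cong)
  have int: "integrable \<nu> (\<lambda>x. \<Sum>j<n. \<tau> ((shift_map ^^ j) x))"
    using integrable_funpow[OF \<tau>] by (rule Bochner_Integration.integrable_sum)
  show "integrable \<nu> g" unfolding g
    using integrable_f[OF f1 n] int by (rule Bochner_Integration.integrable_add)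
  have "(\<integral>x. (\<Sum>j<n. \<tau> ((shift_map ^^ j) x)) \<partial>\<nu>) = (\<Sum>j<n. \<integral>x. \<tau> ((shift_map ^^ j) x) \<partial>\<nu>)"
    using integrable_funpow[OF \<tau>] by (rule Bochner_Integration.integral_sum)
  also have "\<dots> = (\<Sum>j<n. letter_tail N)"
    using integral_funpow[of \<tau>] \<tau> by (simp add: letter_tail_def \<tau>_def)
  finally show "(\<integral>x. g x \<partial>\<nu>) = (\<integral>x. f n x \<partial>\<nu>) + real n * letter_tail N"
    unfolding g using integrable_f[OF f1 n] int by (simp add: Bochner_Integration.integral_add)
qed

end

text \<open>A large letter contributes at most its \<open>s\<close> to \<open>f n\<close>, and the
  added term cancels that; the other letters are bounded by \<open>s_max\<close>.\<close>

lemma (in markov_potential) add_letters_le: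
  assumes "n \<ge> 1" "x \<in> shift_space M"
  shows "f n x + (\<Sum>j<n. if N \<le> x j then - s (x j) else 0) \<le> real n * (s_max + C)"
proof -
  have "(\<Sum>j<n. s (x j)) + (\<Sum>j<n. if N \<le> x j then - s (x j) else 0) \<le> (\<Sum>j<n. s_max)"
    unfolding sum.distrib[symmetric] using letter_le_s_max s_max_nonneg by (intro sum_mono) auto
  then show ?thesis using le_sum_letters[OF assms] by (simp add: algebra_simps)
qed

lemma (in markov_potential) continuous_add_letters:
  assumes "n \<ge> 1"
  shows "continuous_on (shift_space M) (\<lambda>x. f n x + (\<Sum>j<n. if N \<le> x j then - s (x j) else 0))"
  by (intro continuous_on_add continuous[OF assms] continuous_on_sum
      continuous_on_coordinate[where g="\<lambda>v. if N \<le> v then - s v else 0"])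

section \<open>Comparison with the equilibrium states\<close>

context mixing_potential
begin

lemma mixing_potential_measure:
  assumes "\<nu> \<in> invariant_measures M"
  shows "mixing_potential_measure M f C s \<nu>"
  using invariant_measures_shift_measure[OF assms] mixing_potential_axioms markov_potential_axioms
  by (simp add: mixing_potential_measure_def potential_measure_def)

definition finite_energy :: "(nat \<Rightarrow> nat) measure \<Rightarrow> real \<Rightarrow> real \<Rightarrow> bool" where
  "finite_energy \<nu> L h \<longleftrightarrow> \<nu> \<in> invariant_measures M \<and> integrable \<nu> (f 1) \<and>
    mean_value f \<nu> = ereal L \<and> ks_entropy \<nu> shift_map = ereal h \<and> h \<ge> 0 \<and>
    (\<forall>n\<ge>1. \<bar>(\<integral>x. f n x \<partial>\<nu>) - L * real n\<bar> \<le> C)"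

lemma finite_energyI:
  assumes "\<nu> \<in> invariant_measures M" "integrable \<nu> (f 1)"
  obtains L h where "finite_energy \<nu> L h"
proof -
  interpret mixing_potential_measure M f C s a \<nu> by (rule mixing_potential_measure[OF assms(1)])
  obtain L where "mean_value f \<nu> = ereal L" "\<And>n. n \<ge> 1 \<Longrightarrow> \<bar>(\<integral>x. f n x \<partial>\<nu>) - L * real n\<bar> \<le> C"
    using mean_value_integrable[OF assms(2)] by metis
  moreover obtain h where "ks_entropy \<nu> shift_map = ereal h" "h \<ge> 0" by (rule ks_entropy_real[OF assms(2)])
  ultimately show ?thesis using assms that unfolding finite_energy_def by blast
qed

lemma mean_value_cases:
  assumes "\<nu> \<in> invariant_measures M"
  obtains "mean_value f \<nu> = - \<infinity>" | L h where "finite_energy \<nu> L h"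
proof (cases "integrable \<nu> (f 1)")
  case True
  then show ?thesis using finite_energyI[OF assms] that(2) by blast
next
  case False
  interpret mixing_potential_measure M f C s a \<nu> by (rule mixing_potential_measure[OF assms])
  show ?thesis using mean_value_not_integrable[OF False] that(1) by blast
qed

text \<open>The variational inequality for the scaled potential. Its mean value is first obtained as
  an abstract limit and identified with \<open>t * L\<close> by uniqueness of limits.\<close>

lemma pressure_ge:
  assumes \<nu>: "finite_energy \<nu> L h" and t: "t \<ge> 1"
  obtains P where "gurevich_pressure M a (\<lambda>n x. t * f n x) = ereal P" "h + t * L \<le> P"
proof -
  have inv: "\<nu> \<in> invariant_measures M" and f1: "integrable \<nu> (f 1)"
    and L: "mean_value f \<nu> = ereal L" and h: "ks_entropy \<nu> shift_map = ereal h"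
    using \<nu> by (auto simp: finite_energy_def)
  interpret unscaled: mixing_potential_measure M f C s a \<nu> by (rule mixing_potential_measure[OF inv])
  interpret scaled: markov_potential M "\<lambda>n x. t * f n x" "t * C" "\<lambda>i. t * s i" by (rule scale[OF t])
  interpret scaled: mixing_potential M "\<lambda>n x. t * f n x" "t * C" "\<lambda>i. t * s i" a
    by unfold_locales (rule mixing)
  interpret scaled: mixing_potential_measure M "\<lambda>n x. t * f n x" "t * C" "\<lambda>i. t * s i" a \<nu>
    by (rule scaled.mixing_potential_measure[OF inv])
  have f1': "integrable \<nu> (\<lambda>x. t * f 1 x)" using f1 by simp
  obtain L' where L': "mean_value (\<lambda>n x. t * f n x) \<nu> = ereal L'" "(\<lambda>n. (\<integral>x. t * f n x \<partial>\<nu>) / real n) \<longlonglongrightarrow> L'"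
    using scaled.mean_value_integrable[OF f1'] by metis
  have "(\<lambda>n. (\<integral>x. f n x \<partial>\<nu>) / real n) \<longlonglongrightarrow> L"
    using unscaled.mean_value_integrable[OF f1] L by (metis ereal.inject)
  then have "(\<lambda>n. t * ((\<integral>x. f n x \<partial>\<nu>) / real n)) \<longlonglongrightarrow> t * L" by (rule tendsto_mult_left)
  then have "L' = t * L" using LIMSEQ_unique[OF L'(2)] by simp
  then show ?thesis
    using scaled.ks_entropy_add_mean_value_le[OF f1' L'(1) h] that by metis
qed

theorem entropy_limit:
  fixes \<mu> :: "real \<Rightarrow> (nat \<Rightarrow> nat) measure" and \<mu>' :: "(nat \<Rightarrow> nat) measure"
  assumes eq: "\<And>t. t > 1 \<Longrightarrow> equilibrium_state M a f t (\<mu> t)"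
    and acc: "accumulation_point_at_infinity M \<mu> \<mu>'"
  shows "((\<lambda>t. ks_entropy (\<mu> t) shift_map) \<longlongrightarrow> ks_entropy \<mu>' shift_map) at_top"
    and "ks_entropy \<mu>' shift_map = (SUP \<nu>\<in>maximising_measures M f. ks_entropy \<nu> shift_map)"
proof -
  have inv: "\<mu> t \<in> invariant_measures M" if "t > 1" for t
    using eq[OF that] by (simp add: equilibrium_state_def)
  have "\<exists>L h. finite_energy (\<mu> t) L h" if t: "t > 1" for t
    using inv[OF t]
  proof (cases rule: mean_value_cases)
    case 1
    then show ?thesis using eq[OF t] by (simp add: equilibrium_state_def)
  qed blast
  then obtain F h where fe: "\<And>t. t > 1 \<Longrightarrow> finite_energy (\<mu> t) (F t) (h t)" by metis
  have h_nonneg: "h t \<ge> 0" if "t > 1" for t using fe[OF that] by (simp add: finite_energy_def)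
  have vp: "h' + t * L \<le> h t + t * F t" if t: "t > 1" and \<nu>: "finite_energy \<nu> L h'" for t \<nu> L h'
  proof -
    obtain P where "gurevich_pressure M a (\<lambda>n x. t * f n x) = ereal P" "h' + t * L \<le> P"
      using pressure_ge[OF \<nu>, of t] t by auto
    then show ?thesis
      using eq[OF t] fe[OF t] by (simp add: equilibrium_state_def finite_energy_def)
  qed
  have antimono: "h u \<le> h t" if t: "1 < t" "t \<le> u" for t u
  proof (cases "t = u")
    case False
    \<comment> \<open>Each of the two states is tested at the parameter of the other; adding the
      inequalities cancels the entropies and shows that \<open>F\<close> increases.\<close>
    have 1: "h u + t * F u \<le> h t + t * F t" "h t + u * F t \<le> h u + u * F u"
      using vp[OF _ fe] t by auto
    then have "(u - t) * (F u - F t) \<ge> 0" by (simp add: algebra_simps)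
    then have "F u \<ge> F t" using False t by (simp add: zero_le_mult_iff)
    then have "t * F t \<le> t * F u" using t by (intro mult_left_mono) auto
    then show ?thesis using 1(1) by simp
  qed simp
  \<comment> \<open>Entropy decreases in the parameter, so \<open>h 2\<close> bounds it from 2 on
    and its effect on the mean value is of order \<open>1 / t\<close>.\<close>
  have F_ge: "F t \<ge> L - h 2 / t" if t: "t \<ge> 2" and \<nu>: "finite_energy \<nu> L h'" for t \<nu> L h'
  proof -
    have "h' + t * L \<le> h t + t * F t" using vp[OF _ \<nu>, of t] t by simp
    moreover have "h t \<le> h 2" using antimono[of 2 t] t by simp
    moreover have "h' \<ge> 0" using \<nu> by (simp add: finite_energy_def)
    ultimately have "t * (L - F t) \<le> h 2" by (simp add: algebra_simps)
    then have "L - F t \<le> h 2 / t" using t by (simp add: pos_le_divide_eq mult.commute)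
    then show ?thesis by simp
  qed
  obtain t where t: "\<And>k. t k > 1" "filterlim t at_top sequentially" and weak: "weakly_converges M (\<lambda>k. \<mu> (t k)) \<mu>'"
    and inv': "\<mu>' \<in> invariant_measures M"
    using acc unfolding accumulation_point_at_infinity_def by blast
  have sm: "shift_measure (\<mu> (t k)) M" for k using inv[OF t(1)] by (rule invariant_measures_shift_measure)
  have sm': "shift_measure \<mu>' M" using inv' by (rule invariant_measures_shift_measure)
  have f1: "integrable (\<mu> (t k)) (f 1)" for k using fe[OF t(1)] by (simp add: finite_energy_def)
  interpret mk: mixing_potential_measure M f C s a "\<mu> (t k)" for k
    by (rule mixing_potential_measure[OF inv[OF t(1)]])
  interpret m': mixing_potential_measure M f C s a \<mu>' by (rule mixing_potential_measure[OF inv'])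
  \<comment> \<open>\<open>C\<close> is the error in replacing \<open>n F\<close> by the integral of
    \<open>f n\<close>; the 1 absorbs \<open>n * h 2 / t k\<close>, which is small for fixed
    \<open>n\<close> and large \<open>k\<close>.\<close>
  have int_ge: "eventually (\<lambda>k. (\<integral>x. f n x \<partial>\<mu> (t k)) \<ge> real n * L - C - 1) sequentially"
    if n: "n \<ge> 1" and \<nu>: "finite_energy \<nu> L h'" for n \<nu> L h'
  proof -
    have "((\<lambda>k. real n * (h 2 / t k)) \<longlongrightarrow> real n * 0) sequentially"
      by (intro tendsto_mult tendsto_const tendsto_divide_0[OF tendsto_const] filterlim_at_top_imp_at_infinity t)
    then have "eventually (\<lambda>k. real n * (h 2 / t k) < 1) sequentially" by (rule order_tendstoD) simp
    moreover have "eventually (\<lambda>k. t k \<ge> 2) sequentially" using t(2) by (simp add: filterlim_at_top)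
    ultimately show ?thesis
    proof eventually_elim
      case (elim k)
      have "real n * (L - h 2 / t k) \<le> real n * F (t k)" using F_ge[OF elim(2) \<nu>] by (intro mult_left_mono) auto
      moreover have "\<bar>(\<integral>x. f n x \<partial>\<mu> (t k)) - F (t k) * real n\<bar> \<le> C"
        using fe[OF t(1)] n by (simp add: finite_energy_def)
      ultimately show ?case using elim(1) by (simp add: algebra_simps)
    qed
  qed
  have limit_int: "integrable \<mu>' (f n)" "(\<integral>x. f n x \<partial>\<mu>') \<ge> real n * L - C - 1"
    if n: "n \<ge> 1" and \<nu>: "finite_energy \<nu> L h'" for n \<nu> L h'
    using weakly_converges_integral_ge[OF sm sm' weak continuous[OF n] le_const[OF n] mk.integrable_f[OF f1 n]
        eventually_frequently[OF trivial_limit_sequentially int_ge[OF n \<nu>]]] by blast+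
  \<comment> \<open>Any measure of finite energy can serve as the comparison here;
    \<open>\<mu> 2\<close> is one at hand.\<close>
  have f1': "integrable \<mu>' (f 1)" using limit_int(1)[OF _ fe[of 2]] by simp
  obtain L' h' where fe': "finite_energy \<mu>' L' h'" using finite_energyI[OF inv' f1'] .
  \<comment> \<open>The errors total \<open>2 * C + 1\<close> whatever \<open>n\<close> is, while a
    gap between \<open>L\<close> and \<open>L'\<close> would be multiplied by
    \<open>n\<close>.\<close>
  have L'_ge: "L \<le> L'" if \<nu>: "finite_energy \<nu> L h''" for \<nu> L h''
  proof (rule ccontr)
    assume "\<not> L \<le> L'"
    then obtain n where n: "2 * C + 1 < real n * (L - L')"
      using reals_Archimedean3[of "L - L'"] by auto
    then have "n \<ge> 1" using C_nonneg by (cases n) auto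
    then have "real n * L - C - 1 \<le> (\<integral>x. f n x \<partial>\<mu>')" "\<bar>(\<integral>x. f n x \<partial>\<mu>') - L' * real n\<bar> \<le> C"
      using limit_int(2)[OF _ \<nu>, of n] fe' by (auto simp: finite_energy_def)
    then show False using n by (simp add: algebra_simps)
  qed
  have max_eq: "(SUP \<nu>\<in>invariant_measures M. mean_value f \<nu>) = ereal L'"
  proof (rule antisym)
    show "(SUP \<nu>\<in>invariant_measures M. mean_value f \<nu>) \<le> ereal L'"
    proof (rule SUP_least)
      fix \<nu> assume "\<nu> \<in> invariant_measures M"
      then show "mean_value f \<nu> \<le> ereal L'"
      proof (cases rule: mean_value_cases)
        case (2 L h'')
        then show ?thesis using L'_ge[OF 2] by (simp add: finite_energy_def)
      qed simp
    qed
    have "mean_value f \<mu>' = ereal L'" using fe' by (simp add: finite_energy_def)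
    then show "ereal L' \<le> (SUP \<nu>\<in>invariant_measures M. mean_value f \<nu>)"
      using SUP_upper[OF inv', of "mean_value f"] by simp
  qed
  have \<mu>'_max: "\<mu>' \<in> maximising_measures M f"
    using fe' max_eq by (simp add: maximising_measures_def finite_energy_def)
  have le_h: "ks_entropy \<nu> shift_map \<le> ereal (h u)" if \<nu>: "\<nu> \<in> maximising_measures M f" and u: "u > 1" for \<nu> u
  proof -
    have \<nu>inv: "\<nu> \<in> invariant_measures M" and mv: "mean_value f \<nu> = ereal L'"
      using \<nu> max_eq by (auto simp: maximising_measures_def)
    from \<nu>inv show ?thesis
    proof (cases rule: mean_value_cases)
      case (2 L h'')
      then have "L = L'" using mv by (simp add: finite_energy_def)
      have "h'' + u * L' \<le> h u + u * F u" using vp[OF u 2] \<open>L = L'\<close> by simp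
      \<comment> \<open>No equilibrium state exceeds the maximal mean value, so the energy terms
        cancel in the favourable direction.\<close>
      moreover have "u * F u \<le> u * L'" using L'_ge[OF fe[OF u]] u by (intro mult_left_mono) auto
      ultimately show ?thesis using 2 by (simp add: finite_energy_def)
    qed (use mv in simp)
  qed
  have h'_le: "h' \<le> h u" if "u > 1" for u
    using le_h[OF \<mu>'_max that] fe' by (simp add: finite_energy_def)
  \<comment> \<open>Moving the letters \<open>\<ge> N\<close> out of \<open>f n\<close> leaves a function \<open>g\<close> that is still bounded above, so its
    integral is upper semicontinuous; the error \<open>2 * C + 1\<close> is independent of \<open>n\<close>.\<close>
  have tail: "eventually (\<lambda>k. mk.letter_tail k N < m'.letter_tail N + \<epsilon>) sequentially" if "\<epsilon> > 0" for \<epsilon> N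
  proof (rule ccontr)
    assume "\<not> eventually (\<lambda>k. mk.letter_tail k N < m'.letter_tail N + \<epsilon>) sequentially"
    then have freq: "\<exists>\<^sub>F k in sequentially. m'.letter_tail N + \<epsilon> \<le> mk.letter_tail k N"
      by (simp add: frequently_def not_le)
    obtain n where n: "2 * C + 1 < real n * \<epsilon>" using reals_Archimedean3[OF \<open>\<epsilon> > 0\<close>] by auto
    then have n1: "n \<ge> 1" using C_nonneg by (cases n) auto
    define g where "g x = f n x + (\<Sum>j<n. if N \<le> x j then - s (x j) else 0)" for x
    define c where "c = real n * L' - C - 1 + real n * (m'.letter_tail N + \<epsilon>)"
    have "\<exists>\<^sub>F k in sequentially. m'.letter_tail N + \<epsilon> \<le> mk.letter_tail k N \<and>
        (\<integral>x. f n x \<partial>\<mu> (t k)) \<ge> real n * L' - C - 1"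
      using freq int_ge[OF n1 fe'] by (rule frequently_eventually_frequently)
    then have freq': "\<exists>\<^sub>F k in sequentially. (\<integral>x. g x \<partial>\<mu> (t k)) \<ge> c"
    proof (rule frequently_elim1)
      fix k assume k: "m'.letter_tail N + \<epsilon> \<le> mk.letter_tail k N \<and> (\<integral>x. f n x \<partial>\<mu> (t k)) \<ge> real n * L' - C - 1"
      then have "real n * (m'.letter_tail N + \<epsilon>) \<le> real n * mk.letter_tail k N" by (intro mult_left_mono) auto
      then show "(\<integral>x. g x \<partial>\<mu> (t k)) \<ge> c"
        using mk.integral_add_letters(2)[OF f1 n1, where N=N] k unfolding g_def c_def by simp
    qed
    have cont: "continuous_on (shift_space M) g" unfolding g_def by (rule continuous_add_letters[OF n1])
    have bd: "g x \<le> real n * (s_max + C)" if "x \<in> shift_space M" for x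
      unfolding g_def by (rule add_letters_le[OF n1 that])
    have ig: "integrable (\<mu> (t k)) g" for k
      using mk.integral_add_letters(1)[OF f1 n1, where N=N] unfolding g_def .
    have "(\<integral>x. g x \<partial>\<mu>') \<ge> c"
      by (rule weakly_converges_integral_ge(2)[OF sm sm' weak cont bd ig freq'])
    moreover have "(\<integral>x. g x \<partial>\<mu>') = (\<integral>x. f n x \<partial>\<mu>') + real n * m'.letter_tail N"
      using m'.integral_add_letters(2)[OF f1' n1, where N=N] unfolding g_def .
    moreover have "\<bar>(\<integral>x. f n x \<partial>\<mu>') - L' * real n\<bar> \<le> C" using fe' n1 by (simp add: finite_energy_def)
    ultimately show False using n unfolding c_def by (simp add: algebra_simps)
  qed
  \<comment> \<open>The five errors are: block entropy against entropy rate for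
    \<open>\<mu>'\<close>, block entropies along the sequence, the letter tail of
    \<open>\<mu>'\<close>, the change of that tail along the sequence, and the tail of the
    series.\<close>
  have usc: "\<exists>k. h (t k) < h' + 5 * \<epsilon>" if \<epsilon>: "\<epsilon> > 0" for \<epsilon>
  proof -
    obtain N1 where N1: "\<And>i. i \<ge> N1 \<Longrightarrow> s i \<le> 0"
      using eventually_letter_le[of 0] by (auto simp: eventually_sequentially)
    obtain N2 where N2: "\<And>n. n \<ge> N2 \<Longrightarrow> norm (\<Sum>i. exp (s (i + n))) < \<epsilon>"
      using suminf_exist_split[OF \<epsilon> summable_exp] by blast
    have "eventually (\<lambda>N. m'.letter_tail N < \<epsilon>) sequentially"
      using m'.letter_tail_tendsto_0[OF f1'] \<epsilon> by (rule order_tendstoD)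
    then obtain N3 where N3: "\<And>n. n \<ge> N3 \<Longrightarrow> m'.letter_tail n < \<epsilon>" by (auto simp: eventually_sequentially)
    define N where "N = Max {N1, N2, N3}"
    have N: "N \<ge> N1" "N \<ge> N2" "N \<ge> N3" by (auto simp: N_def)
    have rate': "entropy_rate \<mu>' shift_map (letter N) \<le> h'"
      using m'.entropy_rate_le_ks_entropy[OF m'.simple_function_letter, of N] fe' by (simp add: finite_energy_def)
    have "eventually (\<lambda>n. shannon_entropy \<mu>' (block N n) / real n < entropy_rate \<mu>' shift_map (letter N) + \<epsilon>) sequentially"
      using m'.entropy_rate_tendsto[OF m'.simple_function_letter, of N] by (rule order_tendstoD) (use \<epsilon> in simp)
    then have "eventually (\<lambda>n. n \<ge> 1 \<and> shannon_entropy \<mu>' (block N n) / real n < entropy_rate \<mu>' shift_map (letter N) + \<epsilon>) sequentially"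
      using eventually_ge_at_top[of 1] by eventually_elim simp
    \<comment> \<open>The length \<open>n\<close> is fixed before \<open>k\<close>: block entropy at
      a fixed length is continuous along the sequence, and divided by \<open>n\<close> it bounds the
      entropy rate of every measure from above.\<close>
    then obtain n where n: "n \<ge> 1" "shannon_entropy \<mu>' (block N n) / real n < entropy_rate \<mu>' shift_map (letter N) + \<epsilon>"
      by (auto simp: eventually_sequentially)
    have "(\<lambda>k. shannon_entropy (\<mu> (t k)) (block N n) / real n) \<longlonglongrightarrow> shannon_entropy \<mu>' (block N n) / real n"
      using n by (intro tendsto_divide tendsto_entropy_block[OF sm sm' weak] tendsto_const) auto
    then have "eventually (\<lambda>k. shannon_entropy (\<mu> (t k)) (block N n) / real n < shannon_entropy \<mu>' (block N n) / real n + \<epsilon>) sequentially"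
      by (rule order_tendstoD) (use \<epsilon> in simp)
    moreover have "eventually (\<lambda>k. mk.letter_tail k N < m'.letter_tail N + \<epsilon>) sequentially"
      by (rule tail[OF \<epsilon>])
    ultimately have "eventually (\<lambda>k. h (t k) < h' + 5 * \<epsilon>) sequentially"
    proof eventually_elim
      case (elim k)
      have "ks_entropy (\<mu> (t k)) shift_map \<le> ereal (entropy_rate (\<mu> (t k)) shift_map (letter N)
          + mk.letter_tail k N + (\<Sum>i. exp (s (i + N))))"
        unfolding mk.letter_tail_def using N1 N by (intro mk.ks_entropy_le_letter_tail[OF f1]) auto
      then have "h (t k) \<le> entropy_rate (\<mu> (t k)) shift_map (letter N) + mk.letter_tail k N + (\<Sum>i. exp (s (i + N)))"
        using fe[OF t(1)] by (simp add: finite_energy_def)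
      moreover have "entropy_rate (\<mu> (t k)) shift_map (letter N) \<le> shannon_entropy (\<mu> (t k)) (block N n) / real n"
        using mk.entropy_rate_le[OF mk.simple_function_letter, of n k N] n by (simp add: pos_le_divide_eq)
      moreover have "(\<Sum>i. exp (s (i + N))) < \<epsilon>" using N2[of N] N by simp
      ultimately show ?case using elim n(2) rate' N3[of N] N by simp
    qed
    then show ?thesis by (auto simp: eventually_sequentially)
  qed
  have ks': "ks_entropy \<mu>' shift_map = ereal h'" using fe' by (simp add: finite_energy_def)
  have "(h \<longlongrightarrow> h') at_top"
  proof (rule order_tendstoI)
    fix y assume "y < h'"
    show "eventually (\<lambda>u. y < h u) at_top"
      using eventually_gt_at_top[of "1::real"]
      by eventually_elim (rule less_le_trans[OF \<open>y < h'\<close> h'_le])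
  next
    fix y assume y: "h' < y"
    then obtain k where "h (t k) < h' + 5 * ((y - h') / 5)" using usc[of "(y - h') / 5"] by auto
    then have k: "h (t k) < y" by (simp add: field_simps)
    \<comment> \<open>Monotonicity lets the single parameter \<open>t k\<close> control all larger
      ones.\<close>
    show "eventually (\<lambda>u. h u < y) at_top"
      using eventually_ge_at_top[of "t k"]
    proof eventually_elim
      case (elim u)
      then show ?case using antimono[OF t(1) elim] k by simp
    qed
  qed
  then have "((\<lambda>u. ereal (h u)) \<longlongrightarrow> ereal h') at_top" by simp
  then show "((\<lambda>u. ks_entropy (\<mu> u) shift_map) \<longlongrightarrow> ks_entropy \<mu>' shift_map) at_top"
    unfolding ks'
  proof (rule Lim_transform_eventually)
    show "eventually (\<lambda>u. ereal (h u) = ks_entropy (\<mu> u) shift_map) at_top"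
      using eventually_gt_at_top[of "1::real"] by eventually_elim (use fe in \<open>simp add: finite_energy_def\<close>)
  qed
  show "ks_entropy \<mu>' shift_map = (SUP \<nu>\<in>maximising_measures M f. ks_entropy \<nu> shift_map)"
  proof (rule antisym)
    show "ks_entropy \<mu>' shift_map \<le> (SUP \<nu>\<in>maximising_measures M f. ks_entropy \<nu> shift_map)"
      using \<mu>'_max by (rule SUP_upper)
    show "(SUP \<nu>\<in>maximising_measures M f. ks_entropy \<nu> shift_map) \<le> ks_entropy \<mu>' shift_map"
    proof (rule SUP_least)
      fix \<nu> assume \<nu>: "\<nu> \<in> maximising_measures M f"
      show "ks_entropy \<nu> shift_map \<le> ks_entropy \<mu>' shift_map"
      proof (rule tendsto_lowerbound)
        show "((\<lambda>u. ereal (h u)) \<longlongrightarrow> ks_entropy \<mu>' shift_map) at_top"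
          unfolding ks' by fact
        show "eventually (\<lambda>u. ks_entropy \<nu> shift_map \<le> ereal (h u)) at_top"
          using eventually_gt_at_top[of "1::real"] by eventually_elim (rule le_h[OF \<nu>])
      qed simp
    qed
  qed
qed

end

section \<open>Transfer to the original hypotheses\<close>

lemma mixing_potentialI:
  assumes mix: "topologically_mixing M" and cont: "continuous_potential M f" and aa: "almost_additive M f"
    and sum: "summable_potential M f" and bv: "bounded_variation M f"
  obtains C s where "mixing_potential M f C s"
proof -
  obtain C1 where C1: "C1 \<ge> 0" "\<And>n m x. n \<ge> 1 \<Longrightarrow> m \<ge> 1 \<Longrightarrow> x \<in> shift_space M \<Longrightarrow>
      f n x + f m ((shift_map ^^ n) x) - C1 \<le> f (n + m) x \<and> f (n + m) x \<le> f n x + f m ((shift_map ^^ n) x) + C1"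
    using aa unfolding almost_additive_def by blast
  obtain C2 where C2: "\<And>n x y. n \<ge> 1 \<Longrightarrow> x \<in> shift_space M \<Longrightarrow> y \<in> shift_space M \<Longrightarrow>
      (\<forall>i<n. x i = y i) \<Longrightarrow> \<bar>f n x - f n y\<bar> \<le> C2"
    using bv unfolding bounded_variation_def by blast
  define s where "s i = (SUP x\<in>cylinder M [i]. f 1 x)" for i
  have "mixing_potential M f (max C1 C2) s"
  proof
    fix n :: nat assume n: "n \<ge> 1"
    show "continuous_on (shift_space M) (f n)" using cont n by (simp add: continuous_potential_def)
    fix x :: "nat \<Rightarrow> nat" assume x: "x \<in> shift_space M"
    show "\<bar>f n x - f n y\<bar> \<le> max C1 C2" if "y \<in> shift_space M" "\<And>i. i < n \<Longrightarrow> x i = y i" for y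
      using C2[OF n x that(1)] that(2) by force
    fix m :: nat assume m: "m \<ge> 1"
    show "f (n + m) x \<le> f n x + f m ((shift_map ^^ n) x) + max C1 C2"
      using C1(2)[OF n m x] max.cobounded1[of C1 C2] by linarith
    show "f n x + f m ((shift_map ^^ n) x) - max C1 C2 \<le> f (n + m) x"
      using C1(2)[OF n m x] max.cobounded1[of C1 C2] by linarith
  next
    show "f 1 x \<le> s (x 0)" if "x \<in> shift_space M" for x
      unfolding s_def using that sum by (intro cSUP_upper) (auto simp: cylinder_def summable_potential_def)
  next
    show "summable (\<lambda>i. exp (s i))" unfolding s_def using sum by (simp add: summable_potential_def)
  qed (use C1 mix in auto)
  then show ?thesis by (rule that)
qed

theorem theorem1p4:
  fixes M :: "nat \<Rightarrow> nat \<Rightarrow> nat"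
    and f :: "nat \<Rightarrow> (nat \<Rightarrow> nat) \<Rightarrow> real"
    and a :: nat
    and \<mu> :: "real \<Rightarrow> (nat \<Rightarrow> nat) measure"
    and \<mu>_inf :: "(nat \<Rightarrow> nat) measure"
  assumes "transition_matrix M"
    and "topologically_mixing M"
    and "continuous_potential M f"
    and "almost_additive M f"
    and "summable_potential M f"
    and "bounded_variation M f"
    and "\<And>t. t > 1 \<Longrightarrow> equilibrium_state M a f t (\<mu> t)"
    and "accumulation_point_at_infinity M \<mu> \<mu>_inf"
  shows "((\<lambda>t. ks_entropy (\<mu> t) shift_map) \<longlongrightarrow> ks_entropy \<mu>_inf shift_map) at_top \<and>
    ks_entropy \<mu>_inf shift_map = (SUP \<nu>\<in>maximising_measures M f. ks_entropy \<nu> shift_map)"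
proof -
  obtain C s where "mixing_potential M f C s"
    using mixing_potentialI[OF assms(2-6)] .
  then interpret mixing_potential M f C s a by simp
  show ?thesis using entropy_limit[OF assms(7,8)] by blast
qed

end
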